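(* Let $X$ be a complex manifold and let $f\in\mathscr{O}_X$ be a reduced, non-zero, non-invertible global holomorphic function. For each non-negative integer $k$, $$F_k^H\mathscr{O}_X( *f)=\left(\partial_t F_k^H i_{f,+}\mathscr{O}_X( *f)+V^0 i_{f,+}\mathscr{O}_X( *f)\right)\cap\left(\mathscr{O}_X( *f)\delta\right)=\left(\partial_t F_{k-1}^{t\text{-ord}} i_{f,+}\mathscr{O}_X( *f)+V^0 i_{f,+}\mathscr{O}_X( *f)\right)\cap\left(\mathscr{O}_X( *f)\delta\right),$$ where the two intersections take place in $\mathscr{O}_X( *f)[\partial_t]\delta\simeq i_{f,+}\mathscr{O}_X( *f)$, and $F_k^H\mathscr{O}_X( *f)$ is identified with $F_k^H\mathscr{O}_X( *f)\,\delta$.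
   Context: $X$ is a complex manifold of dimension $n$, $\mathscr{O}_X$ the sheaf of holomorphic functions, $\mathscr{D}_X$ the sheaf of holomorphic differential operators; "$f\in\mathscr{O}_X$" means a global section. $\mathscr{O}_X( *f)$ is the left $\mathscr{D}_X$-module of meromorphic functions with poles along $D=\{f=0\}$. Graph embedding: $i_f:X\to X\times\mathbb{C}_t$, $x\mapsto(x,f(x))$, $t$ the coordinate on $\mathbb{C}$. For a left $\mathscr{D}_X$-module $\mathscr{M}$, the $\mathscr{D}$-module direct image $i_{f,+}\mathscr{M}$ is identified with $\mathscr{M}[\partial_t]\delta=\bigoplus_{k\ge0}\mathscr{M}\,\partial_t^k\delta$, with $\mathscr{D}_{X\times\mathbb{C}_t}$-action in local coordinates: $g(x,t)\cdot(m\delta)=(g(x,f)m)\delta$; $\partial_{x_i}\cdot(m\partial_t^k\delta)=(\partial_{x_i}m)\partial_t^k\delta-(\partial_{x_i}(f)m)\partial_t^{k+1}\delta$; $t\cdot(m\partial_t^k\delta)=(fm)\partial_t^k\delta-km\,\partial_t^{k-1}\delta$; $\partial_t\cdot(m\partial_t^k\delta)=m\partial_t^{k+1}\delta$. $t$-order filtration: $F_k^{t\text{-ord}}i_{f,+}\mathscr{M}=\sum_{i=0}^k\mathscr{M}\partial_t^i\delta$ (and $0$ for $k<0$). Kashiwara–Malgrange $V$-filtration: $V^\bullet i_{f,+}\mathscr{M}$ (for $\mathscr{M}=\mathscr{O}_X$ or $\mathscr{O}_X( *f)$) is the unique rational, decreasing, exhaustive, discrete, left-continuous filtration such that for every $\gamma\in\mathbb{Q}$: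 $V^\gamma$ is coherent over the ring $\{P\in\mathscr{D}_{X\times\mathbb{C}_t}: P\cdot(t^i)\subseteq(t^i)\ \forall i\ge0\}$; $tV^\gamma\subseteq V^{\gamma+1}$ with equality if $\gamma>0$; $\partial_tV^\gamma\subseteq V^{\gamma-1}$; $\partial_tt-\gamma$ acts nilpotently on $V^\gamma/V^{>\gamma}$. Hodge filtration: with $j:U=X\setminus D\to X$ the open embedding, $F^H_\bullet\mathscr{O}_X( *f)$ is the Hodge filtration underlying the mixed Hodge module $j_*\mathbb{Q}_U^H[n]$ (indexed so that $F^H_{-1}=0$), and $F_\bullet^Hi_{f,+}\mathscr{O}_X( *f)$ is the Hodge filtration underlying $i_{f,*}j_*\mathbb{Q}_U^H[n]$, so that $F_{k+1}^Hi_{f,+}\mathscr{O}_X( *f)=\sum_{j\ge0}F_{k-j}^H\mathscr{O}_X( *f)\,\partial_t^j\delta$. By Mustaţă–Popa one may take as definition, for $k\ge0$: $F_k^H\mathscr{O}_X( *f)=\{\sum_{j=0}^kj!f^{-j-1}v_j: v_j\in\mathscr{O}_X,\ \sum_{j=0}^kv_j\partial_t^j\delta\in V^1i_{f,+}\mathscr{O}_X\}$. *)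

theory Defs
  imports "HOL-Analysis.Analysis"
begin

text \<open>
  Conventions.  A section over an open set of a sheaf of functions is represented by a total
  function, only its values on that open set being meaningful.  Meromorphic functions
  with poles along the zero set of \<open>f\<close> are functions whose values on the zero set are
  disregarded.  To treat both sheaves uniformly, the definitions below carry a closed set
  \<open>E\<close> of disregarded points: two representatives over \<open>U\<close> are equal as sections iff
  they agree on \<open>U - E\<close>, where \<open>E\<close> is empty for \<open>O\<^sub>X\<close> and the zero set
  of \<open>f\<close> for \<open>O\<^sub>X(*f)\<close>.
\<close>

section \<open>Complex manifolds, holomorphic and meromorphic functions\<close>

definition cdiff_at :: "(complex ^ 'm::finite \<Rightarrow> complex) \<Rightarrow> complex ^ 'm \<Rightarrow> bool" where
  "cdiff_at g z \<longleftrightarrow>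
     (\<exists>L. (g has_derivative L) (at z) \<and> (\<forall>c v. L (c *s v) = c * L v))"

type_synonym ('y, 'm) chart = "'y set \<times> ('y \<Rightarrow> complex ^ 'm)"

definition is_chart :: "('y::topological_space, 'm::finite) chart \<Rightarrow> bool" where
  "is_chart c \<longleftrightarrow> (case c of (U, \<phi>) \<Rightarrow>
     open U \<and> open (\<phi> ` U) \<and> homeomorphism U (\<phi> ` U) \<phi> (inv_into U \<phi>))"

text \<open>The manifold is the whole type, and its dimension is \<open>CARD('m)\<close>.\<close>

definition complex_manifold ::
    "('y::{t2_space,second_countable_topology}, 'm::finite) chart set \<Rightarrow> bool" where
  "complex_manifold A \<longleftrightarrow>
     (\<forall>c\<in>A. is_chart c) \<and> (\<Union>c\<in>A. fst c) = UNIV \<and>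
     (\<forall>(U, \<phi>)\<in>A. \<forall>(V, \<psi>)\<in>A. \<forall>z\<in>\<phi> ` (U \<inter> V). \<forall>i.
        cdiff_at (\<lambda>z. \<psi> (inv_into U \<phi> z) $ i) z)"

definition hol_sheaf ::
    "('y::topological_space, 'm::finite) chart set \<Rightarrow> 'y set \<Rightarrow> ('y \<Rightarrow> complex) set" where
  "hol_sheaf A W =
     {g. \<forall>(U, \<phi>)\<in>A. \<forall>y\<in>U \<inter> W. cdiff_at (\<lambda>z. g (inv_into U \<phi> z)) (\<phi> y)}"

definition zero_set :: "('y \<Rightarrow> complex) \<Rightarrow> 'y set" where
  "zero_set f = {y. f y = 0}"

definition mer_sheaf ::
    "('y::topological_space, 'm::finite) chart set \<Rightarrow> ('y \<Rightarrow> complex) \<Rightarrow> 'y set \<Rightarrow> ('y \<Rightarrow> complex) set"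
    where
  "mer_sheaf A f W =
     {g. \<forall>x\<in>W. \<exists>W' r h. open W' \<and> x \<in> W' \<and> W' \<subseteq> W \<and> h \<in> hol_sheaf A W' \<and>
           (\<forall>y\<in>W' - zero_set f. g y = h y / f y ^ r)}"

text \<open>All local rings \<open>O\<^sub>X\<^sub>,\<^sub>x / (f)\<close> are reduced.\<close>

definition reduced_fun ::
    "('y::topological_space, 'm::finite) chart set \<Rightarrow> ('y \<Rightarrow> complex) \<Rightarrow> bool" where
  "reduced_fun A f \<longleftrightarrow>
     (\<forall>x W g h r. open W \<and> x \<in> W \<and> g \<in> hol_sheaf A W \<and> h \<in> hol_sheaf A W \<and>
          (\<forall>y\<in>W. g y ^ r = f y * h y) \<longrightarrow>
        (\<exists>W' h'. open W' \<and> x \<in> W' \<and> W' \<subseteq> W \<and> h' \<in> hol_sheaf A W' \<and>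
          (\<forall>y\<in>W'. g y = f y * h' y)))"

definition invertible_fun ::
    "('y::topological_space, 'm::finite) chart set \<Rightarrow> ('y \<Rightarrow> complex) \<Rightarrow> bool" where
  "invertible_fun A f \<longleftrightarrow> (\<exists>g\<in>hol_sheaf A UNIV. \<forall>y. f y * g y = 1)"

definition pd :: "('y, 'm::finite) chart \<Rightarrow> 'm \<Rightarrow> ('y \<Rightarrow> complex) \<Rightarrow> 'y \<Rightarrow> complex" where
  "pd c i g y = (case c of (U, \<phi>) \<Rightarrow>
     deriv (\<lambda>z. g (inv_into U \<phi> (\<phi> y + axis i z))) 0)"

section \<open>Differential operators on \<open>X \<times> \<complex>\<close>\<close>

text \<open>The coordinate of index \<^term>\<open>None\<close> is \<open>t\<close>.\<close>

definition prod_chart ::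
    "('a, 'n::finite) chart \<Rightarrow> ('a \<times> complex, 'n option) chart" where
  "prod_chart c = (case c of (U, \<phi>) \<Rightarrow>
     (U \<times> UNIV, \<lambda>(p, t). \<chi> i. case i of None \<Rightarrow> t | Some j \<Rightarrow> \<phi> p $ j))"

abbreviation hol_sheaf_prod ::
    "('a::topological_space, 'n::finite) chart set \<Rightarrow> ('a \<times> complex) set \<Rightarrow> ('a \<times> complex \<Rightarrow> complex) set"
    where
  "hol_sheaf_prod A \<equiv> hol_sheaf (prod_chart ` A)"

text \<open>
  Over the domain of a chart, a differential operator is a finite sum of terms
  \<open>a(x,t) \<partial>\<^bsub>w\<^sub>1\<^esub> \<dots> \<partial>\<^bsub>w\<^sub>r\<^esub>\<close>, listed as pairs of a coefficient \<open>a\<close> and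
  a word \<open>w\<close> in the coordinate indices.  An operator has several such expressions; two
  of them are equal in the sheaf of differential operators iff they act in the same way
  on holomorphic functions.
\<close>

type_synonym ('a, 'n) dop = "(('a \<times> complex \<Rightarrow> complex) \<times> 'n option list) list"

definition op_fun ::
    "('a, 'n::finite) chart \<Rightarrow> ('a, 'n) dop \<Rightarrow> ('a \<times> complex \<Rightarrow> complex) \<Rightarrow> 'a \<times> complex \<Rightarrow> complex"
    where
  "op_fun c P g q = (\<Sum>(a, w)\<leftarrow>P. a q * foldr (pd (prod_chart c)) w g q)"

text \<open>The operators over \<open>W\<close> (inside the domain of \<open>c\<close>) that preserve all \<open>(t\<^sup>i)\<close>.\<close>

definition V0_ops ::
    "('a::topological_space, 'n::finite) chart set \<Rightarrow> ('a, 'n) chart \<Rightarrow> ('a \<times> complex) set \<Rightarrow> ('a, 'n) dop set"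
    where
  "V0_ops A c W =
     {P. (\<forall>(a, w)\<in>set P. a \<in> hol_sheaf_prod A W) \<and>
         (\<forall>i W' h. open W' \<and> W' \<subseteq> W \<and> h \<in> hol_sheaf_prod A W' \<longrightarrow>
            (\<exists>h'\<in>hol_sheaf_prod A W'. \<forall>q\<in>W'.
               op_fun c P (\<lambda>q. snd q ^ i * h q) q = snd q ^ i * h' q))}"

section \<open>The direct image under the graph embedding\<close>

text \<open>
  \<open>s :: nat \<Rightarrow> 'a \<Rightarrow> complex\<close> stands for \<open>\<Sum>\<^sub>k (s k) \<partial>\<^sub>t\<^sup>k \<delta>\<close>.  Sections of the direct sum
  sheaf have locally finitely many nonzero components.
\<close>

type_synonym 'a dsec = "nat \<Rightarrow> 'a \<Rightarrow> complex"

definition sec_eq :: "'a set \<Rightarrow> 'a set \<Rightarrow> 'a dsec \<Rightarrow> 'a dsec \<Rightarrow> bool" where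
  "sec_eq E U s s' \<longleftrightarrow> (\<forall>k. \<forall>y\<in>U - E. s k y = s' k y)"

definition dimg ::
    "'a::topological_space set \<Rightarrow> ('a set \<Rightarrow> ('a \<Rightarrow> complex) set) \<Rightarrow> 'a set \<Rightarrow> 'a dsec set" where
  "dimg E M U =
     {s. (\<forall>k. s k \<in> M U) \<and>
         (\<forall>x\<in>U. \<exists>U' K. open U' \<and> x \<in> U' \<and> U' \<subseteq> U \<and> (\<forall>k>K. \<forall>y\<in>U' - E. s k y = 0))}"

definition dt_act :: "'a dsec \<Rightarrow> 'a dsec" where
  "dt_act s k y = (case k of 0 \<Rightarrow> 0 | Suc j \<Rightarrow> s j y)"

definition t_act :: "('a \<Rightarrow> complex) \<Rightarrow> 'a dsec \<Rightarrow> 'a dsec" where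
  "t_act f s k y = f y * s k y - of_nat (k + 1) * s (k + 1) y"

definition dx_act ::
    "('a, 'n::finite) chart \<Rightarrow> ('a \<Rightarrow> complex) \<Rightarrow> 'n \<Rightarrow> 'a dsec \<Rightarrow> 'a dsec" where
  "dx_act c f i s k y =
     pd c i (s k) y - (case k of 0 \<Rightarrow> 0 | Suc j \<Rightarrow> pd c i f y * s j y)"

text \<open>
  The action of a function \<open>g(x,t)\<close> is determined by \<open>g \<cdot> m\<delta> = g(x,f) m \<delta>\<close> and
  \<open>[\<partial>\<^sub>t, g] = \<partial>g/\<partial>t\<close>, which give
  \<open>g \<cdot> m \<partial>\<^sub>t\<^sup>k \<delta> = \<Sum>\<^sub>i (-1)\<^sup>i (k choose i) (\<partial>\<^sup>ig/\<partial>t\<^sup>i)(x,f) m \<partial>\<^sub>t\<^sup>k\<^sup>-\<^sup>i \<delta>\<close>.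
  The sum in the definition is finite, as \<open>s\<close> has finitely many nonzero components
  near each relevant point.
\<close>

definition mult_act ::
    "('a \<Rightarrow> complex) \<Rightarrow> ('a \<times> complex \<Rightarrow> complex) \<Rightarrow> 'a dsec \<Rightarrow> 'a dsec" where
  "mult_act f g s k y =
     (\<Sum>i | s (k + i) y \<noteq> 0.
        (- 1) ^ i * of_nat ((k + i) choose i) * (deriv ^^ i) (\<lambda>t. g (y, t)) (f y) * s (k + i) y)"

definition d_act ::
    "('a, 'n::finite) chart \<Rightarrow> ('a \<Rightarrow> complex) \<Rightarrow> 'n option \<Rightarrow> 'a dsec \<Rightarrow> 'a dsec" where
  "d_act c f i = (case i of None \<Rightarrow> dt_act | Some j \<Rightarrow> dx_act c f j)"

definition op_act ::
    "('a, 'n::finite) chart \<Rightarrow> ('a \<Rightarrow> complex) \<Rightarrow> ('a, 'n) dop \<Rightarrow> 'a dsec \<Rightarrow> 'a dsec" where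
  "op_act c f P s k y = (\<Sum>(a, w)\<leftarrow>P. mult_act f a (foldr (d_act c f) w s) k y)"

lemma mult_act_delta:
  "mult_act f g (\<lambda>k. if k = 0 then m else (\<lambda>_. 0)) =
     (\<lambda>k. if k = 0 then (\<lambda>y. g (y, f y) * m y) else (\<lambda>_. 0))"
proof (intro ext)
  fix k y
  show "mult_act f g (\<lambda>k. if k = 0 then m else (\<lambda>_. 0)) k y =
     (if k = 0 then (\<lambda>y. g (y, f y) * m y) else (\<lambda>_. 0)) y"
  proof (cases "k = 0 \<and> m y \<noteq> 0")
    case True
    then have "{i. (if k + i = 0 then m else (\<lambda>_. 0)) y \<noteq> 0} = {0}" by auto
    with True show ?thesis by (simp add: mult_act_def)
  next
    case False
    then have "{i. (if k + i = 0 then m else (\<lambda>_. 0)) y \<noteq> 0} = {}" by auto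
    with False show ?thesis by (auto simp: mult_act_def)
  qed
qed

section \<open>The Kashiwara--Malgrange filtration\<close>

text \<open>The part of the graph of \<open>f\<close> in \<open>W\<close>, seen in \<open>X\<close>.\<close>

definition gr_preimage :: "('a \<Rightarrow> complex) \<Rightarrow> ('a \<times> complex) set \<Rightarrow> 'a set" where
  "gr_preimage f W = {x. (x, f x) \<in> W}"

definition V0_submodule ::
    "('a::topological_space, 'n::finite) chart set \<Rightarrow> ('a \<Rightarrow> complex) \<Rightarrow> 'a set \<Rightarrow>
      ('a set \<Rightarrow> ('a \<Rightarrow> complex) set) \<Rightarrow> ('a set \<Rightarrow> 'a dsec set) \<Rightarrow> bool" where
  "V0_submodule A f E M S \<longleftrightarrow>
     (\<forall>U. open U \<longrightarrow> S U \<subseteq> dimg E M U) \<and>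
     (\<forall>U s s'. open U \<and> s \<in> S U \<and> s' \<in> dimg E M U \<and> sec_eq E U s s' \<longrightarrow> s' \<in> S U) \<and>
     (\<forall>U U' s. open U \<and> open U' \<and> U' \<subseteq> U \<and> s \<in> S U \<longrightarrow> s \<in> S U') \<and>
     (\<forall>U s. open U \<and> (\<forall>x\<in>U. \<exists>U'. open U' \<and> x \<in> U' \<and> U' \<subseteq> U \<and> s \<in> S U') \<longrightarrow> s \<in> S U) \<and>
     (\<forall>U. open U \<longrightarrow> (\<lambda>k y. 0) \<in> S U) \<and>
     (\<forall>U s s'. open U \<and> s \<in> S U \<and> s' \<in> S U \<longrightarrow> (\<lambda>k y. s k y + s' k y) \<in> S U) \<and>
     (\<forall>c\<in>A. \<forall>W P s. open W \<and> W \<subseteq> fst c \<times> UNIV \<and> P \<in> V0_ops A c W \<and> s \<in> S (gr_preimage f W)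
        \<longrightarrow> op_act c f P s \<in> S (gr_preimage f W))"

definition finite_type ::
    "('a::topological_space, 'n::finite) chart set \<Rightarrow> ('a \<Rightarrow> complex) \<Rightarrow> 'a set \<Rightarrow>
      ('a set \<Rightarrow> 'a dsec set) \<Rightarrow> bool" where
  "finite_type A f E S \<longleftrightarrow>
     (\<forall>c\<in>A. \<forall>z\<in>fst c \<times> UNIV. \<exists>W p (\<sigma> :: nat \<Rightarrow> 'a dsec).
        open W \<and> z \<in> W \<and> W \<subseteq> fst c \<times> UNIV \<and> (\<forall>i<p. \<sigma> i \<in> S (gr_preimage f W)) \<and>
        (\<forall>W' s. open W' \<and> W' \<subseteq> W \<and> s \<in> S (gr_preimage f W') \<longrightarrow>
           (\<forall>z'\<in>W'. \<exists>W'' P. open W'' \<and> z' \<in> W'' \<and> W'' \<subseteq> W' \<and> (\<forall>i<p. P i \<in> V0_ops A c W'') \<and>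
              sec_eq E (gr_preimage f W'') s (\<lambda>k y. \<Sum>i<p. op_act c f (P i) (\<sigma> i) k y))))"

text \<open>
  For sections \<open>\<sigma>\<^sub>0, \<dots>, \<sigma>\<^sub>p\<^sub>-\<^sub>1\<close> over \<open>W\<close>, the sheaf of relations
  \<open>\<Sum>\<^sub>i P\<^sub>i \<sigma>\<^sub>i = 0\<close> is a module of finite type: near each point of \<open>W\<close> it is generated
  by finitely many relations \<open>(Q b i)\<^sub>i\<close>, \<open>b < q\<close>.
\<close>

definition finite_relations ::
    "('a::topological_space, 'n::finite) chart set \<Rightarrow> ('a \<Rightarrow> complex) \<Rightarrow> 'a set \<Rightarrow>
      ('a set \<Rightarrow> 'a dsec set) \<Rightarrow> bool" where
  "finite_relations A f E S \<longleftrightarrow>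
     (\<forall>c\<in>A. \<forall>W p (\<sigma> :: nat \<Rightarrow> 'a dsec).
        open W \<and> W \<subseteq> fst c \<times> UNIV \<and> (\<forall>i<p. \<sigma> i \<in> S (gr_preimage f W)) \<longrightarrow>
        (\<forall>z\<in>W. \<exists>W' q (Q :: nat \<Rightarrow> nat \<Rightarrow> ('a, 'n) dop).
           open W' \<and> z \<in> W' \<and> W' \<subseteq> W \<and>
           (\<forall>b<q. (\<forall>i<p. Q b i \<in> V0_ops A c W') \<and>
              sec_eq E (gr_preimage f W') (\<lambda>k y. \<Sum>i<p. op_act c f (Q b i) (\<sigma> i) k y) (\<lambda>k y. 0)) \<and>
           (\<forall>W1 (P :: nat \<Rightarrow> ('a, 'n) dop).
              open W1 \<and> W1 \<subseteq> W' \<and> (\<forall>i<p. P i \<in> V0_ops A c W1) \<and>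
              sec_eq E (gr_preimage f W1) (\<lambda>k y. \<Sum>i<p. op_act c f (P i) (\<sigma> i) k y) (\<lambda>k y. 0) \<longrightarrow>
              (\<forall>z1\<in>W1. \<exists>W2 (B :: nat \<Rightarrow> ('a, 'n) dop).
                 open W2 \<and> z1 \<in> W2 \<and> W2 \<subseteq> W1 \<and> (\<forall>b<q. B b \<in> V0_ops A c W2) \<and>
                 (\<forall>i<p. \<forall>G g. open G \<and> G \<subseteq> W2 \<and> g \<in> hol_sheaf_prod A G \<longrightarrow>
                    (\<forall>y\<in>G. op_fun c (P i) g y =
                       (\<Sum>b<q. op_fun c (B b) (op_fun c (Q b i) g) y)))))))"

definition V0_coherent ::
    "('a::topological_space, 'n::finite) chart set \<Rightarrow> ('a \<Rightarrow> complex) \<Rightarrow> 'a set \<Rightarrow>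
      ('a set \<Rightarrow> ('a \<Rightarrow> complex) set) \<Rightarrow> ('a set \<Rightarrow> 'a dsec set) \<Rightarrow> bool" where
  "V0_coherent A f E M S \<longleftrightarrow>
     V0_submodule A f E M S \<and> finite_type A f E S \<and> finite_relations A f E S"

text \<open>The sheaf \<open>V\<^sup>>\<^sup>\<gamma>\<close>, the union of the \<open>V\<^sup>\<beta>\<close> with \<open>\<beta> > \<gamma>\<close>.\<close>

definition V_gt :: "(rat \<Rightarrow> 'a::topological_space set \<Rightarrow> 'a dsec set) \<Rightarrow> rat \<Rightarrow> 'a set \<Rightarrow> 'a dsec set"
  where
  "V_gt V \<gamma> U =
     {s. \<forall>x\<in>U. \<exists>U' \<beta>. open U' \<and> x \<in> U' \<and> U' \<subseteq> U \<and> \<gamma> < \<beta> \<and> s \<in> V \<beta> U'}"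

text \<open>
  The conditions on a filtration are conditions on sheaves: the denominator \<open>l\<close> of the jumps
  and the nilpotency index \<open>r\<close> are only required to exist locally.
\<close>

definition V_filtration ::
    "('a::topological_space, 'n::finite) chart set \<Rightarrow> ('a \<Rightarrow> complex) \<Rightarrow> 'a set \<Rightarrow>
      ('a set \<Rightarrow> ('a \<Rightarrow> complex) set) \<Rightarrow> (rat \<Rightarrow> 'a set \<Rightarrow> 'a dsec set) \<Rightarrow> bool" where
  "V_filtration A f E M V \<longleftrightarrow>
     \<comment> \<open>decreasing\<close>
     (\<forall>\<gamma> \<gamma>' U. open U \<and> \<gamma> \<le> \<gamma>' \<longrightarrow> V \<gamma>' U \<subseteq> V \<gamma> U) \<and>
     \<comment> \<open>exhaustive\<close>
     (\<forall>U. open U \<longrightarrow> (\<forall>s\<in>dimg E M U. \<forall>x\<in>U. \<exists>U' \<gamma>. open U' \<and> x \<in> U' \<and> U' \<subseteq> U \<and> s \<in> V \<gamma> U')) \<and>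
     \<comment> \<open>discrete, with rational jumps\<close>
     (\<forall>x. \<exists>U (l::nat). open U \<and> x \<in> U \<and> l > 0 \<and>
        (\<forall>(i::int) \<beta> \<gamma> U'. open U' \<and> U' \<subseteq> U \<and>
           {\<beta>, \<gamma>} \<subseteq> {of_int i / of_nat l <..< of_int (i + 1) / of_nat l} \<longrightarrow> V \<beta> U' = V \<gamma> U')) \<and>
     \<comment> \<open>left-continuous\<close>
     (\<forall>\<gamma> U. open U \<longrightarrow> V \<gamma> U = (\<Inter>\<beta>\<in>{..<\<gamma>}. V \<beta> U)) \<and>
     (\<forall>\<gamma>. V0_coherent A f E M (V \<gamma>)) \<and>
     (\<forall>\<gamma> U. open U \<longrightarrow> t_act f ` V \<gamma> U \<subseteq> V (\<gamma> + 1) U) \<and>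
     (\<forall>\<gamma> U. open U \<and> \<gamma> > 0 \<longrightarrow> (\<forall>s\<in>V (\<gamma> + 1) U. \<forall>x\<in>U. \<exists>U'. open U' \<and> x \<in> U' \<and> U' \<subseteq> U \<and>
        (\<exists>s'\<in>V \<gamma> U'. sec_eq E U' (t_act f s') s))) \<and>
     (\<forall>\<gamma> U. open U \<longrightarrow> dt_act ` V \<gamma> U \<subseteq> V (\<gamma> - 1) U) \<and>
     \<comment> \<open>local nilpotency on the graded pieces\<close>
     (\<forall>\<gamma> x. \<exists>U r. open U \<and> x \<in> U \<and> (\<forall>U'. open U' \<and> U' \<subseteq> U \<longrightarrow>
        (\<forall>s\<in>V \<gamma> U'. ((\<lambda>s k y. dt_act (t_act f s) k y - of_rat \<gamma> * s k y) ^^ r) s \<in> V_gt V \<gamma> U')))"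

section \<open>Order and Hodge filtrations\<close>

definition tord_filt ::
    "('a::topological_space, 'n::finite) chart set \<Rightarrow> ('a \<Rightarrow> complex) \<Rightarrow> int \<Rightarrow> 'a set \<Rightarrow> 'a dsec set"
    where
  "tord_filt A f k U =
     {s \<in> dimg (zero_set f) (mer_sheaf A f) U.
        \<forall>j. int j > k \<longrightarrow> (\<forall>y\<in>U - zero_set f. s j y = 0)}"

text \<open>\<open>VO\<close> is the \<open>V\<close>-filtration of the direct image of \<open>O\<^sub>X\<close>.\<close>

definition hodge_filt ::
    "('a::topological_space, 'n::finite) chart set \<Rightarrow> ('a \<Rightarrow> complex) \<Rightarrow>
      (rat \<Rightarrow> 'a set \<Rightarrow> 'a dsec set) \<Rightarrow> int \<Rightarrow> 'a set \<Rightarrow> ('a \<Rightarrow> complex) set" where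
  "hodge_filt A f VO k U =
     (if k < 0 then {m. \<forall>y\<in>U - zero_set f. m y = 0}
      else {m. \<forall>x\<in>U. \<exists>U' v. open U' \<and> x \<in> U' \<and> U' \<subseteq> U \<and> (\<forall>j\<le>nat k. v j \<in> hol_sheaf A U') \<and>
              (\<lambda>j. if j \<le> nat k then v j else (\<lambda>_. 0)) \<in> VO 1 U' \<and>
              (\<forall>y\<in>U' - zero_set f. m y = (\<Sum>j\<le>nat k. fact j * v j y / f y ^ (j + 1)))})"

text \<open>\<open>F\<^sub>k = \<Sum>\<^sub>j F\<^sub>k\<^sub>-\<^sub>1\<^sub>-\<^sub>j \<partial>\<^sub>t\<^sup>j \<delta>\<close>, the sum being direct.\<close>

definition hodge_filt_dimg ::
    "('a::topological_space, 'n::finite) chart set \<Rightarrow> ('a \<Rightarrow> complex) \<Rightarrow>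
      (rat \<Rightarrow> 'a set \<Rightarrow> 'a dsec set) \<Rightarrow> int \<Rightarrow> 'a set \<Rightarrow> 'a dsec set" where
  "hodge_filt_dimg A f VO k U =
     {s \<in> dimg (zero_set f) (mer_sheaf A f) U. \<forall>j. s j \<in> hodge_filt A f VO (k - 1 - int j) U}"

text \<open>The sections \<open>m \<delta>\<close> of the direct image of \<open>O\<^sub>X(*f)\<close> with \<open>m\<close> in \<open>S\<close>.\<close>

definition delta_part ::
    "('a::topological_space, 'n::finite) chart set \<Rightarrow> ('a \<Rightarrow> complex) \<Rightarrow>
      ('a set \<Rightarrow> ('a \<Rightarrow> complex) set) \<Rightarrow> 'a set \<Rightarrow> 'a dsec set" where
  "delta_part A f S U =
     {s \<in> dimg (zero_set f) (mer_sheaf A f) U.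
        s 0 \<in> S U \<and> (\<forall>k>0. \<forall>y\<in>U - zero_set f. s k y = 0)}"

text \<open>The sum of two subsheaves of the direct image of \<open>O\<^sub>X(*f)\<close>.\<close>

definition sheaf_sum ::
    "('a::topological_space, 'n::finite) chart set \<Rightarrow> ('a \<Rightarrow> complex) \<Rightarrow>
      ('a set \<Rightarrow> 'a dsec set) \<Rightarrow> ('a set \<Rightarrow> 'a dsec set) \<Rightarrow> 'a set \<Rightarrow> 'a dsec set" where
  "sheaf_sum A f S T U =
     {s \<in> dimg (zero_set f) (mer_sheaf A f) U.
        \<forall>x\<in>U. \<exists>U'. open U' \<and> x \<in> U' \<and> U' \<subseteq> U \<and>
          (\<exists>a\<in>S U'. \<exists>b\<in>T U'. sec_eq (zero_set f) U' s (\<lambda>k y. a k y + b k y))}"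

end

theory Submission
  imports Defs "HOL-Complex_Analysis.Conformal_Mappings"
begin

text \<open>
  Write \<open>B = i\<^sub>+O\<close> and \<open>B' = i\<^sub>+O(*f)\<close>, and regard a section of either as a polynomial in \<open>\<partial>\<^sub>t\<close> with
  coefficients on \<open>X\<close>.  Multiplication by \<open>t\<close> is bijective on \<open>B'\<close>, and the \<open>\<delta>\<close>-coefficient of
  \<open>t\<^sup>-\<^sup>1 \<Sum>\<^sub>j v\<^sub>j \<partial>\<^sub>t\<^sup>j \<delta>\<close> is \<open>\<Sum>\<^sub>j j! v\<^sub>j / f\<^sup>j\<^sup>+\<^sup>1\<close>, the expression that defines the Hodge filtration.  Two facts
  on the filtrations therefore carry the theorem: \<open>V\<^sup>1 B = V\<^sup>1 B'\<close> off the zero set of \<open>f\<close>, and \<open>t\<^sup>-\<^sup>1 V\<^sup>1 B' \<subseteq> V\<^sup>0 B'\<close>.  Together they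
  say that \<open>F\<^sub>k O(*f)\<close> consists of the \<open>\<delta>\<close>-coefficients of the sections of \<open>V\<^sup>0 B'\<close> of order at most \<open>k\<close> in
  \<open>\<partial>\<^sub>t\<close>.  Such a section \<open>u\<close> with \<open>\<delta>\<close>-coefficient \<open>m\<close> has the form \<open>m \<delta> - \<partial>\<^sub>t w\<close> with \<open>w\<close> of order at most
  \<open>k - 1\<close>, and this is the second description of \<open>F\<^sub>k\<close> (\<open>hodge_recovery\<close> and \<open>hodge_decomposition\<close>).
  For the first one, the coefficients of \<open>w\<close> have to lie in the Hodge filtration.  They do, because
  \<open>V\<^sup>1 B\<close> is stable under \<open>f - t\<close>, which acts as the derivative with respect to \<open>\<partial>\<^sub>t\<close>: up to sign, the
  coefficient \<open>w\<^sub>i\<close> arises from \<open>(f - t)\<^sup>i\<^sup>+\<^sup>1 v / (i+1)!\<close> as \<open>m\<close> does from \<open>v\<close> (\<open>VO_binomial_shift\<close>).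

  The two facts are derived from the defining properties of a \<open>V\<close>-filtration, in the stalk at a point.
  The main tool is that the index of a section is detected by polynomials in \<open>\<partial>\<^sub>t t\<close> (\<open>germ_climb\<close>):
  such a polynomial with roots \<open>\<ge> \<alpha>\<close> can take a section into \<open>V\<^sup>\<alpha>\<close> only if the section lies in \<open>V\<^sup>\<alpha>\<close>
  already.  For \<open>t\<^sup>-\<^sup>1 V\<^sup>1 B' \<subseteq> V\<^sup>0 B'\<close> the polynomial is \<open>\<partial>\<^sub>t t\<close> itself.  For \<open>V\<^sup>1 B \<subseteq> V\<^sup>1 B'\<close>, finite generation
  places \<open>V\<^sup>1 B\<close> in some \<open>V\<^sup>\<beta> B'\<close>, hence \<open>V\<^sup>1\<^sup>+\<^sup>n B = t\<^sup>n V\<^sup>1 B\<close> in \<open>V\<^sup>1 B'\<close> for large \<open>n\<close>; and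
  some polynomial with roots \<open>\<ge> 1\<close> takes \<open>V\<^sup>1 B\<close> locally into \<open>V\<^sup>1\<^sup>+\<^sup>n B\<close>, section by section.

  The reverse inclusion \<open>V\<^sup>1 B' \<subseteq> V\<^sup>1 B\<close> first needs a common denominator: \<open>t\<^sup>m V\<^sup>1 B' \<subseteq> V\<^sup>1 B\<close> for some \<open>m\<close>.
  Each of finitely many generators has one, but it must survive the action of the operators \<open>P\<close>
  of \<open>V\<^sup>0 D\<close>.  This is shown with the commutators \<open>(ad t)\<^sup>n P\<close> (\<open>op_act_denominator\<close>), which raise the
  filtration by \<open>n\<close> and vanish for large \<open>n\<close>.  The vanishing rests on \<open>[t, \<partial>\<^sub>x] = 0\<close>, that is on the product
  rule for iterated derivatives, and so on the fact that partial derivatives of holomorphic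
  functions of several variables are holomorphic (\<open>cdiff_at_partial\<close>).
  Given the denominator, a section of \<open>V\<^sup>1 B'\<close> is taken into \<open>B\<close> by two
  polynomials in \<open>\<partial>\<^sub>t t\<close>, one with roots \<open>\<ge> 1\<close> and the other, \<open>\<partial>\<^sub>t\<^sup>m t\<^sup>m\<close>, with roots \<open>\<le> 0\<close>.  As they are
  coprime, the section lies in \<open>B\<close>, and its index is again read off from the roots.
\<close>

section \<open>Holomorphic functions of several complex variables\<close>

lemma cdiff_at_const: "cdiff_at (\<lambda>_. c) z"
  unfolding cdiff_at_def by (rule exI[of _ "\<lambda>_. 0"]) auto

lemma cdiff_at_add: "cdiff_at g z \<Longrightarrow> cdiff_at h z \<Longrightarrow> cdiff_at (\<lambda>w. g w + h w) z"
  unfolding cdiff_at_def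
proof (elim exE conjE)
  fix L L'
  assume "(g has_derivative L) (at z)" "(h has_derivative L') (at z)"
    and "\<forall>c v. L (c *s v) = c * L v" "\<forall>c v. L' (c *s v) = c * L' v"
  then show "\<exists>L. ((\<lambda>w. g w + h w) has_derivative L) (at z) \<and> (\<forall>c v. L (c *s v) = c * L v)"
    by (intro exI[of _ "\<lambda>v. L v + L' v"] conjI has_derivative_add) (auto simp: algebra_simps)
qed

lemma cdiff_at_mult: "cdiff_at g z \<Longrightarrow> cdiff_at h z \<Longrightarrow> cdiff_at (\<lambda>w. g w * h w) z"
  unfolding cdiff_at_def
proof (elim exE conjE)
  fix L L'
  assume "(g has_derivative L) (at z)" "(h has_derivative L') (at z)"
    and "\<forall>c v. L (c *s v) = c * L v" "\<forall>c v. L' (c *s v) = c * L' v"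
  then show "\<exists>L. ((\<lambda>w. g w * h w) has_derivative L) (at z) \<and> (\<forall>c v. L (c *s v) = c * L v)"
    by (intro exI[of _ "\<lambda>v. g z * L' v + L v * h z"] conjI has_derivative_mult) (auto simp: algebra_simps)
qed

lemma cdiff_at_diff: "cdiff_at g z \<Longrightarrow> cdiff_at h z \<Longrightarrow> cdiff_at (\<lambda>w. g w - h w) z"
  using cdiff_at_add[of g z "\<lambda>w. - 1 * h w"] cdiff_at_mult[OF cdiff_at_const[of "-1" z], of h]
  by simp

lemma cdiff_at_power: "cdiff_at g z \<Longrightarrow> cdiff_at (\<lambda>w. g w ^ r) z"
  by (induction r) (auto intro: cdiff_at_const cdiff_at_mult)

lemma cdiff_at_inverse: "cdiff_at g z \<Longrightarrow> g z \<noteq> 0 \<Longrightarrow> cdiff_at (\<lambda>w. inverse (g w)) z"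
  unfolding cdiff_at_def
proof (elim exE conjE)
  fix L
  assume "(g has_derivative L) (at z)" "g z \<noteq> 0" "\<forall>c v. L (c *s v) = c * L v"
  then show "\<exists>L. ((\<lambda>w. inverse (g w)) has_derivative L) (at z) \<and> (\<forall>c v. L (c *s v) = c * L v)"
    by (intro exI[of _ "\<lambda>v. - (inverse (g z) * L v * inverse (g z))"] conjI Deriv.has_derivative_inverse)
      (auto simp: algebra_simps)
qed

lemma cdiff_at_divide: "cdiff_at g z \<Longrightarrow> cdiff_at h z \<Longrightarrow> h z \<noteq> 0 \<Longrightarrow> cdiff_at (\<lambda>w. g w / h w) z"
  unfolding divide_inverse by (intro cdiff_at_mult cdiff_at_inverse)

lemma cdiff_at_cong_open:
  assumes "cdiff_at g z" "open N" "z \<in> N" "\<And>w. w \<in> N \<Longrightarrow> g w = h w"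
  shows "cdiff_at h z"
  using assms has_derivative_transform_within_open[of g _ z UNIV N h]
  unfolding cdiff_at_def by blast

lemma cdiff_at_isCont: "cdiff_at g z \<Longrightarrow> isCont g z"
  unfolding cdiff_at_def using has_derivative_continuous by blast

lemma bounded_linear_line: "bounded_linear (\<lambda>\<zeta>::complex. \<zeta> *s (v :: complex ^ 'm::finite))"
proof -
  have "linear (\<lambda>\<zeta>::complex. \<zeta> *s v)"
    by (rule linearI) (simp_all add: vec_eq_iff algebra_simps)
  then show ?thesis by (simp add: linear_conv_bounded_linear)
qed

lemma has_derivative_on_line:
  fixes F :: "complex ^ 'm::finite \<Rightarrow> complex"
  assumes "(F has_derivative L) (at (z + \<zeta> *s v))" "\<forall>c v. L (c *s v) = c * L v"
  shows "((\<lambda>\<zeta>. F (z + \<zeta> *s v)) has_field_derivative L v) (at \<zeta>)"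
proof -
  have "((\<lambda>\<zeta>. z + \<zeta> *s v) has_derivative (\<lambda>\<zeta>. \<zeta> *s v)) (at \<zeta>)"
    using has_derivative_add[OF has_derivative_const bounded_linear_imp_has_derivative[OF bounded_linear_line]]
    by simp
  from diff_chain_at[OF this assms(1)] have "((\<lambda>\<zeta>. F (z + \<zeta> *s v)) has_derivative (\<lambda>\<zeta>. L (\<zeta> *s v))) (at \<zeta>)"
    by (simp add: o_def)
  moreover have "(\<lambda>\<zeta>. L (\<zeta> *s v)) = (*) (L v)" using assms(2) by (auto simp: fun_eq_iff)
  ultimately show ?thesis by (simp add: has_field_derivative_def)
qed

definition partial :: "'m \<Rightarrow> (complex ^ 'm::finite \<Rightarrow> complex) \<Rightarrow> complex ^ 'm \<Rightarrow> complex" where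
  "partial i F z = deriv (\<lambda>\<zeta>. F (z + axis i \<zeta>)) 0"

lemma axis_scalar: "axis i (c::complex) = c *s axis i 1"
  by (auto simp: axis_def vec_eq_iff)

lemma axis_zero: "axis i 0 = 0"
  by (simp add: axis_def vec_eq_iff)

lemma has_derivative_on_axis:
  fixes F :: "complex ^ 'm::finite \<Rightarrow> complex"
  assumes "(F has_derivative L) (at (z + axis i \<zeta>))" "\<forall>c v. L (c *s v) = c * L v"
  shows "((\<lambda>\<zeta>. F (z + axis i \<zeta>)) has_field_derivative L (axis i 1)) (at \<zeta>)"
proof -
  have "(\<lambda>\<zeta>. F (z + axis i \<zeta>)) = (\<lambda>\<zeta>. F (z + \<zeta> *s axis i 1))"
    by (rule ext) (metis axis_scalar)
  moreover have "(F has_derivative L) (at (z + \<zeta> *s axis i 1))"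
    using assms(1) by (metis axis_scalar)
  ultimately show ?thesis using has_derivative_on_line[of F L z \<zeta> "axis i 1"] assms(2) by simp
qed

text \<open>
  The complex linear derivative of \<open>F\<close> is determined by its values on the coordinate axes, so
  complex differentiability of \<open>F\<close> is the same as the following two statements.
\<close>

lemma has_partial:
  assumes "cdiff_at F z"
  shows "((\<lambda>\<zeta>. F (z + axis i \<zeta>)) has_field_derivative partial i F z) (at 0)"
proof -
  from assms obtain L where L: "(F has_derivative L) (at z)" "\<forall>c v. L (c *s v) = c * L v"
    unfolding cdiff_at_def by blast
  have "((\<lambda>\<zeta>. F (z + axis i \<zeta>)) has_field_derivative L (axis i 1)) (at 0)"
    by (rule has_derivative_on_axis) (use L in \<open>auto simp: axis_zero\<close>)
  then show ?thesis
    unfolding partial_def using DERIV_imp_deriv by fastforce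
qed

lemma has_derivative_partials:
  assumes "cdiff_at F z"
  shows "(F has_derivative (\<lambda>v. \<Sum>i\<in>UNIV. partial i F z * v $ i)) (at z)"
proof -
  from assms obtain L where L: "(F has_derivative L) (at z)" "\<forall>c v. L (c *s v) = c * L v"
    unfolding cdiff_at_def by blast
  have p: "L (axis i 1) = partial i F z" for i
  proof -
    have "((\<lambda>\<zeta>. F (z + axis i \<zeta>)) has_field_derivative L (axis i 1)) (at 0)"
      by (rule has_derivative_on_axis) (use L in \<open>auto simp: axis_zero\<close>)
    with has_partial[OF assms] show ?thesis using DERIV_unique by blast
  qed
  have "L v = (\<Sum>i\<in>UNIV. partial i F z * v $ i)" for v
  proof -
    have "v = (\<Sum>i\<in>UNIV. v $ i *s axis i 1)"
      by (simp add: vec_eq_iff axis_def if_distrib cong: if_cong)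
    then have "L v = L (\<Sum>i\<in>UNIV. v $ i *s axis i 1)" by simp
    also have "\<dots> = (\<Sum>i\<in>UNIV. L (v $ i *s axis i 1))"
      using L(1) by (intro linear_sum has_derivative_linear)
    finally show ?thesis using L(2) p by (simp add: mult.commute)
  qed
  with L(1) show ?thesis by (metis (no_types, lifting) ext)
qed

text \<open>
  This rewrites a partial derivative as an integral over a fixed interval whose integrand
  contains \<open>F\<close> but no derivative of it.  That form can be differentiated under the integral sign.
\<close>

lemma partial_Cauchy_integral:
  fixes F :: "complex ^ 'm::finite \<Rightarrow> complex"
  assumes "r > 0" "\<And>\<zeta>. norm \<zeta> \<le> r \<Longrightarrow> cdiff_at F (z + axis i \<zeta>)"
  shows "partial i F z = integral {0..1} (\<lambda>t. F (z + axis i (circlepath 0 r t)) *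
           (1 / (2 * of_real pi * \<i>) / (circlepath 0 r t)^2 * vector_derivative (circlepath 0 r) (at t)))"
proof -
  let ?g = "\<lambda>\<zeta>. F (z + axis i \<zeta>)"
  have d: "?g field_differentiable at \<zeta>" if "norm \<zeta> \<le> r" for \<zeta>
    using assms(2)[OF that] unfolding cdiff_at_def field_differentiable_def
    by (metis has_derivative_on_axis)
  have "continuous_on (cball 0 r) ?g" "?g holomorphic_on ball 0 r"
    using d by (auto intro!: continuous_at_imp_continuous_on field_differentiable_imp_continuous_at
      simp: holomorphic_on_def intro: field_differentiable_at_within)
  from Cauchy_derivative_integral_circlepath(2)[OF this, of 0]
  have "(?g has_field_derivative (1 / (2 * of_real pi * \<i>) * contour_integral (circlepath 0 r) (\<lambda>u. ?g u / (u - 0)^2))) (at 0)"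
    using assms(1) by simp
  then have "partial i F z = 1 / (2 * of_real pi * \<i>) * contour_integral (circlepath 0 r) (\<lambda>u. ?g u / u^2)"
    unfolding partial_def by (simp add: DERIV_imp_deriv)
  also have "\<dots> = integral {0..1} (\<lambda>t. 1 / (2 * of_real pi * \<i>) *
       (?g (circlepath 0 r t) / (circlepath 0 r t)^2 * vector_derivative (circlepath 0 r) (at t)))"
    unfolding contour_integral_integral by (rule integral_mult_right[symmetric])
  finally show ?thesis by (simp add: field_simps)
qed

lemma norm_axis_complex: "norm (axis i (c::complex)) = norm c"
proof -
  have "(\<Sum>j\<in>UNIV. (norm (axis i c $ j))\<^sup>2) = (\<Sum>j\<in>UNIV. if j = i then (norm c)\<^sup>2 else 0)"
    by (rule sum.cong) (auto simp: axis_def)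
  then show ?thesis by (simp add: norm_vec_def L2_set_def)
qed

lemma isCont_axis: "isCont (\<lambda>\<zeta>::complex. z + axis i \<zeta>) \<zeta>"
proof -
  have "(\<lambda>\<zeta>::complex. z + axis i \<zeta>) = (\<lambda>\<zeta>. z + \<zeta> *s axis i 1)"
    by (rule ext) (metis axis_scalar)
  then show ?thesis
    using linear_continuous_at[OF bounded_linear_line, of \<zeta> "axis i 1"]
    by (simp add: isCont_add)
qed

lemma add_axis_mem:
  fixes z :: "complex ^ 'm::finite"
  assumes "z \<in> ball z0 r" "norm \<zeta> \<le> r" "ball z0 (2 * r) \<subseteq> G"
  shows "z + axis i \<zeta> \<in> G"
proof -
  have "dist z0 (z + axis i \<zeta>) \<le> dist z0 z + norm (axis i \<zeta>)"
    by (metis add.commute add_diff_cancel_left' dist_norm dist_triangle norm_minus_commute)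
  moreover have "norm (axis i \<zeta>) = norm \<zeta>"
    by (simp add: norm_axis_complex)
  ultimately have "z + axis i \<zeta> \<in> ball z0 (2*r)" using assms by auto
  with assms show ?thesis by blast
qed

text \<open>
  Partial derivatives of holomorphic functions are holomorphic.  The integral formula first
  shows that all partial derivatives are continuous, by continuity of parameter integrals.
  With this, the integrand has a continuous derivative in \<open>z\<close>, and the Leibniz rule applies to
  the same formula.
\<close>

lemma cdiff_at_partial:
  fixes F :: "complex ^ 'm::finite \<Rightarrow> complex"
  assumes "open G" "\<And>z. z \<in> G \<Longrightarrow> cdiff_at F z" "z0 \<in> G"
  shows "cdiff_at (partial i F) z0"
proof -
  define \<kappa> where "\<kappa> r t = 1 / (2 * of_real pi * \<i>) / (circlepath 0 r t)^2 * vector_derivative (circlepath 0 r) (at t)"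
    for r t
  have \<kappa>: "continuous_on {0..1} (\<kappa> r)" if "r > 0" for r
  proof -
    have nz: "(0 + of_real r * exp (2 * of_real pi * \<i> * of_real t))\<^sup>2 \<noteq> 0" for t
      using that by simp
    show ?thesis
      unfolding \<kappa>_def vector_derivative_circlepath unfolding circlepath
      by (intro continuous_on_mult continuous_on_divide continuous_on_const continuous_on_power
          continuous_on_add continuous_on_exp continuous_on_of_real continuous_on_id ballI nz) auto
  qed
  have contF: "continuous_on G F"
    using assms(2) cdiff_at_isCont continuous_at_imp_continuous_on by blast
  have axc: "continuous_on S (\<lambda>x. axis j (h x))" if "continuous_on S h" for S and h :: "'x::topological_space \<Rightarrow> complex" and j :: 'm
    unfolding axis_def
  proof (intro continuous_on_vec_lambda)
    fix i show "continuous_on S (\<lambda>x. if i = j then h x else 0)"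
      using that by (cases "i = j") auto
  qed
  have cp: "continuous_on {0..1} (circlepath 0 r)" for r
    by (simp add: path_circlepath flip: path_def)
  have cpn: "norm (circlepath 0 r t) = r" if "r > 0" for r t
    using that by (simp add: circlepath norm_mult)
  \<comment> \<open>The integrands below: \<open>H\<close> is \<open>F\<close> or one of its partial derivatives.\<close>
  have para: "continuous_on (ball z1 r \<times> cbox 0 1) (\<lambda>(z, t). H (z + axis j (circlepath 0 r t)) * \<kappa> r t)"
    if H: "continuous_on G H" and r: "r > 0" "ball z1 (2 * r) \<subseteq> G" for H and z1 :: "complex ^ 'm" and r j
  proof -
    have c: "continuous_on (ball z1 r \<times> cbox 0 1) (\<lambda>p. circlepath 0 r (snd p))"
      by (rule continuous_on_compose2[OF cp continuous_on_snd[OF continuous_on_id]]) auto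
    have "continuous_on (ball z1 r \<times> cbox 0 1) (\<lambda>p. fst p + axis j (circlepath 0 r (snd p)))"
      by (rule continuous_on_add[OF continuous_on_fst[OF continuous_on_id] axc[OF c]])
    then have "continuous_on (ball z1 r \<times> cbox 0 1) (\<lambda>p. H (fst p + axis j (circlepath 0 r (snd p))))"
      by (rule continuous_on_compose2[OF H]) (use add_axis_mem[OF _ _ r(2)] cpn r(1) in auto)
    moreover have "continuous_on (ball z1 r \<times> cbox 0 1) (\<lambda>p. \<kappa> r (snd p))"
      by (rule continuous_on_compose2[OF \<kappa>[OF r(1)] continuous_on_snd[OF continuous_on_id]]) auto
    ultimately show ?thesis
      unfolding case_prod_unfold by (rule continuous_on_mult)
  qed
  have cont_partial: "continuous_on G (partial j F)" for j
  proof (rule continuous_at_imp_continuous_on, rule ballI)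
    fix z1 assume "z1 \<in> G"
    then obtain e where "e > 0" "ball z1 e \<subseteq> G" using assms(1) open_contains_ball by blast
    then have "e / 2 > 0 \<and> ball z1 (2 * (e / 2)) \<subseteq> G" by simp
    then obtain r where r: "r > 0" "ball z1 (2 * r) \<subseteq> G" by blast
    have eq: "partial j F z = integral (cbox 0 1) (\<lambda>t. F (z + axis j (circlepath 0 r t)) * \<kappa> r t)" if "z \<in> ball z1 r" for z
      using partial_Cauchy_integral[of r F z j] r add_axis_mem[OF that _ r(2), of _ j] assms(2) unfolding \<kappa>_def by auto
    have "continuous_on (ball z1 r \<times> cbox 0 1) (\<lambda>(z, t). F (z + axis j (circlepath 0 r t)) * \<kappa> r t)"
      by (rule para[OF contF r])
    from continuous_on_eq[OF integral_continuous_on_param[OF this] eq[symmetric]]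
    have "continuous_on (ball z1 r) (partial j F)" .
    then show "isCont (partial j F) z1"
      using r(1) by (simp add: continuous_on_eq_continuous_at)
  qed
  obtain e where "e > 0" "ball z0 e \<subseteq> G" using assms(1,3) open_contains_ball by blast
  then have "e / 2 > 0 \<and> ball z0 (2 * (e / 2)) \<subseteq> G" by simp
    then obtain r where r: "r > 0" "ball z0 (2 * r) \<subseteq> G" by blast
  \<comment> \<open>From here on the circle is in the \<open>i\<close>-th variable, the one of the derivative under study.\<close>
  have eq: "partial i F z = integral (cbox 0 1) (\<lambda>t. F (z + axis i (circlepath 0 r t)) * \<kappa> r t)" if "z \<in> ball z0 r" for z
    using partial_Cauchy_integral[of r F z i] r add_axis_mem[OF that _ r(2), of _ i] assms(2) unfolding \<kappa>_def by auto
  define pr :: "'m \<Rightarrow> (complex ^ 'm) \<Rightarrow>\<^sub>L complex" where "pr j = Blinfun (\<lambda>v. v $ j)" for j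
  have pr: "blinfun_apply (pr j) v = v $ j" for j v
    unfolding pr_def by (simp add: bounded_linear_Blinfun_apply bounded_linear_vec_nth)
  define fx :: "complex ^ 'm \<Rightarrow> real \<Rightarrow> (complex ^ 'm) \<Rightarrow>\<^sub>L complex" where
    "fx z t = (\<Sum>j\<in>UNIV. blinfun_mult_right (partial j F (z + axis i (circlepath 0 r t)) * \<kappa> r t) o\<^sub>L pr j)" for z t
  have fx_apply: "blinfun_apply (fx z t) v = (\<Sum>j\<in>UNIV. partial j F (z + axis i (circlepath 0 r t)) * v $ j) * \<kappa> r t" for z t v
    unfolding fx_def by (simp add: blinfun.sum_left pr sum_distrib_left algebra_simps)
  have pairc: "continuous_on (cbox 0 (1::real)) (\<lambda>t. (z, t))" for z :: "complex ^ 'm"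
    by (rule continuous_on_Pair[OF continuous_on_const continuous_on_id])
  have cont_fx: "continuous_on (ball z0 r \<times> cbox 0 1) (\<lambda>(z, t). fx z t)"
    unfolding fx_def case_prod_unfold
    by (intro continuous_on_sum bounded_bilinear.continuous_on[OF bounded_bilinear_blinfun_compose]
        bounded_linear.continuous_on[OF bounded_linear_blinfun_mult_right] continuous_on_const
        para[OF cont_partial r, unfolded case_prod_unfold])
  have "((\<lambda>z. integral (cbox 0 1) (\<lambda>t. F (z + axis i (circlepath 0 r t)) * \<kappa> r t)) has_derivative
     integral (cbox 0 1) (fx z0)) (at z0 within ball z0 r)"
  proof (rule leibniz_rule[OF _ _ cont_fx])
    fix z t assume z: "z \<in> ball z0 r" and "t \<in> cbox 0 (1::real)"
    have "cdiff_at F (z + axis i (circlepath 0 r t))"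
      using add_axis_mem[OF z _ r(2), of _ i] cpn[OF r(1)] assms(2) by auto
    note dF = has_derivative_partials[OF this]
    have "((\<lambda>z. z + axis i (circlepath 0 r t)) has_derivative (\<lambda>v. v)) (at z)"
      by (auto intro!: derivative_eq_intros)
    from diff_chain_at[OF this dF]
    have "((\<lambda>z. F (z + axis i (circlepath 0 r t))) has_derivative (\<lambda>v. \<Sum>j\<in>UNIV. partial j F (z + axis i (circlepath 0 r t)) * v $ j)) (at z)"
      by (simp add: o_def)
    then have "((\<lambda>z. F (z + axis i (circlepath 0 r t)) * \<kappa> r t) has_derivative
       (\<lambda>v. (\<Sum>j\<in>UNIV. partial j F (z + axis i (circlepath 0 r t)) * v $ j) * \<kappa> r t)) (at z)"
      by (rule has_derivative_mult_left)
    then show "((\<lambda>z. F (z + axis i (circlepath 0 r t)) * \<kappa> r t) has_derivative blinfun_apply (fx z t)) (at z within ball z0 r)"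
      by (auto simp: fx_apply[abs_def] intro: has_derivative_at_withinI)
  next
    fix z assume z: "z \<in> ball z0 r"
    show "(\<lambda>t. F (z + axis i (circlepath 0 r t)) * \<kappa> r t) integrable_on cbox 0 1"
    proof (rule integrable_continuous)
      show "continuous_on (cbox 0 1) (\<lambda>t. F (z + axis i (circlepath 0 r t)) * \<kappa> r t)"
        using continuous_on_compose2[OF para[OF contF r, of i] pairc, of z] z by (auto simp: image_subset_iff)
    qed
  next
    show "z0 \<in> ball z0 r" using r by simp
    show "convex (ball z0 r)" by (rule convex_ball)
  qed
  then have D: "((\<lambda>z. integral (cbox 0 1) (\<lambda>t. F (z + axis i (circlepath 0 r t)) * \<kappa> r t)) has_derivative
     integral (cbox 0 1) (fx z0)) (at z0)"
    by (subst (asm) at_within_open) (rule centre_in_ball[THEN iffD2, OF r(1)], rule open_ball)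
  have int: "fx z0 integrable_on cbox 0 1"
  proof (rule integrable_continuous)
    show "continuous_on (cbox 0 1) (fx z0)"
      using continuous_on_compose2[OF cont_fx pairc, of z0] r(1) by (auto simp: image_subset_iff)
  qed
  have "blinfun_apply (integral (cbox 0 1) (fx z0)) (c *s v) = c * blinfun_apply (integral (cbox 0 1) (fx z0)) v" for c v
  proof -
    have ap: "blinfun_apply (integral (cbox 0 1) (fx z0)) u = integral (cbox 0 1) (\<lambda>t. blinfun_apply (fx z0 t) u)" for u
      using integral_linear[OF int, of "\<lambda>b. blinfun_apply b u"]
      by (simp add: o_def blinfun.bounded_linear_left)
    show ?thesis
      unfolding ap fx_apply
      by (subst integral_mult_right[symmetric]) (simp add: sum_distrib_left algebra_simps)
  qed
  with D have "cdiff_at (\<lambda>z. integral (cbox 0 1) (\<lambda>t. F (z + axis i (circlepath 0 r t)) * \<kappa> r t)) z0"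
    unfolding cdiff_at_def by blast
  then show ?thesis
    by (rule cdiff_at_cong_open[of _ _ "ball z0 r"]) (use r(1) eq in auto)
qed

lemma partial_add:
  assumes "cdiff_at F z" "cdiff_at G z"
  shows "partial i (\<lambda>z. F z + G z) z = partial i F z + partial i G z"
  using DERIV_add[OF has_partial[OF assms(1), of i] has_partial[OF assms(2), of i]]
  by (simp add: partial_def DERIV_imp_deriv)

lemma partial_mult:
  assumes "cdiff_at F z" "cdiff_at G z"
  shows "partial i (\<lambda>z. F z * G z) z = partial i F z * G z + F z * partial i G z"
  using DERIV_mult[OF has_partial[OF assms(1), of i] has_partial[OF assms(2), of i]]
  by (simp add: partial_def DERIV_imp_deriv axis_zero)

lemma partial_cong:
  assumes "open N" "z \<in> N" "\<And>w. w \<in> N \<Longrightarrow> F w = G w"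
  shows "partial i F z = partial i G z"
proof -
  have "isCont (\<lambda>\<zeta>::complex. z + axis i \<zeta>) 0" by (rule isCont_axis)
  moreover have "z + axis i 0 \<in> N" using assms(2) by (simp add: axis_zero)
  ultimately have "\<forall>\<^sub>F \<zeta> in nhds 0. z + axis i \<zeta> \<in> N"
    using assms(1) unfolding continuous_at_open eventually_nhds by blast
  then have "\<forall>\<^sub>F \<zeta> in nhds 0. F (z + axis i \<zeta>) = G (z + axis i \<zeta>)"
    by eventually_elim (rule assms(3))
  then show ?thesis unfolding partial_def by (rule deriv_cong_ev) simp
qed

text \<open>
  The identity theorem.  The complex line through \<open>p\<close> and \<open>q\<close> meets the convex set \<open>B\<close> in a
  connected set, so the theorem in one variable applies on that line.
\<close>

lemma cdiff_zero_on_convex: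
  fixes F :: "complex ^ 'm::finite \<Rightarrow> complex"
  assumes "open B" "convex B" "\<And>z. z \<in> B \<Longrightarrow> cdiff_at F z"
    and N: "open N" "p \<in> N" "N \<subseteq> B" "\<And>z. z \<in> N \<Longrightarrow> F z = 0" and "q \<in> B"
  shows "F q = 0"
proof -
  \<comment> \<open>The complex line with \<open>l 0 = p\<close> and \<open>l 1 = q\<close>.\<close>
  define l where "l \<zeta> = p + \<zeta> *s (q - p)" for \<zeta> :: complex
  have contl: "continuous_on UNIV l"
    unfolding l_def by (intro continuous_intros bounded_linear.continuous_on[OF bounded_linear_line])
  have oB: "open (l -` B)" "open (l -` N)"
    using contl assms(1) N(1) by (auto intro: open_vimage)
  have "convex (l -` B)"
  proof (rule convexI)
    fix a b :: complex and u v :: real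
    assume "a \<in> l -` B" "b \<in> l -` B" and uv: "0 \<le> u" "0 \<le> v" "u + v = 1"
    then have "u *\<^sub>R l a + v *\<^sub>R l b \<in> B" using assms(2) by (auto simp: convex_def)
    moreover have "u *\<^sub>R l a + v *\<^sub>R l b = l (u *\<^sub>R a + v *\<^sub>R b)"
    proof -
      have "u *\<^sub>R l a + v *\<^sub>R l b = (u + v) *\<^sub>R p + (u *\<^sub>R a + v *\<^sub>R b) *s (q - p)"
        unfolding l_def by (simp add: vec_eq_iff algebra_simps)
      then show ?thesis using uv by (simp add: l_def)
    qed
    ultimately show "u *\<^sub>R a + v *\<^sub>R b \<in> l -` B" by simp
  qed
  then have conn: "connected (l -` B)" by (rule convex_connected)
  have hol: "(\<lambda>\<zeta>. F (l \<zeta>)) holomorphic_on l -` B"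
  proof -
    have "(\<lambda>\<zeta>. F (l \<zeta>)) field_differentiable at \<zeta>" if z: "\<zeta> \<in> l -` B" for \<zeta>
    proof -
      obtain L where L: "(F has_derivative L) (at (l \<zeta>))" "\<forall>c v. L (c *s v) = c * L v"
        using assms(3)[OF vimageD[OF z]] unfolding cdiff_at_def by blast
      from has_derivative_on_line[OF L(1)[unfolded l_def] L(2)]
      show ?thesis unfolding field_differentiable_def l_def by blast
    qed
    then show ?thesis by (auto simp: holomorphic_on_def intro: field_differentiable_at_within)
  qed
  have l0: "l 0 = p" and l1: "l 1 = q" by (auto simp: l_def)
  have "0 islimpt (l -` N)"
    using oB(2) N(2) l0 by (simp add: interior_limit_point interior_open)
  from analytic_continuation[OF hol oB(1) conn _ _ this]
  have "F (l 1) = 0" using N assms(8) l0 l1 by auto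
  then show ?thesis by (simp add: l1)
qed

section \<open>Commutators of differential operators with \<open>t\<close>\<close>

text \<open>
  Holomorphy in one fixed chart, the one to which the coordinate derivatives refer.
\<close>

definition chol :: "('a, 'm::finite) chart \<Rightarrow> 'a set \<Rightarrow> ('a \<Rightarrow> complex) set" where
  "chol c G = {g. \<forall>y\<in>G. cdiff_at (\<lambda>z. g (inv_into (fst c) (snd c) z)) (snd c y)}"

lemma is_chart_inv:
  assumes "is_chart c" "y \<in> fst c"
  shows "inv_into (fst c) (snd c) (snd c y) = y"
  using assms unfolding is_chart_def homeomorphism_def by (auto split: prod.splits)

lemma is_chart_open_image:
  assumes "is_chart c" "open G" "G \<subseteq> fst c"
  shows "open (snd c ` G)"
proof -
  obtain U \<phi> where c: "c = (U, \<phi>)" by (cases c)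
  have "homeomorphism U (\<phi> ` U) \<phi> (inv_into U \<phi>)" and op: "open (\<phi> ` U)"
    using assms(1) unfolding c is_chart_def by auto
  then have "openin (top_of_set (\<phi> ` U)) (\<phi> ` G)"
    by (rule_tac homeomorphism_imp_open_map) (use assms(2,3) c in \<open>auto simp: open_subset\<close>)
  with op show ?thesis unfolding c by (simp add: openin_open_eq)
qed

lemma pd_eq_partial: "pd c i g y = partial i (\<lambda>z. g (inv_into (fst c) (snd c) z)) (snd c y)"
  by (cases c) (simp add: pd_def partial_def)

lemma pd_cong:
  assumes "is_chart c" "open G" "G \<subseteq> fst c" "y \<in> G" "\<And>y. y \<in> G \<Longrightarrow> g y = h y"
  shows "pd c i g y = pd c i h y"
  unfolding pd_eq_partial
  by (rule partial_cong[OF is_chart_open_image[OF assms(1-3)]])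
    (use assms is_chart_inv[OF assms(1)] in auto)

lemma cdiff_chart_cong:
  assumes "is_chart c" "open G" "G \<subseteq> fst c" "y \<in> G" "\<And>y. y \<in> G \<Longrightarrow> g y = h y"
    and "cdiff_at (\<lambda>z. g (inv_into (fst c) (snd c) z)) (snd c y)"
  shows "cdiff_at (\<lambda>z. h (inv_into (fst c) (snd c) z)) (snd c y)"
  by (rule cdiff_at_cong_open[OF assms(6) is_chart_open_image[OF assms(1-3)]])
    (use assms is_chart_inv[OF assms(1)] in auto)

lemma chol_pd:
  assumes "is_chart c" "open G" "G \<subseteq> fst c" "g \<in> chol c G"
  shows "pd c i g \<in> chol c G"
  unfolding chol_def
proof safe
  fix y assume y: "y \<in> G"
  have "cdiff_at (partial i (\<lambda>z. g (inv_into (fst c) (snd c) z))) (snd c y)"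
    by (rule cdiff_at_partial[OF is_chart_open_image[OF assms(1-3)]]) (use assms(4) y in \<open>auto simp: chol_def\<close>)
  then show "cdiff_at (\<lambda>z. pd c i g (inv_into (fst c) (snd c) z)) (snd c y)"
    by (rule cdiff_at_cong_open[OF _ is_chart_open_image[OF assms(1-3)]])
      (use assms y is_chart_inv[OF assms(1)] in \<open>auto simp: pd_eq_partial\<close>)
qed

lemma chol_const: "(\<lambda>_. a) \<in> chol c G"
  by (simp add: chol_def cdiff_at_const)

lemma chol_add: "g \<in> chol c G \<Longrightarrow> h \<in> chol c G \<Longrightarrow> (\<lambda>y. g y + h y) \<in> chol c G"
  by (simp add: chol_def cdiff_at_add)

lemma chol_diff: "g \<in> chol c G \<Longrightarrow> h \<in> chol c G \<Longrightarrow> (\<lambda>y. g y - h y) \<in> chol c G"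
  by (simp add: chol_def cdiff_at_diff)

lemma chol_mult: "g \<in> chol c G \<Longrightarrow> h \<in> chol c G \<Longrightarrow> (\<lambda>y. g y * h y) \<in> chol c G"
  by (simp add: chol_def cdiff_at_mult)

lemma pd_add:
  assumes "is_chart c" "G \<subseteq> fst c" "g \<in> chol c G" "h \<in> chol c G" "y \<in> G"
  shows "pd c i (\<lambda>y. g y + h y) y = pd c i g y + pd c i h y"
  using assms unfolding pd_eq_partial chol_def by (auto intro!: partial_add)

lemma pd_mult:
  assumes "is_chart c" "G \<subseteq> fst c" "g \<in> chol c G" "h \<in> chol c G" "y \<in> G"
  shows "pd c i (\<lambda>y. g y * h y) y = pd c i g y * h y + g y * pd c i h y"
  using assms unfolding pd_eq_partial chol_def
  by (subst partial_mult) (auto simp: is_chart_inv subset_iff)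

lemma pd_const: "pd c i (\<lambda>_. a) y = 0"
  by (simp add: pd_eq_partial partial_def)

lemma pd_lin:
  assumes "is_chart c" "G \<subseteq> fst c" "g \<in> chol c G" "h \<in> chol c G" "y \<in> G"
  shows "pd c i (\<lambda>y. a * g y + b * h y) y = a * pd c i g y + b * pd c i h y"
  using pd_add[OF assms(1,2) chol_mult[OF chol_const assms(3)] chol_mult[OF chol_const assms(4)] assms(5)]
    pd_mult[OF assms(1,2) chol_const assms(3,5)] pd_mult[OF assms(1,2) chol_const assms(4,5)]
  by (simp add: pd_const)

text \<open>
  Sections over \<open>G\<close> with holomorphic components, locally finitely many of them nonzero.  In use, \<open>G\<close>
  lies off the zero set of \<open>f\<close>, where meromorphic sections are of this kind.
\<close>

definition hsec :: "('a::topological_space, 'm::finite) chart \<Rightarrow> 'a set \<Rightarrow> 'a dsec set" where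
  "hsec c G = {s. (\<forall>k. s k \<in> chol c G) \<and>
     (\<forall>x\<in>G. \<exists>G' K. open G' \<and> x \<in> G' \<and> G' \<subseteq> G \<and> (\<forall>k\<ge>K. \<forall>y\<in>G'. s k y = 0))}"

lemma hsec_fin: "s \<in> hsec c G \<Longrightarrow> y \<in> G \<Longrightarrow> \<exists>N. \<forall>k\<ge>N. s k y = 0"
  unfolding hsec_def by blast

lemma hsec_lin:
  assumes "s \<in> hsec c G" "s' \<in> hsec c G"
  shows "(\<lambda>k y. a * s k y + b * s' k y) \<in> hsec c G"
proof -
  have "\<exists>G' K. open G' \<and> x \<in> G' \<and> G' \<subseteq> G \<and> (\<forall>k\<ge>K. \<forall>y\<in>G'. a * s k y + b * s' k y = 0)" if "x \<in> G" for x
  proof -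
    obtain G1 K1 where 1: "open G1" "x \<in> G1" "G1 \<subseteq> G" "\<forall>k\<ge>K1. \<forall>y\<in>G1. s k y = 0"
      using assms(1) \<open>x \<in> G\<close> unfolding hsec_def by blast
    obtain G2 K2 where 2: "open G2" "x \<in> G2" "G2 \<subseteq> G" "\<forall>k\<ge>K2. \<forall>y\<in>G2. s' k y = 0"
      using assms(2) \<open>x \<in> G\<close> unfolding hsec_def by blast
    show ?thesis
      by (rule exI[of _ "G1 \<inter> G2"], rule exI[of _ "max K1 K2"]) (use 1 2 in auto)
  qed
  then show ?thesis
    using assms unfolding hsec_def by (auto intro!: chol_add chol_mult chol_const)
qed

lemma hsec_diff: "s \<in> hsec c G \<Longrightarrow> s' \<in> hsec c G \<Longrightarrow> (\<lambda>k y. s k y - s' k y) \<in> hsec c G"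
  using hsec_lin[of s c G s' 1 "-1"] by simp

lemma hsec_t_act:
  assumes "f \<in> chol c G" "s \<in> hsec c G"
  shows "t_act f s \<in> hsec c G"
proof -
  have "\<exists>G' K. open G' \<and> x \<in> G' \<and> G' \<subseteq> G \<and> (\<forall>k\<ge>K. \<forall>y\<in>G'. t_act f s k y = 0)" if x: "x \<in> G" for x
  proof -
    obtain G1 K1 where 1: "open G1" "x \<in> G1" "G1 \<subseteq> G" "\<forall>k\<ge>K1. \<forall>y\<in>G1. s k y = 0"
      using assms(2) x unfolding hsec_def by blast
    then show ?thesis
      by (intro exI[of _ G1] exI[of _ K1]) (auto simp: t_act_def)
  qed
  moreover have "t_act f s k \<in> chol c G" for k
    unfolding t_act_def using assms unfolding hsec_def
    by (intro chol_diff chol_mult chol_const) auto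
  ultimately show ?thesis unfolding hsec_def by auto
qed

lemma hsec_d_act:
  assumes "is_chart c" "open G" "G \<subseteq> fst c" "f \<in> chol c G" "s \<in> hsec c G"
  shows "d_act c f i s \<in> hsec c G"
proof -
  have "\<exists>G' K. open G' \<and> x \<in> G' \<and> G' \<subseteq> G \<and> (\<forall>k\<ge>K. \<forall>y\<in>G'. d_act c f i s k y = 0)" if x: "x \<in> G" for x
  proof -
    obtain G1 K1 where 1: "open G1" "x \<in> G1" "G1 \<subseteq> G" "\<forall>k\<ge>K1. \<forall>y\<in>G1. s k y = 0"
      using assms(5) x unfolding hsec_def by blast
    have "d_act c f i s k y = 0" if k: "k \<ge> Suc K1" and y: "y \<in> G1" for k y
    proof -
      have "pd c j (s k) y = pd c j (\<lambda>_. 0) y" for j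
        by (rule pd_cong[OF assms(1) 1(1) _ y]) (use 1 assms(3) k in auto)
      then show ?thesis
        using 1(4) k y unfolding d_act_def dt_act_def dx_act_def
        by (auto split: option.split nat.split simp: pd_const)
    qed
    with 1 show ?thesis by blast
  qed
  moreover have "d_act c f i s k \<in> chol c G" for k
  proof -
    have s: "s k \<in> chol c G" for k using assms(5) unfolding hsec_def by auto
    have 1: "(\<lambda>y. case k of 0 \<Rightarrow> 0 | Suc j \<Rightarrow> s j y) \<in> chol c G"
      using s by (cases k) (auto simp: chol_const)
    have 2: "(\<lambda>y. case k of 0 \<Rightarrow> 0 | Suc j \<Rightarrow> pd c j' f y * s j y) \<in> chol c G" for j'
      using s by (cases k) (auto simp: chol_const intro!: chol_mult chol_pd assms)
    show ?thesis
      unfolding d_act_def dt_act_def dx_act_def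
      using 1 by (cases i) (auto intro!: chol_diff chol_pd assms s 2)
  qed
  ultimately show ?thesis unfolding hsec_def by auto
qed

lemma d_act_cong:
  assumes "is_chart c" "open G" "G \<subseteq> fst c" "\<And>k y. y \<in> G \<Longrightarrow> s k y = s' k y" "y \<in> G"
  shows "d_act c f i s k y = d_act c f i s' k y"
proof -
  have "pd c j (s k) y = pd c j (s' k) y" for j
    by (rule pd_cong[OF assms(1-3,5)]) (use assms(4) in auto)
  then show ?thesis
    using assms(4,5) unfolding d_act_def dt_act_def dx_act_def
    by (auto split: option.split nat.split)
qed

definition d_word :: "('a, 'm::finite) chart \<Rightarrow> ('a \<Rightarrow> complex) \<Rightarrow> 'm option list \<Rightarrow> 'a dsec \<Rightarrow> 'a dsec" where
  "d_word c f w = foldr (d_act c f) w"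

lemma d_word_simps [simp]:
  "d_word c f [] s = s" "d_word c f (i # w) s = d_act c f i (d_word c f w s)"
  by (simp_all add: d_word_def)

lemma op_act_d_word: "op_act c f P s k y = (\<Sum>(a, w)\<leftarrow>P. mult_act f a (d_word c f w s) k y)"
  by (simp add: op_act_def d_word_def)

lemma d_act_word_cong:
  assumes "is_chart c" "open G" "G \<subseteq> fst c" "\<And>k y. y \<in> G \<Longrightarrow> s k y = s' k y" "y \<in> G"
  shows "d_word c f w s k y = d_word c f w s' k y"
  using assms(5)
proof (induction w arbitrary: k y)
  case Nil then show ?case using assms(4) by simp
next
  case (Cons i w)
  then show ?case unfolding d_word_simps by (intro d_act_cong[OF assms(1-3)])
qed

lemma mult_act_cong: "(\<And>k. s k y = s' k y) \<Longrightarrow> mult_act f g s k y = mult_act f g s' k y"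
  by (simp add: mult_act_def)

lemma op_act_cong:
  assumes "is_chart c" "open G" "G \<subseteq> fst c" "\<And>k y. y \<in> G \<Longrightarrow> s k y = s' k y" "y \<in> G"
  shows "op_act c f P s k y = op_act c f P s' k y"
proof -
  have "mult_act f a (d_word c f w s) k y = mult_act f a (d_word c f w s') k y" for a w
    by (rule mult_act_cong) (rule d_act_word_cong[OF assms])
  then show ?thesis unfolding op_act_d_word by simp
qed

lemma d_act_zero: "d_act c f i (\<lambda>_ _. 0) k y = 0"
  unfolding d_act_def dt_act_def dx_act_def by (auto split: option.split nat.split simp: pd_const)

lemma d_act_lin:
  assumes "is_chart c" "G \<subseteq> fst c" "s \<in> hsec c G" "s' \<in> hsec c G" "y \<in> G"
  shows "d_act c f i (\<lambda>k y. a * s k y + b * s' k y) k y = a * d_act c f i s k y + b * d_act c f i s' k y"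
proof -
  have s: "s k \<in> chol c G" "s' k \<in> chol c G" for k using assms unfolding hsec_def by auto
  then show ?thesis
    unfolding d_act_def dt_act_def dx_act_def
    by (cases i; cases k) (auto simp: pd_lin[OF assms(1,2) s assms(5)] algebra_simps)
qed

text \<open>
  The relations \<open>[t, \<partial>\<^sub>t] = -1\<close> and \<open>[t, \<partial>\<^sub>x] = 0\<close>.  The second one is the product rule for
  \<open>\<partial>\<^sub>x\<close>, which is why the components of \<open>s\<close> have to be holomorphic.
\<close>

lemma t_d_act_commute:
  assumes "is_chart c" "G \<subseteq> fst c" "f \<in> chol c G" "s \<in> hsec c G" "y \<in> G"
  shows "t_act f (d_act c f i s) k y =
    d_act c f i (t_act f s) k y - (if i = None then s k y else 0)"
proof (cases i)
  case None
  then show ?thesis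
    unfolding d_act_def dt_act_def t_act_def by (cases k) (auto simp: algebra_simps)
next
  case (Some j)
  have s: "s k \<in> chol c G" for k using assms unfolding hsec_def by auto
  have "pd c j (\<lambda>y. f y * s k y - of_nat (k + 1) * s (k + 1) y) y =
      pd c j f y * s k y + f y * pd c j (s k) y - of_nat (k + 1) * pd c j (s (k + 1)) y" for k
    using pd_lin[OF assms(1,2) chol_mult[OF assms(3) s] s assms(5), of j 1 k "- of_nat (k+1)" "k+1", unfolded mult_minus_left diff_conv_add_uminus[symmetric]]
      pd_mult[OF assms(1,2,3) s assms(5), of j k]
    by simp
  then have "pd c j (t_act f s k) y =
      pd c j f y * s k y + f y * pd c j (s k) y - of_nat (k + 1) * pd c j (s (k + 1)) y" for k
    unfolding t_act_def .
  note e = this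
  show ?thesis
    unfolding d_act_def dx_act_def Some using e[of k]
    by (cases k) (auto simp: t_act_def[of f "\<lambda>k y. _ k y"] t_act_def[of f s] algebra_simps)
qed

text \<open>
  The iterated commutator \<open>(ad t)\<^sup>n Q\<close>.
\<close>

primrec adT :: "('a \<Rightarrow> complex) \<Rightarrow> nat \<Rightarrow> ('a dsec \<Rightarrow> 'a dsec) \<Rightarrow> 'a dsec \<Rightarrow> 'a dsec" where
  "adT f 0 Q s = Q s"
| "adT f (Suc n) Q s = (\<lambda>k y. t_act f (adT f n Q s) k y - adT f n Q (t_act f s) k y)"

lemma adT_id: "n > 0 \<Longrightarrow> adT f n id s = (\<lambda>_ _. 0)"
proof (induction n arbitrary: s)
  case (Suc n)
  then show ?case by (cases n) (auto simp: t_act_def fun_eq_iff)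
qed simp

lemma hsec_word:
  assumes "is_chart c" "open G" "G \<subseteq> fst c" "f \<in> chol c G" "s \<in> hsec c G"
  shows "d_word c f w s \<in> hsec c G"
  by (induction w) (use hsec_d_act[OF assms(1-4)] assms(5) in auto)

lemma adT_word_hsec:
  assumes "is_chart c" "open G" "G \<subseteq> fst c" "f \<in> chol c G" "s \<in> hsec c G"
  shows "adT f n (d_word c f w) s \<in> hsec c G"
  using assms(5)
proof (induction n arbitrary: s)
  case 0
  then show ?case using hsec_word assms by simp
next
  case (Suc n)
  then show ?case
    using hsec_diff[OF hsec_t_act[OF assms(4)]] hsec_t_act[OF assms(4)] by simp
qed

lemma t_act_lin: "t_act f (\<lambda>k y. a * s k y + b * s' k y) k y = a * t_act f s k y + b * t_act f s' k y"
  by (simp add: t_act_def algebra_simps)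

text \<open>
  Leibniz rule for the derivation \<open>ad t\<close>: its iterates on \<open>\<partial>\<^sub>i\<close> are \<open>ad t (\<partial>\<^sub>i) = -1\<close> or \<open>0\<close>, and
  zero from the second on, so only two terms of the binomial expansion survive.
\<close>

lemma adT_Cons:
  assumes "is_chart c" "open G" "G \<subseteq> fst c" "f \<in> chol c G" "s \<in> hsec c G" "y \<in> G"
  shows "adT f n (d_word c f (i # w)) s k y =
     d_act c f i (adT f n (d_word c f w) s) k y -
     (if i = None then of_nat n * adT f (n - 1) (d_word c f w) s k y else 0)"
  using assms(5,6)
proof (induction n arbitrary: s k y)
  case 0
  then show ?case by simp
next
  case (Suc n)
  define e :: complex where "e = (if i = None then 1 else 0)"
  let ?W = "d_word c f w"
  let ?A = "adT f n ?W s" and ?A' = "adT f n ?W (t_act f s)"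
  let ?B = "adT f (n - 1) ?W s" and ?B' = "adT f (n - 1) ?W (t_act f s)"
  have hs: "?A \<in> hsec c G" "?A' \<in> hsec c G"
    using adT_word_hsec[OF assms(1-4)] hsec_t_act[OF assms(4)] Suc.prems by blast+
  have tA: "t_act f ?A \<in> hsec c G" using hs hsec_t_act[OF assms(4)] by blast
  have IH: "adT f n (d_word c f (i # w)) s k y = d_act c f i ?A k y - e * of_nat n * ?B k y" for k
    using Suc.IH[OF Suc.prems] by (cases i) (simp_all add: e_def del: d_word_simps)
  have IH': "adT f n (d_word c f (i # w)) (t_act f s) k y = d_act c f i ?A' k y - e * of_nat n * ?B' k y" for k
    using Suc.IH[OF hsec_t_act[OF assms(4) Suc.prems(1)] Suc.prems(2)] by (cases i) (simp_all add: e_def del: d_word_simps)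
  have 1: "t_act f (adT f n (d_word c f (i # w)) s) k y =
      t_act f (d_act c f i ?A) k y - e * of_nat n * t_act f ?B k y"
    unfolding t_act_def IH by (simp add: algebra_simps)
  have 2: "t_act f (d_act c f i ?A) k y = d_act c f i (t_act f ?A) k y - e * ?A k y"
    using t_d_act_commute[OF assms(1,3,4) hs(1) Suc.prems(2)] by (simp add: e_def)
  have 3: "d_act c f i (adT f (Suc n) (d_word c f w) s) k y = d_act c f i (t_act f ?A) k y - d_act c f i ?A' k y"
    using d_act_lin[OF assms(1,3) tA hs(2) Suc.prems(2), of f i 1 "-1"] by simp
  have 4: "of_nat n * (t_act f ?B k y - ?B' k y) = of_nat n * ?A k y"
    by (cases n) auto
  have "adT f (Suc n) (d_word c f (i # w)) s k y =
      t_act f (adT f n (d_word c f (i # w)) s) k y - adT f n (d_word c f (i # w)) (t_act f s) k y"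
    by (simp only: adT.simps)
  also have "\<dots> = d_act c f i (adT f (Suc n) (d_word c f w) s) k y - e * ?A k y
      - e * (of_nat n * (t_act f ?B k y - ?B' k y))"
    unfolding 1 2 3 IH' by (simp only: algebra_simps)
  also have "\<dots> = d_act c f i (adT f (Suc n) (d_word c f w) s) k y - e * (of_nat (Suc n) * ?A k y)"
    unfolding 4 by (simp add: algebra_simps del: adT.simps)
  finally show ?case by (cases i) (simp_all add: e_def del: d_word_simps adT.simps)
qed

text \<open>
  Each commutator with \<open>t\<close> removes at least one derivative from the word.
\<close>

lemma adT_word_vanish:
  assumes "is_chart c" "open G" "G \<subseteq> fst c" "f \<in> chol c G" "s \<in> hsec c G" "y \<in> G" "n > length w"
  shows "adT f n (d_word c f w) s k y = 0"
  using assms(6,7)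
proof (induction w arbitrary: n k y)
  case Nil
  then show ?case using adT_id[of n f s] by (simp add: d_word_def id_def)
next
  case (Cons i w)
  have "d_act c f i (adT f n (d_word c f w) s) k y = d_act c f i (\<lambda>_ _. 0) k y"
    by (rule d_act_cong[OF assms(1-3)]) (use Cons in auto)
  then show ?case
    using Cons adT_Cons[OF assms(1-5), of y n i w k] by (simp add: d_act_zero del: d_word_simps)
qed

lemma mult_act_finite_sum:
  assumes "\<forall>i\<ge>N. s i y = 0"
  shows "mult_act f g s k y =
     (\<Sum>i<N. (- 1) ^ i * of_nat ((k + i) choose i) * (deriv ^^ i) (\<lambda>t. g (y, t)) (f y) * s (k + i) y)"
  unfolding mult_act_def
  by (rule sum.mono_neutral_left) (use assms in \<open>auto simp: not_le[symmetric]\<close>)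

lemma mult_act_fin:
  assumes "\<forall>i\<ge>N. s i y = 0" "k \<ge> N"
  shows "mult_act f g s k y = 0"
  unfolding mult_act_finite_sum[of N s y, OF assms(1)] using assms by simp

lemma mult_act_lin:
  assumes "\<exists>N. \<forall>i\<ge>N. s i y = 0" "\<exists>N. \<forall>i\<ge>N. s' i y = 0"
  shows "mult_act f g (\<lambda>k y. a * s k y + b * s' k y) k y = a * mult_act f g s k y + b * mult_act f g s' k y"
proof -
  obtain N N' where N: "\<forall>i\<ge>N. s i y = 0" "\<forall>i\<ge>N'. s' i y = 0" using assms by blast
  let ?M = "max N N'"
  have 1: "\<forall>i\<ge>?M. s i y = 0" and 2: "\<forall>i\<ge>?M. s' i y = 0" and 3: "\<forall>i\<ge>?M. a * s i y + b * s' i y = 0"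
    using N by auto
  show ?thesis
    unfolding mult_act_finite_sum[of ?M s y, OF 1] mult_act_finite_sum[of ?M s' y, OF 2]
      mult_act_finite_sum[of ?M "\<lambda>k y. a * s k y + b * s' k y" y, OF 3]
    by (simp add: sum_distrib_left sum.distrib[symmetric] algebra_simps)
qed

text \<open>
  Multiplication by a function of \<open>(x,t)\<close> commutes with \<open>t\<close>.  On coefficients this is the
  absorption identity for binomial coefficients.
\<close>

lemma mult_act_t_act:
  assumes "\<exists>N. \<forall>i\<ge>N. s i y = 0"
  shows "mult_act f g (t_act f s) k y = t_act f (mult_act f g s) k y"
proof -
  obtain N where N: "\<forall>i\<ge>N. s i y = 0" using assms by blast
  have N': "\<forall>i\<ge>N. t_act f s i y = 0" using N by (simp add: t_act_def)
  define c where "c i = (- 1) ^ i * (deriv ^^ i) (\<lambda>t. g (y, t)) (f y)" for i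
  have choose: "of_nat (k + 1) * of_nat ((k + 1 + i) choose i) =
      (of_nat ((k + i) choose i) * of_nat (k + i + 1) :: complex)" for i
  proof -
    have "(k + 1) * ((k + 1 + i) choose i) = ((k + i) choose i) * (k + i + 1)"
      using Suc_times_binomial_eq[of "k + i" k] binomial_symmetric[of i "k + 1 + i"] binomial_symmetric[of i "k + i"]
      by (simp add: mult.commute)
    then show ?thesis by (metis of_nat_mult)
  qed
  have "mult_act f g (t_act f s) k y =
      (\<Sum>i<N. c i * (f y * (of_nat ((k + i) choose i) * s (k + i) y) - of_nat ((k + i) choose i) * of_nat (k + i + 1) * s (k + i + 1) y))"
    unfolding mult_act_finite_sum[of N "t_act f s" y, OF N'] t_act_def c_def by (simp add: algebra_simps)
  also have "\<dots> = (\<Sum>i<N. c i * (f y * (of_nat ((k + i) choose i) * s (k + i) y) - of_nat (k + 1) * (of_nat ((k + 1 + i) choose i) * s (k + 1 + i) y)))"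
  proof (rule sum.cong[OF refl])
    fix i
    have "of_nat ((k + i) choose i) * of_nat (k + i + 1) * s (k + i + 1) y = of_nat (k + 1) * (of_nat ((k + 1 + i) choose i) * s (k + 1 + i) y)"
      using choose[of i] by (metis add.commute add.left_commute mult.assoc)
    then show "c i * (f y * (of_nat ((k + i) choose i) * s (k + i) y) - of_nat ((k + i) choose i) * of_nat (k + i + 1) * s (k + i + 1) y)
      = c i * (f y * (of_nat ((k + i) choose i) * s (k + i) y) - of_nat (k + 1) * (of_nat ((k + 1 + i) choose i) * s (k + 1 + i) y))"
      by simp
  qed
  also have "\<dots> = t_act f (mult_act f g s) k y"
    unfolding t_act_def mult_act_finite_sum[of N s y, OF N] c_def
    by (simp add: sum_distrib_left sum_subtractf algebra_simps)
  finally show ?thesis .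
qed

lemma adT_op_act:
  assumes "is_chart c" "open G" "G \<subseteq> fst c" "f \<in> chol c G" "s \<in> hsec c G" "y \<in> G"
  shows "adT f n (op_act c f P) s k y = (\<Sum>(a, w)\<leftarrow>P. mult_act f a (adT f n (d_word c f w) s) k y)"
  using assms(5,6)
proof (induction n arbitrary: s k y)
  case 0
  then show ?case by (simp add: op_act_d_word)
next
  case (Suc n)
  let ?W = "\<lambda>w. d_word c f w"
  have ts: "t_act f s \<in> hsec c G" using Suc.prems hsec_t_act[OF assms(4)] by blast
  have fin: "\<exists>N. \<forall>i\<ge>N. adT f n (?W w) s i y = 0" "\<exists>N. \<forall>i\<ge>N. adT f n (?W w) (t_act f s) i y = 0"
    "\<exists>N. \<forall>i\<ge>N. t_act f (adT f n (?W w) s) i y = 0" for w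
    using hsec_fin[OF _ Suc.prems(2)] adT_word_hsec[OF assms(1-4)] ts Suc.prems(1) hsec_t_act[OF assms(4)] by blast+
  have "adT f (Suc n) (op_act c f P) s k y =
     f y * (\<Sum>(a, w)\<leftarrow>P. mult_act f a (adT f n (?W w) s) k y)
     - of_nat (k + 1) * (\<Sum>(a, w)\<leftarrow>P. mult_act f a (adT f n (?W w) s) (k + 1) y)
     - (\<Sum>(a, w)\<leftarrow>P. mult_act f a (adT f n (?W w) (t_act f s)) k y)"
    using Suc.IH[OF Suc.prems] Suc.IH[OF ts Suc.prems(2)] unfolding adT.simps t_act_def[of f "adT f n (op_act c f P) s"] by simp
  also have "\<dots> = (\<Sum>(a, w)\<leftarrow>P. t_act f (mult_act f a (adT f n (?W w) s)) k y - mult_act f a (adT f n (?W w) (t_act f s)) k y)"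
    by (induction P) (auto simp: t_act_def algebra_simps split: prod.splits)
  also have "\<dots> = (\<Sum>(a, w)\<leftarrow>P. mult_act f a (adT f (Suc n) (?W w) s) k y)"
  proof -
    have "t_act f (mult_act f a (adT f n (?W w) s)) k y - mult_act f a (adT f n (?W w) (t_act f s)) k y
       = mult_act f a (adT f (Suc n) (?W w) s) k y" for a w
      using mult_act_t_act[of "adT f n (?W w) s" y, OF fin(1)]
        mult_act_lin[of "t_act f (adT f n (?W w) s)" y "adT f n (?W w) (t_act f s)", OF fin(3,2), of f a 1 "-1"] by simp
    then show ?thesis by simp
  qed
  finally show ?case .
qed

text \<open>
  This is Grothendieck's description of the order of a differential operator, in the direction
  that an operator of order \<open>< n\<close> is killed by \<open>(ad t)\<^sup>n\<close>.
\<close>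

lemma adT_op_act_vanish:
  assumes "is_chart c" "open G" "G \<subseteq> fst c" "f \<in> chol c G" "s \<in> hsec c G" "y \<in> G"
    and "\<forall>(a, w)\<in>set P. length w < n"
  shows "adT f n (op_act c f P) s k y = 0"
proof -
  have "mult_act f a (adT f n (d_word c f w) s) k y = 0" if "(a, w) \<in> set P" for a w
    using mult_act_fin[of 0 "adT f n (d_word c f w) s" y k f a]
      adT_word_vanish[OF assms(1-6)] that assms(7) by blast
  then show ?thesis
    unfolding adT_op_act[OF assms(1-6)] by (induction P) auto
qed

lemma adT_op_act_fin:
  assumes "is_chart c" "open G" "G \<subseteq> fst c" "f \<in> chol c G" "s \<in> hsec c G" "y \<in> G"
  shows "\<exists>N. \<forall>k\<ge>N. adT f n (op_act c f P) s k y = 0"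
  unfolding adT_op_act[OF assms]
proof (induction P)
  case (Cons p P)
  obtain a w where p: "p = (a, w)" by (cases p)
  obtain N where N: "\<forall>k\<ge>N. (\<Sum>(a, w)\<leftarrow>P. mult_act f a (adT f n (d_word c f w) s) k y) = 0"
    using Cons by blast
  obtain N' where N': "\<forall>i\<ge>N'. adT f n (d_word c f w) s i y = 0"
    using hsec_fin[OF adT_word_hsec[OF assms(1-5)] assms(6)] by blast
  have "\<forall>k\<ge>max N N'. (\<Sum>(a, w)\<leftarrow>p # P. mult_act f a (adT f n (d_word c f w) s) k y) = 0"
    using N mult_act_fin[of N' "adT f n (d_word c f w) s" y, OF N'] p by simp
  then show ?case by blast
qed simp

section \<open>Polynomials in \<open>\<partial>\<^sub>t t\<close>\<close>

definition lin_closed :: "'a dsec set \<Rightarrow> bool" where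
  "lin_closed G \<longleftrightarrow> (\<lambda>_ _. 0) \<in> G \<and>
     (\<forall>a b. \<forall>s\<in>G. \<forall>s'\<in>G. (\<lambda>k y. a * s k y + b * s' k y) \<in> G)"

lemma lin_closedD: "lin_closed G \<Longrightarrow> s \<in> G \<Longrightarrow> s' \<in> G \<Longrightarrow> (\<lambda>k y. a * s k y + b * s' k y) \<in> G"
  unfolding lin_closed_def by blast

lemma lin_closed_diff: "lin_closed G \<Longrightarrow> s \<in> G \<Longrightarrow> s' \<in> G \<Longrightarrow> (\<lambda>k y. s k y - s' k y) \<in> G"
  using lin_closedD[of G s s' 1 "-1"] by simp

lemma lin_closed_add: "lin_closed G \<Longrightarrow> s \<in> G \<Longrightarrow> s' \<in> G \<Longrightarrow> (\<lambda>k y. s k y + s' k y) \<in> G"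
  using lin_closedD[of G s s' 1 1] by simp

lemma lin_closed_sum:
  assumes "lin_closed G" "\<And>i. i < (p::nat) \<Longrightarrow> s i \<in> G"
  shows "(\<lambda>k y. \<Sum>i<p. s i k y) \<in> G"
  using assms(2)
proof (induction p)
  case 0
  then show ?case using assms(1) by (simp add: lin_closed_def)
next
  case (Suc p)
  then show ?case using lin_closed_add[OF assms(1), of "\<lambda>k y. \<Sum>i<p. s i k y" "s p"] by simp
qed

text \<open>
  The operator \<open>\<partial>\<^sub>t t - \<rho>\<close>.  A polynomial in \<open>\<partial>\<^sub>t t\<close> is represented below by the list of its roots.
\<close>

definition euler :: "('a \<Rightarrow> complex) \<Rightarrow> complex \<Rightarrow> 'a dsec \<Rightarrow> 'a dsec" where
  "euler f \<rho> s = (\<lambda>k y. dt_act (t_act f s) k y - \<rho> * s k y)"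

definition eulers :: "('a \<Rightarrow> complex) \<Rightarrow> complex list \<Rightarrow> 'a dsec \<Rightarrow> 'a dsec" where
  "eulers f R s = foldr (euler f) R s"

lemma eulers_simps [simp]: "eulers f [] s = s" "eulers f (\<rho> # R) s = euler f \<rho> (eulers f R s)"
  by (simp_all add: eulers_def)

lemma eulers_append: "eulers f (R @ R') s = eulers f R (eulers f R' s)"
  by (simp add: eulers_def)

lemma dt_act_lin: "dt_act (\<lambda>k y. a * s k y + b * s' k y) k y = a * dt_act s k y + b * dt_act s' k y"
  by (simp add: dt_act_def split: nat.split)

lemma euler_lin: "euler f \<rho> (\<lambda>k y. a * s k y + b * s' k y) = (\<lambda>k y. a * euler f \<rho> s k y + b * euler f \<rho> s' k y)"
proof (intro ext)
  fix k y
  have "t_act f (\<lambda>k y. a * s k y + b * s' k y) = (\<lambda>k y. a * t_act f s k y + b * t_act f s' k y)"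
    by (intro ext) (simp add: t_act_lin)
  then show "euler f \<rho> (\<lambda>k y. a * s k y + b * s' k y) k y = a * euler f \<rho> s k y + b * euler f \<rho> s' k y"
    unfolding euler_def by (simp add: dt_act_lin algebra_simps)
qed

lemma euler_shift: "euler f \<mu> s = (\<lambda>k y. 1 * euler f \<rho> s k y + (\<rho> - \<mu>) * s k y)"
  by (intro ext) (simp add: euler_def algebra_simps)

lemma euler_commute: "euler f \<rho> (euler f \<mu> s) = euler f \<mu> (euler f \<rho> s)"
proof -
  have "euler f \<rho> (euler f \<mu> s) = euler f \<rho> (\<lambda>k y. 1 * euler f \<rho> s k y + (\<rho> - \<mu>) * s k y)"
    using euler_shift[of f \<mu> s \<rho>] by simp
  also have "\<dots> = (\<lambda>k y. 1 * euler f \<rho> (euler f \<rho> s) k y + (\<rho> - \<mu>) * euler f \<rho> s k y)"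
    by (rule euler_lin)
  also have "\<dots> = euler f \<mu> (euler f \<rho> s)" by (rule euler_shift[symmetric])
  finally show ?thesis .
qed

lemma eulers_commute: "euler f \<rho> (eulers f R s) = eulers f R (euler f \<rho> s)"
  by (induction R) (auto simp: euler_commute[of f \<rho>])

lemma euler_closed:
  assumes "lin_closed G" "\<And>s. s \<in> G \<Longrightarrow> euler f 0 s \<in> G" "s \<in> G"
  shows "euler f \<rho> s \<in> G"
  unfolding euler_shift[of f \<rho> s 0] by (rule lin_closedD[OF assms(1) assms(2)[OF assms(3)] assms(3)])

text \<open>
  Modulo \<open>G\<close> the section \<open>s\<close> is an eigenvector of \<open>\<partial>\<^sub>t t\<close> with eigenvalue \<open>\<rho>\<close>, so a polynomial in
  \<open>\<partial>\<^sub>t t\<close> acts on it as the value of the polynomial at \<open>\<rho>\<close>.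
\<close>

lemma eulers_residue:
  assumes "lin_closed G" "\<And>s. s \<in> G \<Longrightarrow> euler f 0 s \<in> G" "euler f \<rho> s \<in> G"
  shows "\<exists>g\<in>G. eulers f R s = (\<lambda>k y. 1 * g k y + (\<Prod>\<mu>\<leftarrow>R. \<rho> - \<mu>) * s k y)"
proof (induction R)
  case Nil
  then show ?case using assms(1) by (auto simp: lin_closed_def intro!: bexI[of _ "\<lambda>_ _. 0"])
next
  case (Cons \<mu> R)
  let ?p = "\<Prod>\<mu>\<leftarrow>R. \<rho> - \<mu>"
  obtain g where g: "g \<in> G" "eulers f R s = (\<lambda>k y. 1 * g k y + ?p * s k y)" using Cons by blast
  have "eulers f (\<mu> # R) s = (\<lambda>k y. 1 * euler f \<mu> g k y + ?p * euler f \<mu> s k y)"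
    unfolding eulers_simps g(2) by (rule euler_lin)
  also have "\<dots> = (\<lambda>k y. 1 * (1 * euler f \<mu> g k y + ?p * euler f \<rho> s k y) + (\<Prod>\<mu>\<leftarrow>\<mu> # R. \<rho> - \<mu>) * s k y)"
    unfolding euler_shift[of f \<mu> s \<rho>] by (intro ext) (simp add: algebra_simps)
  finally have eq: "eulers f (\<mu> # R) s = \<dots>" .
  have "euler f \<mu> g \<in> G" by (rule euler_closed[OF assms(1) _ g(1)]) (rule assms(2))
  then show ?case
    by (intro bexI[of _ "\<lambda>k y. 1 * euler f \<mu> g k y + ?p * euler f \<rho> s k y"] eq
        lin_closedD[OF assms(1) _ assms(3)])
qed

lemma eulers_coprime_single:
  assumes "lin_closed G" "\<And>s. s \<in> G \<Longrightarrow> euler f 0 s \<in> G" "euler f \<rho> s \<in> G" "eulers f R s \<in> G" "\<rho> \<notin> set R"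
  shows "s \<in> G"
proof -
  let ?p = "\<Prod>\<mu>\<leftarrow>R. \<rho> - \<mu>"
  obtain g where g: "g \<in> G" "eulers f R s = (\<lambda>k y. 1 * g k y + ?p * s k y)"
    using eulers_residue[OF assms(1-3)] by blast
  have p: "?p \<noteq> 0" using assms(5) by (induction R) auto
  have "(\<lambda>k y. (1 / ?p) * eulers f R s k y + (- 1 / ?p) * g k y) \<in> G"
    by (rule lin_closedD[OF assms(1,4) g(1)])
  moreover have "(\<lambda>k y. (1 / ?p) * eulers f R s k y + (- 1 / ?p) * g k y) = s"
    unfolding g(2) using p by (intro ext) (simp add: field_simps)
  ultimately show ?thesis by simp
qed

text \<open>
  The Bezout argument: two polynomials in \<open>\<partial>\<^sub>t t\<close> without a common root generate the unit ideal,
  so a vector that both of them kill modulo \<open>G\<close> is zero modulo \<open>G\<close>.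
\<close>

lemma eulers_coprime:
  assumes "lin_closed G" "\<And>s. s \<in> G \<Longrightarrow> euler f 0 s \<in> G" "eulers f R s \<in> G" "eulers f R' s \<in> G" "set R \<inter> set R' = {}"
  shows "s \<in> G"
  using assms(3-5)
proof (induction R arbitrary: s)
  case Nil then show ?case by simp
next
  case (Cons \<rho> R)
  have "euler f \<rho> s \<in> G"
  proof (rule Cons.IH)
    show "eulers f R (euler f \<rho> s) \<in> G" using Cons.prems by (simp add: eulers_commute)
    show "eulers f R' (euler f \<rho> s) \<in> G"
      using euler_closed[OF assms(1,2) Cons.prems(2)] by (simp add: eulers_commute)
  qed (use Cons.prems in auto)
  from eulers_coprime_single[OF assms(1,2) this Cons.prems(2)] show ?case using Cons.prems by auto
qed

lemma dt_euler: "dt_act (euler f \<rho> s) = euler f (\<rho> - 1) (dt_act s)"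
  unfolding euler_def
  by (intro ext) (auto simp: dt_act_def t_act_def algebra_simps split: nat.split)

lemma dt_pow_euler: "(dt_act ^^ n) (euler f \<rho> s) = euler f (\<rho> - of_nat n) ((dt_act ^^ n) s)"
  by (induction n) (auto simp: dt_euler algebra_simps)

text \<open>
  The identity \<open>\<partial>\<^sub>t\<^sup>n t\<^sup>n = (\<partial>\<^sub>t t) (\<partial>\<^sub>t t + 1) \<dots> (\<partial>\<^sub>t t + n - 1)\<close>.  It turns information on \<open>t\<^sup>n s\<close> into a polynomial in
  \<open>\<partial>\<^sub>t t\<close> whose roots are all \<open>\<le> 0\<close>.
\<close>

lemma dt_pow_t_pow:
  "(dt_act ^^ n) ((t_act f ^^ n) s) = eulers f (rev (map (\<lambda>j. - of_nat j) [0..<n])) s"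
proof (induction n)
  case (Suc n)
  have "(dt_act ^^ Suc n) ((t_act f ^^ Suc n) s) = (dt_act ^^ n) (dt_act (t_act f ((t_act f ^^ n) s)))"
    by (simp add: funpow_swap1)
  also have "dt_act (t_act f ((t_act f ^^ n) s)) = euler f 0 ((t_act f ^^ n) s)"
    by (simp add: euler_def)
  also have "(dt_act ^^ n) \<dots> = euler f (- of_nat n) ((dt_act ^^ n) ((t_act f ^^ n) s))"
    by (simp add: dt_pow_euler)
  finally show ?case using Suc by simp
qed simp

section \<open>Holomorphic functions as operators\<close>

lemma hol_sheaf_chol: "g \<in> hol_sheaf A U \<Longrightarrow> c \<in> A \<Longrightarrow> G \<subseteq> U \<Longrightarrow> G \<subseteq> fst c \<Longrightarrow> g \<in> chol c G"
  by (cases c) (fastforce simp: hol_sheaf_def chol_def)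

lemma hol_sheaf_iff_chol: "g \<in> hol_sheaf A U \<longleftrightarrow> (\<forall>c\<in>A. g \<in> chol c (fst c \<inter> U))"
  by (fastforce simp: hol_sheaf_def chol_def)

lemma hol_sheaf_mono: "g \<in> hol_sheaf A U \<Longrightarrow> U' \<subseteq> U \<Longrightarrow> g \<in> hol_sheaf A U'"
  by (fastforce simp: hol_sheaf_def)

lemma hol_sheaf_const: "(\<lambda>_. a) \<in> hol_sheaf A U"
  by (simp add: hol_sheaf_iff_chol chol_const)

lemma hol_sheaf_add: "g \<in> hol_sheaf A U \<Longrightarrow> h \<in> hol_sheaf A U \<Longrightarrow> (\<lambda>y. g y + h y) \<in> hol_sheaf A U"
  by (simp add: hol_sheaf_iff_chol chol_add)

lemma hol_sheaf_diff: "g \<in> hol_sheaf A U \<Longrightarrow> h \<in> hol_sheaf A U \<Longrightarrow> (\<lambda>y. g y - h y) \<in> hol_sheaf A U"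
  by (simp add: hol_sheaf_iff_chol chol_diff)

lemma hol_sheaf_mult: "g \<in> hol_sheaf A U \<Longrightarrow> h \<in> hol_sheaf A U \<Longrightarrow> (\<lambda>y. g y * h y) \<in> hol_sheaf A U"
  by (simp add: hol_sheaf_iff_chol chol_mult)

lemma hol_sheaf_power: "g \<in> hol_sheaf A U \<Longrightarrow> (\<lambda>y. g y ^ r) \<in> hol_sheaf A U"
  by (induction r) (auto intro: hol_sheaf_const hol_sheaf_mult)

lemma hol_sheaf_sum: "(\<And>i. i \<in> I \<Longrightarrow> g i \<in> hol_sheaf A U) \<Longrightarrow> (\<lambda>y. \<Sum>i\<in>I. g i y) \<in> hol_sheaf A U"
  by (induction I rule: infinite_finite_induct) (auto intro: hol_sheaf_const hol_sheaf_add)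

lemma hol_sheaf_continuous:
  assumes "complex_manifold A" "g \<in> hol_sheaf A W" "open W"
  shows "continuous_on W g"
proof (rule continuous_at_imp_continuous_on, rule ballI)
  fix x assume x: "x \<in> W"
  obtain c where c: "c \<in> A" "x \<in> fst c" using assms(1) unfolding complex_manifold_def by blast
  have ch: "is_chart c" using assms(1) c unfolding complex_manifold_def by blast
  obtain U \<phi> where U: "c = (U, \<phi>)" by (cases c)
  have oU: "open U" "continuous_on U \<phi>" using ch unfolding U is_chart_def homeomorphism_def by auto
  have "isCont (\<lambda>z. g (inv_into U \<phi> z)) (\<phi> x)"
    using assms(2) c x unfolding U by (intro cdiff_at_isCont) (auto simp: hol_sheaf_def)
  moreover have "isCont \<phi> x" using oU c U by (simp add: continuous_on_eq_continuous_at)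
  ultimately have "isCont (\<lambda>y. g (inv_into U \<phi> (\<phi> y))) x" by (rule isCont_o2[rotated])
  moreover have "\<forall>\<^sub>F y in nhds x. g (inv_into U \<phi> (\<phi> y)) = g y"
    unfolding eventually_nhds using oU c is_chart_inv[OF ch] U by (intro exI[of _ U]) auto
  ultimately show "isCont g x" using isCont_cong[of "\<lambda>y. g (inv_into U \<phi> (\<phi> y))" g x] by blast
qed

lemma cdiff_at_proj:
  fixes g :: "complex ^ 'n::finite \<Rightarrow> complex" and z :: "complex ^ 'n option"
  assumes "cdiff_at g (\<chi> j. z $ Some j)"
  shows "cdiff_at (\<lambda>z :: complex ^ 'n option. g (\<chi> j. z $ Some j)) z"
proof -
  obtain L where L: "(g has_derivative L) (at (\<chi> j. z $ Some j))" "\<forall>c v. L (c *s v) = c * L v"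
    using assms unfolding cdiff_at_def by blast
  have "linear (\<lambda>z :: complex ^ 'n option. \<chi> j. z $ Some j)"
    by (rule linearI) (simp_all add: vec_eq_iff)
  then have "((\<lambda>z :: complex ^ 'n option. \<chi> j. z $ Some j) has_derivative (\<lambda>z. \<chi> j. z $ Some j)) (at z)"
    by (intro bounded_linear_imp_has_derivative) (simp add: linear_conv_bounded_linear)
  from diff_chain_at[OF this L(1)]
  have "((\<lambda>z. g (\<chi> j. z $ Some j)) has_derivative (\<lambda>v. L (\<chi> j. v $ Some j))) (at z)"
    by (simp add: o_def)
  moreover have "L (\<chi> j. (c *s v) $ Some j) = c * L (\<chi> j. v $ Some j)" for c and v :: "complex ^ 'n option"
  proof -
    have "(\<chi> j. (c *s v) $ Some j) = c *s (\<chi> j. v $ Some j)" by (simp add: vec_eq_iff)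
    then show ?thesis using L(2) by simp
  qed
  ultimately show ?thesis unfolding cdiff_at_def by blast
qed

text \<open>
  In the product charts the projection to \<open>X\<close> is the coordinate projection, along which
  holomorphic functions pull back.
\<close>

lemma hol_sheaf_fst:
  fixes A :: "('a::topological_space, 'n::finite) chart set"
  assumes "\<forall>c\<in>A. is_chart c" "g \<in> hol_sheaf A U" "open U"
  shows "(\<lambda>q. g (fst q)) \<in> hol_sheaf_prod A (U \<times> UNIV)"
  unfolding hol_sheaf_iff_chol
proof
  fix c' assume "c' \<in> prod_chart ` A"
  then obtain V \<phi> where c: "(V, \<phi>) \<in> A" "c' = prod_chart (V, \<phi>)" by force
  let ?\<psi> = "\<lambda>(p, t). \<chi> i. case i of None \<Rightarrow> t | Some j \<Rightarrow> \<phi> p $ j"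
  let ?\<pi> = "\<lambda>z :: complex ^ 'n option. \<chi> j. z $ Some j"
  have c': "c' = (V \<times> UNIV, ?\<psi>)" by (simp add: c prod_chart_def)
  have ch: "is_chart (V, \<phi>)" using assms(1) c by blast
  note inv = is_chart_inv[OF ch, unfolded fst_conv snd_conv]
  have inv': "fst (inv_into (V \<times> UNIV) ?\<psi> (?\<psi> q)) = fst q" if q: "q \<in> V \<times> UNIV" for q
  proof -
    define q' where "q' = inv_into (V \<times> UNIV) ?\<psi> (?\<psi> q)"
    have q': "q' \<in> V \<times> UNIV" "?\<psi> q' = ?\<psi> q"
      unfolding q'_def using q by (auto intro: inv_into_into f_inv_into_f)
    then have "\<phi> (fst q') = \<phi> (fst q)"
      by (auto simp: vec_eq_iff case_prod_unfold split: option.split_asm)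
    then show ?thesis unfolding q'_def[symmetric] using inv q q' by (metis mem_Times_iff)
  qed
  show "(\<lambda>q. g (fst q)) \<in> chol c' (fst c' \<inter> U \<times> UNIV)"
    unfolding chol_def c' fst_conv snd_conv
  proof (rule CollectI, rule ballI)
    fix q :: "'a \<times> complex" assume q0: "q \<in> V \<times> UNIV \<inter> U \<times> UNIV"
    obtain p t where pt: "q = (p, t)" by (cases q)
    have p: "p \<in> V" "p \<in> U" using q0 pt by auto
    have oV: "open V" using ch by (auto simp: is_chart_def)
    have pi: "?\<pi> (?\<psi> (q, t)) = \<phi> q" for q t by (simp add: vec_eq_iff)
    have "cdiff_at (\<lambda>z. g (inv_into V \<phi> z)) (\<phi> p)"
      using assms(2) p c by (auto simp: hol_sheaf_def)
    then have "cdiff_at (\<lambda>z. g (inv_into V \<phi> (?\<pi> z))) (?\<psi> (p, t))"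
      using cdiff_at_proj[of "\<lambda>z. g (inv_into V \<phi> z)" "?\<psi> (p, t)"] by (simp only: pi)
    moreover have "open (?\<pi> -` (\<phi> ` V))"
    proof (rule open_vimage)
      show "open (\<phi> ` V)" using ch by (auto simp: is_chart_def)
      show "continuous_on UNIV ?\<pi>" by (intro continuous_on_vec_lambda continuous_intros)
    qed
    moreover have "?\<psi> (p, t) \<in> ?\<pi> -` (\<phi> ` V)" using p(1) by (simp only: vimage_eq pi) simp
    moreover have "g (inv_into V \<phi> (?\<pi> z)) = g (fst (inv_into (V \<times> UNIV) ?\<psi> z))" if z: "z \<in> ?\<pi> -` (\<phi> ` V)" for z
    proof -
      obtain q where q: "q \<in> V" "?\<pi> z = \<phi> q" using z by auto
      have zs: "z $ Some j = \<phi> q $ j" for j using q(2) by (metis vec_lambda_beta)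
      have "z = ?\<psi> (q, z $ None)"
        by (auto simp: vec_eq_iff zs split: option.split)
      then have "fst (inv_into (V \<times> UNIV) ?\<psi> z) = q" using inv'[of "(q, z $ None)"] q(1) by simp
      then show ?thesis using q inv by simp
    qed
    ultimately show "cdiff_at (\<lambda>z. g (fst (inv_into (V \<times> UNIV) ?\<psi> z))) (?\<psi> q)"
      unfolding pt by (rule cdiff_at_cong_open)
  qed
qed

text \<open>
  Functions on \<open>X\<close> are operators that preserve every \<open>(t\<^sup>i)\<close>.  Through this lemma the filtration
  inherits scalar multiplication and multiplication by \<open>f\<close>.
\<close>

lemma mult_op_V0:
  assumes "\<forall>c\<in>A. is_chart c" "g \<in> hol_sheaf A U" "open U"
  shows "[(\<lambda>q. g (fst q), [])] \<in> V0_ops A c (U \<times> UNIV)"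
proof -
  note g = hol_sheaf_fst[OF assms]
  have "\<exists>h'\<in>hol_sheaf_prod A W'. \<forall>q\<in>W'. op_fun c [(\<lambda>q. g (fst q), [])] (\<lambda>q. snd q ^ i * h q) q = snd q ^ i * h' q"
    if "W' \<subseteq> U \<times> UNIV" "h \<in> hol_sheaf_prod A W'" for i W' h
    using hol_sheaf_mult[OF hol_sheaf_mono[OF g that(1)] that(2)]
    by (intro bexI[of _ "\<lambda>q. g (fst q) * h q"]) (auto simp: op_fun_def)
  with g show ?thesis unfolding V0_ops_def by auto
qed

lemma higher_deriv_const: "(deriv ^^ i) (\<lambda>_. a) z = (if i = 0 then a else (0::complex))"
proof -
  have "(deriv ^^ Suc i) (\<lambda>_. a) = (\<lambda>_. 0::complex)" for i and a :: complex
    by (induction i) (auto simp: fun_eq_iff)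
  then show ?thesis by (cases i) (metis funpow_0 , simp)
qed

lemma op_act_mult:
  assumes "\<exists>N. \<forall>i\<ge>N. s i y = 0"
  shows "op_act c f [(\<lambda>q. g (fst q), [])] s k y = g y * s k y"
proof -
  obtain N where N: "\<forall>i\<ge>N. s i y = 0" using assms by blast
  then have N': "\<forall>i\<ge>Suc N. s i y = 0" by simp
  have "op_act c f [(\<lambda>q. g (fst q), [])] s k y = (\<Sum>i<Suc N. (- 1) ^ i * of_nat ((k + i) choose i) * (deriv ^^ i) (\<lambda>t. g y) (f y) * s (k + i) y)"
    unfolding op_act_def using mult_act_finite_sum[of "Suc N" s y, OF N'] by simp
  also have "\<dots> = (\<Sum>i<Suc N. if i = 0 then g y * s k y else 0)"
    by (rule sum.cong) (auto simp: higher_deriv_const)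
  finally show ?thesis by simp
qed

section \<open>Stalks of a \<open>V\<close>-filtration\<close>

text \<open>
  Only the values off the zero set are compared, also for sections of \<open>i\<^sub>+O\<close>.  This is what makes the
  filtrations of \<open>i\<^sub>+O\<close> and \<open>i\<^sub>+O(*f)\<close> comparable.
\<close>

definition near_eq :: "('a::topological_space \<Rightarrow> complex) \<Rightarrow> 'a \<Rightarrow> 'a dsec \<Rightarrow> 'a dsec \<Rightarrow> bool" where
  "near_eq f x s s' \<longleftrightarrow> (\<exists>U. open U \<and> x \<in> U \<and> sec_eq (zero_set f) U s s')"

text \<open>
  The stalk of \<open>V\<^sup>\<gamma>\<close> at \<open>x\<close>, saturated with respect to equality off the zero set.  The elements are
  arbitrary functions, so the stalk is a subspace stable under \<open>t\<close> and \<open>\<partial>\<^sub>t\<close> without side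
  conditions on the representative.
\<close>

definition germ :: "('a::topological_space \<Rightarrow> complex) \<Rightarrow> (rat \<Rightarrow> 'a set \<Rightarrow> 'a dsec set) \<Rightarrow> 'a \<Rightarrow> rat \<Rightarrow> 'a dsec set" where
  "germ f V x \<gamma> = {s. \<exists>U v. open U \<and> x \<in> U \<and> v \<in> V \<gamma> U \<and> sec_eq (zero_set f) U s v}"

lemma sec_eq_t_act: "sec_eq E U s s' \<Longrightarrow> sec_eq E U (t_act f s) (t_act f s')"
  unfolding sec_eq_def t_act_def by auto

lemma sec_eq_dt_act: "sec_eq E U s s' \<Longrightarrow> sec_eq E U (dt_act s) (dt_act s')"
  unfolding sec_eq_def dt_act_def by (auto split: nat.split)

lemma sec_eq_euler: "sec_eq E U s s' \<Longrightarrow> sec_eq E U (euler f \<rho> s) (euler f \<rho> s')"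
  using sec_eq_dt_act[OF sec_eq_t_act, of E U s s' f] unfolding sec_eq_def euler_def by auto

lemma sec_eq_eulers: "sec_eq E U s s' \<Longrightarrow> sec_eq E U (eulers f R s) (eulers f R s')"
  by (induction R) (auto intro: sec_eq_euler)

lemma near_eq_refl: "near_eq f x s s"
  unfolding near_eq_def sec_eq_def by (rule exI[of _ UNIV]) auto

lemma near_eq_trans: "near_eq f x s s' \<Longrightarrow> near_eq f x s' s'' \<Longrightarrow> near_eq f x s s''"
  unfolding near_eq_def
proof safe
  fix U U' assume "open U" "x \<in> U" "open U'" "x \<in> U'" "sec_eq (zero_set f) U s s'" "sec_eq (zero_set f) U' s' s''"
  then show "\<exists>U. open U \<and> x \<in> U \<and> sec_eq (zero_set f) U s s''"
    by (intro exI[of _ "U \<inter> U'"]) (auto simp: sec_eq_def)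
qed

lemma near_eq_t_act: "near_eq f x s s' \<Longrightarrow> near_eq f x (t_act f s) (t_act f s')"
  unfolding near_eq_def using sec_eq_t_act by blast

lemma near_eq_t_pow: "near_eq f x s s' \<Longrightarrow> near_eq f x ((t_act f ^^ n) s) ((t_act f ^^ n) s')"
  by (induction n) (auto intro: near_eq_t_act)

lemma near_eq_eulers: "near_eq f x s s' \<Longrightarrow> near_eq f x (eulers f R s) (eulers f R s')"
  unfolding near_eq_def using sec_eq_eulers by meson

lemma germ_near_eq:
  assumes "near_eq f x s s'" "s' \<in> germ f V x \<gamma>"
    and "\<And>U U' v. open U \<Longrightarrow> open U' \<Longrightarrow> U' \<subseteq> U \<Longrightarrow> v \<in> V \<gamma> U \<Longrightarrow> v \<in> V \<gamma> U'"
  shows "s \<in> germ f V x \<gamma>"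
proof -
  obtain U where U: "open U" "x \<in> U" "sec_eq (zero_set f) U s s'" using assms(1) unfolding near_eq_def by blast
  obtain U' v where U': "open U'" "x \<in> U'" "v \<in> V \<gamma> U'" "sec_eq (zero_set f) U' s' v"
    using assms(2) unfolding germ_def by blast
  have "v \<in> V \<gamma> (U \<inter> U')" using assms(3)[OF U'(1) _ _ U'(3)] U U' by (simp add: open_Int)
  moreover have "sec_eq (zero_set f) (U \<inter> U') s v" using U(3) U'(4) unfolding sec_eq_def by auto
  ultimately show ?thesis unfolding germ_def using U U' by (auto intro!: exI[of _ "U \<inter> U'"] exI[of _ v])
qed

text \<open>
  The properties of the filtration shared by \<open>i\<^sub>+O\<close> (with \<open>E\<close> empty) and \<open>i\<^sub>+O(*f)\<close> (with \<open>E\<close> the zero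
  set), at one point \<open>x\<close>.
\<close>

locale V_germ =
  fixes A :: "('a::{t2_space,second_countable_topology}, 'n::finite) chart set"
    and f :: "'a \<Rightarrow> complex" and E :: "'a set" and M :: "'a set \<Rightarrow> ('a \<Rightarrow> complex) set"
    and V :: "rat \<Rightarrow> 'a set \<Rightarrow> 'a dsec set" and x :: 'a
  assumes manifold: "complex_manifold A"
    and hol: "f \<in> hol_sheaf A UNIV"
    and VF: "V_filtration A f E M V"
    and EZ: "E \<subseteq> zero_set f"
begin

lemma charts: "\<forall>c\<in>A. is_chart c"
  using manifold unfolding complex_manifold_def by blast

lemma chart_at: "\<exists>c\<in>A. x \<in> fst c"
  using manifold unfolding complex_manifold_def by blast

lemma chart_open: "c \<in> A \<Longrightarrow> open (fst c)"
  using charts unfolding is_chart_def by (cases c) fastforce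

lemma cont: "continuous_on UNIV f"
  by (rule hol_sheaf_continuous[OF manifold hol open_UNIV])

lemma closed_Z: "closed (zero_set f)"
proof -
  have "zero_set f = f -` {0}" by (auto simp: zero_set_def)
  then show ?thesis using cont by (metis closed_singleton continuous_closed_vimage continuous_on_eq_continuous_at open_UNIV UNIV_I)
qed

lemmas vf_decr = VF[unfolded V_filtration_def, THEN conjunct1]
lemmas vf_exh = VF[unfolded V_filtration_def, THEN conjunct2, THEN conjunct1]
lemmas vf_disc = VF[unfolded V_filtration_def, THEN conjunct2, THEN conjunct2, THEN conjunct1]
lemmas vf_left = VF[unfolded V_filtration_def, THEN conjunct2, THEN conjunct2, THEN conjunct2, THEN conjunct1]
lemmas vf_coh = VF[unfolded V_filtration_def, THEN conjunct2, THEN conjunct2, THEN conjunct2, THEN conjunct2, THEN conjunct1]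
lemmas vf_t = VF[unfolded V_filtration_def, THEN conjunct2, THEN conjunct2, THEN conjunct2, THEN conjunct2, THEN conjunct2, THEN conjunct1]
lemmas vf_tsurj = VF[unfolded V_filtration_def, THEN conjunct2, THEN conjunct2, THEN conjunct2, THEN conjunct2, THEN conjunct2, THEN conjunct2, THEN conjunct1]
lemmas vf_dt = VF[unfolded V_filtration_def, THEN conjunct2, THEN conjunct2, THEN conjunct2, THEN conjunct2, THEN conjunct2, THEN conjunct2, THEN conjunct2, THEN conjunct1]
lemmas vf_nil = VF[unfolded V_filtration_def, THEN conjunct2, THEN conjunct2, THEN conjunct2, THEN conjunct2, THEN conjunct2, THEN conjunct2, THEN conjunct2, THEN conjunct2]

lemma submodule: "V0_submodule A f E M (V \<gamma>)" and fin_type: "finite_type A f E (V \<gamma>)"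
  using vf_coh[rule_format, of \<gamma>] unfolding V0_coherent_def by simp_all

lemmas sub_dimg = submodule[unfolded V0_submodule_def, THEN conjunct1]
lemmas sub_cong = submodule[unfolded V0_submodule_def, THEN conjunct2, THEN conjunct1]
lemmas sub_restrict = submodule[unfolded V0_submodule_def, THEN conjunct2, THEN conjunct2, THEN conjunct1]
lemmas sub_zero = submodule[unfolded V0_submodule_def, THEN conjunct2, THEN conjunct2, THEN conjunct2, THEN conjunct2, THEN conjunct1]
lemmas sub_add = submodule[unfolded V0_submodule_def, THEN conjunct2, THEN conjunct2, THEN conjunct2, THEN conjunct2, THEN conjunct2, THEN conjunct1]
lemmas sub_op = submodule[unfolded V0_submodule_def, THEN conjunct2, THEN conjunct2, THEN conjunct2, THEN conjunct2, THEN conjunct2, THEN conjunct2]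

lemma V_dimg: "open U \<Longrightarrow> s \<in> V \<gamma> U \<Longrightarrow> s \<in> dimg E M U"
  using sub_dimg by blast

lemma V_cong: "open U \<Longrightarrow> s \<in> V \<gamma> U \<Longrightarrow> s' \<in> dimg E M U \<Longrightarrow> sec_eq E U s s' \<Longrightarrow> s' \<in> V \<gamma> U"
  using sub_cong by blast

lemma V_restrict: "open U \<Longrightarrow> open U' \<Longrightarrow> U' \<subseteq> U \<Longrightarrow> s \<in> V \<gamma> U \<Longrightarrow> s \<in> V \<gamma> U'"
  using sub_restrict by blast

lemma V_zero: "open U \<Longrightarrow> (\<lambda>k y. 0) \<in> V \<gamma> U"
  using sub_zero by blast

lemma V_add: "open U \<Longrightarrow> s \<in> V \<gamma> U \<Longrightarrow> s' \<in> V \<gamma> U \<Longrightarrow> (\<lambda>k y. s k y + s' k y) \<in> V \<gamma> U"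
  using sub_add by blast

lemma V_op: "c \<in> A \<Longrightarrow> open W \<Longrightarrow> W \<subseteq> fst c \<times> UNIV \<Longrightarrow> P \<in> V0_ops A c W \<Longrightarrow> s \<in> V \<gamma> (gr_preimage f W)
    \<Longrightarrow> op_act c f P s \<in> V \<gamma> (gr_preimage f W)"
  using sub_op by blast

lemma V_decr: "open U \<Longrightarrow> \<gamma> \<le> \<gamma>' \<Longrightarrow> s \<in> V \<gamma>' U \<Longrightarrow> s \<in> V \<gamma> U"
  using vf_decr by blast

lemma V_left: "open U \<Longrightarrow> (\<And>\<beta>. \<beta> < \<gamma> \<Longrightarrow> s \<in> V \<beta> U) \<Longrightarrow> s \<in> V \<gamma> U"
  using vf_left by blast

lemma V_fin:
  assumes "open U" "s \<in> V \<gamma> U" "y \<in> U - E"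
  shows "\<exists>N. \<forall>k\<ge>N. s k y = 0"
proof -
  have "y \<in> U" using assms(3) by blast
  with V_dimg[OF assms(1,2)] obtain U' K where "y \<in> U'" "\<forall>k>K. \<forall>y\<in>U' - E. s k y = 0"
    unfolding dimg_def by blast
  then have "\<forall>k\<ge>Suc K. s k y = 0" using assms(3) by (simp add: Suc_le_eq)
  then show ?thesis by blast
qed

text \<open>
  The points of \<open>E\<close> are excepted because a section may have infinitely many nonzero components there,
  and then the action of a function has only a default value.
\<close>

lemma V_mult:
  assumes "c \<in> A" "open U" "U \<subseteq> fst c" "g \<in> hol_sheaf A U" "s \<in> V \<gamma> U"
  shows "\<exists>s'\<in>V \<gamma> U. \<forall>k. \<forall>y\<in>U - E. s' k y = g y * s k y"
proof -
  have U: "gr_preimage f (U \<times> UNIV) = U" by (auto simp: gr_preimage_def)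
  have "op_act c f [(\<lambda>q. g (fst q), [])] s \<in> V \<gamma> (gr_preimage f (U \<times> UNIV))"
    by (rule V_op[OF assms(1) _ _ mult_op_V0[OF charts assms(4,2)]])
      (use assms in \<open>auto simp: U open_Times\<close>)
  then show ?thesis
    unfolding U using op_act_mult[of s _ c f g] V_fin[OF assms(2,5)] by blast
qed

abbreviation "G \<equiv> germ f V x"

lemma germI: "open U \<Longrightarrow> x \<in> U \<Longrightarrow> s \<in> V \<gamma> U \<Longrightarrow> s \<in> G \<gamma>"
  unfolding germ_def sec_eq_def by blast

lemma germ_cong: "near_eq f x s s' \<Longrightarrow> s' \<in> G \<gamma> \<Longrightarrow> s \<in> G \<gamma>"
  by (rule germ_near_eq) (auto intro: V_restrict)

lemma germ_decr: "\<gamma> \<le> \<gamma>' \<Longrightarrow> s \<in> G \<gamma>' \<Longrightarrow> s \<in> G \<gamma>"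
  unfolding germ_def using V_decr by blast

lemma germ_lin: "lin_closed (G \<gamma>)"
  unfolding lin_closed_def
proof (intro conjI allI ballI)
  show "(\<lambda>_ _. 0) \<in> G \<gamma>" using germI[of UNIV] V_zero by auto
next
  fix a b s s' assume "s \<in> G \<gamma>" "s' \<in> G \<gamma>"
  then obtain U v U' v' where 1: "open U" "x \<in> U" "v \<in> V \<gamma> U" "sec_eq (zero_set f) U s v"
    and 2: "open U'" "x \<in> U'" "v' \<in> V \<gamma> U'" "sec_eq (zero_set f) U' s' v'" unfolding germ_def by blast
  obtain c where c: "c \<in> A" "x \<in> fst c" using chart_at by blast
  let ?U = "U \<inter> U' \<inter> fst c"
  have oU: "open ?U" "?U \<subseteq> fst c" using 1 2 chart_open[OF c(1)] by auto
  have v: "v \<in> V \<gamma> ?U" "v' \<in> V \<gamma> ?U" using V_restrict 1 2 oU by blast+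
  obtain w where w: "w \<in> V \<gamma> ?U" "\<forall>k. \<forall>y\<in>?U - E. w k y = a * v k y"
    using V_mult[OF c(1) oU hol_sheaf_const v(1)] by blast
  obtain w' where w': "w' \<in> V \<gamma> ?U" "\<forall>k. \<forall>y\<in>?U - E. w' k y = b * v' k y"
    using V_mult[OF c(1) oU hol_sheaf_const v(2)] by blast
  have "sec_eq (zero_set f) ?U (\<lambda>k y. a * s k y + b * s' k y) (\<lambda>k y. w k y + w' k y)"
    unfolding sec_eq_def
  proof (intro allI ballI)
    fix k y assume y: "y \<in> ?U - zero_set f"
    then have "y \<in> ?U - E" using EZ by blast
    then show "a * s k y + b * s' k y = w k y + w' k y"
      using 1(4) 2(4) w(2) w'(2) y unfolding sec_eq_def by simp
  qed
  then show "(\<lambda>k y. a * s k y + b * s' k y) \<in> G \<gamma>"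
    unfolding germ_def using V_add[OF oU(1) w(1) w'(1)] oU 1 2 c by blast
qed

lemma germ_t: "s \<in> G \<gamma> \<Longrightarrow> t_act f s \<in> G (\<gamma> + 1)"
proof -
  assume "s \<in> G \<gamma>"
  then obtain U v where 1: "open U" "x \<in> U" "v \<in> V \<gamma> U" "sec_eq (zero_set f) U s v" unfolding germ_def by blast
  then have "t_act f v \<in> V (\<gamma> + 1) U" using vf_t by blast
  with 1 show ?thesis unfolding germ_def using sec_eq_t_act by blast
qed

lemma germ_dt: "s \<in> G \<gamma> \<Longrightarrow> dt_act s \<in> G (\<gamma> - 1)"
proof -
  assume "s \<in> G \<gamma>"
  then obtain U v where 1: "open U" "x \<in> U" "v \<in> V \<gamma> U" "sec_eq (zero_set f) U s v" unfolding germ_def by blast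
  then have "dt_act v \<in> V (\<gamma> - 1) U" using vf_dt by blast
  with 1 show ?thesis unfolding germ_def using sec_eq_dt_act by blast
qed

lemma germ_t_pow: "s \<in> G \<gamma> \<Longrightarrow> (t_act f ^^ n) s \<in> G (\<gamma> + of_nat n)"
proof (induction n)
  case (Suc n)
  then show ?case using germ_t[of "(t_act f ^^ n) s" "\<gamma> + of_nat n"] by (simp add: algebra_simps)
qed simp

lemma germ_dt_pow: "s \<in> G \<gamma> \<Longrightarrow> (dt_act ^^ n) s \<in> G (\<gamma> - of_nat n)"
proof (induction n)
  case (Suc n)
  then show ?case using germ_dt[of "(dt_act ^^ n) s" "\<gamma> - of_nat n"] by (simp add: algebra_simps)
qed simp

lemma germ_euler0: "s \<in> G \<gamma> \<Longrightarrow> euler f 0 s \<in> G \<gamma>"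
  using germ_dt[OF germ_t, of s \<gamma>] by (simp add: euler_def)

lemma germ_coprime:
  "eulers f R s \<in> G \<gamma> \<Longrightarrow> eulers f R' s \<in> G \<gamma> \<Longrightarrow> set R \<inter> set R' = {} \<Longrightarrow> s \<in> G \<gamma>"
  by (rule eulers_coprime[OF germ_lin germ_euler0])

lemma gr_preimage_open: "open W \<Longrightarrow> open (gr_preimage f W)"
proof -
  assume "open W"
  moreover have "continuous_on UNIV (\<lambda>y. (y, f y))" using cont by (intro continuous_intros)
  moreover have "gr_preimage f W = (\<lambda>y. (y, f y)) -` W" by (auto simp: gr_preimage_def)
  ultimately show ?thesis by (metis open_vimage)
qed

lemma germ_op:
  assumes "c \<in> A" "open W" "W \<subseteq> fst c \<times> UNIV" "(x, f x) \<in> W" "P \<in> V0_ops A c W" "s \<in> G \<gamma>"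
  shows "op_act c f P s \<in> G \<gamma>"
proof -
  obtain U v where 1: "open U" "x \<in> U" "v \<in> V \<gamma> U" "sec_eq (zero_set f) U s v"
    using assms(6) unfolding germ_def by blast
  \<comment> \<open>Shrink \<open>W\<close> to the part over the neighbourhood on which \<open>v\<close> represents \<open>s\<close>.\<close>
  let ?W = "W \<inter> (U \<times> UNIV)" let ?U = "gr_preimage f ?W"
  have oW: "open ?W" using assms(2) 1(1) by (simp add: open_Int open_Times)
  have U: "?U \<subseteq> U" "x \<in> ?U" "?U \<subseteq> fst c" using 1 assms(3,4) by (auto simp: gr_preimage_def)
  have oU: "open ?U" by (rule gr_preimage_open[OF oW])
  have P: "P \<in> V0_ops A c ?W"
  proof -
    have "\<forall>(a, w)\<in>set P. a \<in> hol_sheaf_prod A ?W"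
      using assms(5) unfolding V0_ops_def by (auto intro: hol_sheaf_mono[of _ _ W])
    moreover have "?W \<subseteq> W" by blast
    ultimately show ?thesis using assms(5) unfolding V0_ops_def by blast
  qed
  have "op_act c f P v \<in> V \<gamma> ?U"
    using V_op[OF assms(1) oW _ P] assms(3) V_restrict[OF 1(1) oU U(1) 1(3)] by blast
  moreover have "sec_eq (zero_set f) ?U (op_act c f P s) (op_act c f P v)"
    unfolding sec_eq_def
  proof safe
    fix k y assume y: "y \<in> ?U" "y \<notin> zero_set f"
    show "op_act c f P s k y = op_act c f P v k y"
    proof (rule op_act_cong[where G = "?U - zero_set f"])
      show "is_chart c" using charts assms(1) by blast
      show "open (?U - zero_set f)" using oU closed_Z by (rule open_Diff)
      show "?U - zero_set f \<subseteq> fst c" using U by blast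
    qed (use y U 1(4) in \<open>auto simp: sec_eq_def\<close>)
  qed
  ultimately show ?thesis unfolding germ_def using oU U by blast
qed

text \<open>
  Nilpotency on the graded piece moves \<open>s\<close> from \<open>V\<^sup>\<beta>\<close> into some \<open>V\<^sup>\<beta>\<^sup>'\<close> with \<open>\<beta>' > \<beta>\<close> and, since the
  filtration is constant on \<open>]i/l, (i+1)/l]\<close>, into the next step of the grid \<open>(1/l) \<int>\<close>.
\<close>

lemma germ_step: "\<exists>l::nat. l > 0 \<and> (\<forall>\<beta>. \<forall>s\<in>G \<beta>. \<exists>r.
    eulers f (replicate r (of_rat \<beta>)) s \<in> G (of_int (\<lfloor>\<beta> * of_nat l\<rfloor> + 1) / of_nat l))"
proof -
  obtain U0 and l :: nat where d: "open U0 \<and> x \<in> U0 \<and> l > 0 \<and>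
        (\<forall>(i::int) \<beta> \<gamma> U'. open U' \<and> U' \<subseteq> U0 \<and>
           {\<beta>, \<gamma>} \<subseteq> {of_int i / of_nat l <..< of_int (i + 1) / of_nat l} \<longrightarrow> V \<beta> U' = V \<gamma> U')"
    using spec[OF vf_disc, of x] by (elim exE) (rule that)
  then have l: "open U0" "x \<in> U0" "l > 0" by simp_all
  have disc: "V \<beta> U' = V \<gamma> U'" if "open U'" "U' \<subseteq> U0"
    "{\<beta>, \<gamma>} \<subseteq> {of_int i / of_nat l <..< of_int (i + 1) / of_nat l}" for i :: int and \<beta> \<gamma> U'
    using d that by meson
  have "\<exists>r. eulers f (replicate r (of_rat \<beta>)) s \<in> G (of_int (\<lfloor>\<beta> * of_nat l\<rfloor> + 1) / of_nat l)" if s: "s \<in> G \<beta>" for \<beta> s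
  proof -
    obtain U v where 1: "open U" "x \<in> U" "v \<in> V \<beta> U" "sec_eq (zero_set f) U s v"
      using s unfolding germ_def by blast
    obtain U1 r where n: "open U1 \<and> x \<in> U1 \<and> (\<forall>U'. open U' \<and> U' \<subseteq> U1 \<longrightarrow>
        (\<forall>s\<in>V \<beta> U'. ((\<lambda>s k y. dt_act (t_act f s) k y - of_rat \<beta> * s k y) ^^ r) s \<in> V_gt V \<beta> U'))"
      using spec[OF spec[OF vf_nil, of \<beta>], of x] by (elim exE) (rule that)
    then have U1: "open U1" "x \<in> U1" by simp_all
    have nil: "((\<lambda>s k y. dt_act (t_act f s) k y - of_rat \<beta> * s k y) ^^ r) s \<in> V_gt V \<beta> U'"
      if "open U'" "U' \<subseteq> U1" "s \<in> V \<beta> U'" for U' s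
      using n that by meson
    let ?U = "U \<inter> U1 \<inter> U0"
    have oU: "open ?U" "x \<in> ?U" using 1 U1 l by auto
    have "v \<in> V \<beta> ?U" using V_restrict[OF 1(1) oU(1) _ 1(3)] by blast
    from nil[OF oU(1) _ this] have "((\<lambda>s k y. dt_act (t_act f s) k y - of_rat \<beta> * s k y) ^^ r) v \<in> V_gt V \<beta> ?U"
      by blast
    moreover have "((\<lambda>s k y. dt_act (t_act f s) k y - of_rat \<beta> * s k y) ^^ r) v = eulers f (replicate r (of_rat \<beta>)) v"
      by (induction r) (auto simp: euler_def)
    ultimately have "eulers f (replicate r (of_rat \<beta>)) v \<in> V_gt V \<beta> ?U" by simp
    then obtain U2 \<beta>' where U2: "open U2" "x \<in> U2" "U2 \<subseteq> ?U" "\<beta> < \<beta>'" "eulers f (replicate r (of_rat \<beta>)) v \<in> V \<beta>' U2"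
      using oU(2) unfolding V_gt_def by blast
    let ?v = "eulers f (replicate r (of_rat \<beta>)) v"
    let ?i = "\<lfloor>\<beta> * of_nat l\<rfloor>"
    have il: "of_int ?i / of_nat l \<le> \<beta>" using l(3) by (simp add: field_simps)
    have "?v \<in> V (of_int (?i + 1) / of_nat l) U2"
    proof (cases "of_int (?i + 1) / of_nat l \<le> \<beta>'")
      case True
      then show ?thesis using V_decr[OF U2(1) True U2(5)] by simp
    next
      case False
      show ?thesis
      proof (rule V_left[OF U2(1)])
        fix \<delta> :: rat assume d: "\<delta> < of_int (?i + 1) / of_nat l"
        show "?v \<in> V \<delta> U2"
        proof (cases "\<delta> \<le> \<beta>'")
          case True
          then show ?thesis using V_decr[OF U2(1) True U2(5)] by simp
        next
          case False2: False
          \<comment> \<open>Both indices lie strictly between consecutive grid points; the endpoint is reached by left continuity.\<close>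
          have "V \<beta>' U2 = V \<delta> U2"
            by (rule disc[of _ _ _ ?i]) (use U2 False False2 d il in auto)
          then show ?thesis using U2(5) by simp
        qed
      qed
    qed
    from germI[OF U2(1,2) this] have "?v \<in> G (of_int (?i + 1) / of_nat l)" .
    moreover have "near_eq f x s v" unfolding near_eq_def using 1 by blast
    ultimately show ?thesis using germ_cong[OF near_eq_eulers] by blast
  qed
  with l(3) show ?thesis by blast
qed

text \<open>
  Only finitely many grid points lie between \<open>\<beta>\<close> and \<open>\<alpha>'\<close>, so iterating the previous step reaches
  \<open>V\<^sup>\<alpha>\<^sup>'\<close>.  Each step uses the index where it starts as a root, so the roots stay in \<open>[\<alpha>, \<alpha>'[\<close>.
\<close>

lemma germ_raise:
  assumes "\<alpha> \<le> \<beta>" "s \<in> G \<beta>"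
  shows "\<exists>R. set R \<subseteq> of_rat ` {\<alpha>..<\<alpha>'} \<and> eulers f R s \<in> G \<alpha>'"
proof -
  obtain l :: nat where l: "l > 0" and step: "\<And>\<beta> s. s \<in> G \<beta> \<Longrightarrow>
    \<exists>r. eulers f (replicate r (of_rat \<beta>)) s \<in> G (of_int (\<lfloor>\<beta> * of_nat l\<rfloor> + 1) / of_nat l)"
    using germ_step by blast
  show ?thesis
    using assms
  \<comment> \<open>The measure counts the grid steps from \<open>\<beta>\<close> to \<open>\<alpha>'\<close>; the first step may start off the grid.\<close>
  proof (induction "nat (\<lceil>\<alpha>' * of_nat l\<rceil> - \<lfloor>\<beta> * of_nat l\<rfloor>)" arbitrary: \<beta> s rule: less_induct)
    case less
    show ?case
    proof (cases "\<alpha>' \<le> \<beta>")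
      case True
      then show ?thesis using germ_decr less.prems by (intro exI[of _ "[]"]) auto
    next
      case False
      obtain r where r: "eulers f (replicate r (of_rat \<beta>)) s \<in> G (of_int (\<lfloor>\<beta> * of_nat l\<rfloor> + 1) / of_nat l)"
        using step[OF less.prems(2)] by blast
      let ?b = "of_int (\<lfloor>\<beta> * of_nat l\<rfloor> + 1) / of_nat l :: rat"
      have b: "\<beta> < ?b" using l by (simp add: pos_less_divide_eq) linarith
      have fl: "\<lfloor>?b * of_nat l\<rfloor> = \<lfloor>\<beta> * of_nat l\<rfloor> + 1" using l by simp
      have "\<beta> * of_nat l < \<alpha>' * of_nat l" using False l by simp
      then have "\<lfloor>\<beta> * of_nat l\<rfloor> < \<lceil>\<alpha>' * of_nat l\<rceil>" by linarith
      then have "nat (\<lceil>\<alpha>' * of_nat l\<rceil> - \<lfloor>?b * of_nat l\<rfloor>) < nat (\<lceil>\<alpha>' * of_nat l\<rceil> - \<lfloor>\<beta> * of_nat l\<rfloor>)"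
        unfolding fl by linarith
      from less.hyps[OF this _ r] obtain R where R: "set R \<subseteq> of_rat ` {\<alpha>..<\<alpha>'}"
        "eulers f R (eulers f (replicate r (of_rat \<beta>)) s) \<in> G \<alpha>'"
        using b less.prems by force
      moreover have "of_rat \<beta> \<in> of_rat ` {\<alpha>..<\<alpha>'}" using False less.prems by auto
      ultimately show ?thesis
        by (intro exI[of _ "R @ replicate r (of_rat \<beta>)"]) (auto simp: eulers_append)
    qed
  qed
qed

lemma germ_b_function:
  assumes "s \<in> G \<alpha>"
  shows "\<exists>R. set R \<subseteq> of_rat ` {\<alpha>..} \<and> eulers f R s \<in> G \<alpha>'"
  using germ_raise[OF order_refl assms, of \<alpha>'] by force

text \<open>
  The index of a section is detected by the eigenvalues of \<open>\<partial>\<^sub>t t\<close>.  Raising \<open>s\<close> from \<open>V\<^sup>\<beta>\<close> to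
  \<open>V\<^sup>\<alpha>\<close> takes a polynomial with roots \<open>< \<alpha>\<close>, the hypothesis provides one with roots \<open>\<ge> \<alpha>\<close>, and
  the two are coprime.
\<close>

lemma germ_climb:
  assumes "s \<in> G \<beta>" "eulers f R s \<in> G \<alpha>" "set R \<subseteq> of_rat ` {\<alpha>..}"
  shows "s \<in> G \<alpha>"
proof -
  obtain R' where R': "set R' \<subseteq> of_rat ` {\<beta>..<\<alpha>}" "eulers f R' s \<in> G \<alpha>"
    using germ_raise[OF order_refl assms(1)] by blast
  have "set R \<inter> set R' = {}" using assms(3) R'(1) by force
  from germ_coprime[OF assms(2) R'(2) this] show ?thesis .
qed

lemma germ_t_surj:
  assumes "s \<in> G (\<gamma> + 1)" "\<gamma> > 0"
  shows "\<exists>U v. open U \<and> x \<in> U \<and> v \<in> V \<gamma> U \<and> near_eq f x s (t_act f v)"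
proof -
  obtain U v where 1: "open U" "x \<in> U" "v \<in> V (\<gamma> + 1) U" "sec_eq (zero_set f) U s v"
    using assms(1) unfolding germ_def by blast
  with 1 assms(2) obtain U' s' where 2: "open U'" "x \<in> U'" "U' \<subseteq> U" "s' \<in> V \<gamma> U'" "sec_eq E U' (t_act f s') v"
    using vf_tsurj by meson
  have "sec_eq (zero_set f) U' s (t_act f s')"
    unfolding sec_eq_def
  proof (intro allI ballI)
    fix k y assume y: "y \<in> U' - zero_set f"
    then have "y \<in> U' - E" using EZ by blast
    then show "s k y = t_act f s' k y"
      using 1(4) 2(3,5) y unfolding sec_eq_def by auto
  qed
  then show ?thesis unfolding near_eq_def using 2 by blast
qed

lemma germ_t_pow_surj:
  assumes "s \<in> G (\<gamma> + of_nat n)" "\<gamma> > 0"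
  shows "\<exists>v\<in>G \<gamma>. near_eq f x s ((t_act f ^^ n) v)"
  using assms(1)
proof (induction n arbitrary: s)
  case 0
  then show ?case using near_eq_refl by auto
next
  case (Suc n)
  then have "s \<in> G ((\<gamma> + of_nat n) + 1)" by (simp add: algebra_simps)
  from germ_t_surj[OF this] assms(2) obtain U v where v: "open U" "x \<in> U" "v \<in> V (\<gamma> + of_nat n) U" "near_eq f x s (t_act f v)"
    by force
  from Suc.IH[OF germI[OF v(1-3)]] obtain w where w: "w \<in> G \<gamma>" "near_eq f x v ((t_act f ^^ n) w)" by blast
  have "near_eq f x s ((t_act f ^^ Suc n) w)"
    using near_eq_trans[OF v(4) near_eq_t_act[OF w(2)]] by simp
  with w(1) show ?case by blast
qed

lemma germ_exhaustive:
  assumes "open U" "x \<in> U" "s \<in> dimg E M U"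
  shows "\<exists>\<gamma>. s \<in> G \<gamma>"
proof -
  have "\<exists>U' \<gamma>. open U' \<and> x \<in> U' \<and> U' \<subseteq> U \<and> s \<in> V \<gamma> U'"
    using vf_exh assms by blast
  then show ?thesis using germI by blast
qed

lemma germ_generated:
  "\<exists>c\<in>A. \<exists>W p (\<sigma> :: nat \<Rightarrow> 'a dsec). open W \<and> (x, f x) \<in> W \<and> W \<subseteq> fst c \<times> UNIV \<and>
     (\<forall>i<p. \<sigma> i \<in> V \<gamma> (gr_preimage f W)) \<and>
     (\<forall>s\<in>G \<gamma>. \<exists>W' P. open W' \<and> (x, f x) \<in> W' \<and> W' \<subseteq> W \<and> (\<forall>i<p. P i \<in> V0_ops A c W') \<and>
        near_eq f x s (\<lambda>k y. \<Sum>i<p. op_act c f (P i) (\<sigma> i) k y))"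
proof -
  obtain c where c: "c \<in> A" "x \<in> fst c" using chart_at by blast
  then have z: "(x, f x) \<in> fst c \<times> UNIV" by simp
  obtain W p and \<sigma> :: "nat \<Rightarrow> 'a dsec" where
    d: "open W \<and> (x, f x) \<in> W \<and> W \<subseteq> fst c \<times> UNIV \<and> (\<forall>i<p. \<sigma> i \<in> V \<gamma> (gr_preimage f W)) \<and>
      (\<forall>W' s. open W' \<and> W' \<subseteq> W \<and> s \<in> V \<gamma> (gr_preimage f W') \<longrightarrow>
           (\<forall>z'\<in>W'. \<exists>W'' P. open W'' \<and> z' \<in> W'' \<and> W'' \<subseteq> W' \<and> (\<forall>i<p. P i \<in> V0_ops A c W'') \<and>
              sec_eq E (gr_preimage f W'') s (\<lambda>k y. \<Sum>i<p. op_act c f (P i) (\<sigma> i) k y)))"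
    using bspec[OF bspec[OF fin_type[of \<gamma>, unfolded finite_type_def] c(1)] z] by (elim exE) (rule that)
  then have W: "open W" "(x, f x) \<in> W" "W \<subseteq> fst c \<times> UNIV" "\<forall>i<p. \<sigma> i \<in> V \<gamma> (gr_preimage f W)"
    by simp_all
  note gen = d[THEN conjunct2, THEN conjunct2, THEN conjunct2, THEN conjunct2]
  have "\<exists>W' P. open W' \<and> (x, f x) \<in> W' \<and> W' \<subseteq> W \<and> (\<forall>i<p. P i \<in> V0_ops A c W') \<and>
        near_eq f x s (\<lambda>k y. \<Sum>i<p. op_act c f (P i) (\<sigma> i) k y)" if "s \<in> G \<gamma>" for s
  proof -
    obtain U v where 1: "open U" "x \<in> U" "v \<in> V \<gamma> U" "sec_eq (zero_set f) U s v"
      using \<open>s \<in> G \<gamma>\<close> unfolding germ_def by blast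
    let ?W = "W \<inter> (U \<times> UNIV)"
    have oW: "open ?W" "(x, f x) \<in> ?W" using W 1 by (auto simp: open_Int open_Times)
    have "v \<in> V \<gamma> (gr_preimage f ?W)"
      by (rule V_restrict[OF 1(1) gr_preimage_open[OF oW(1)] _ 1(3)]) (auto simp: gr_preimage_def)
    with oW have "open ?W \<and> ?W \<subseteq> W \<and> v \<in> V \<gamma> (gr_preimage f ?W)" by blast
    from bspec[OF mp[OF spec[OF spec[OF gen, of ?W], of v] this] oW(2)]
    obtain W'' P where d': "open W'' \<and> (x, f x) \<in> W'' \<and> W'' \<subseteq> ?W \<and> (\<forall>i<p. P i \<in> V0_ops A c W'') \<and>
       sec_eq E (gr_preimage f W'') v (\<lambda>k y. \<Sum>i<p. op_act c f (P i) (\<sigma> i) k y)"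
      by (elim exE) (rule that)
    then have W'': "open W''" "(x, f x) \<in> W''" "W'' \<subseteq> ?W" "\<forall>i<p. P i \<in> V0_ops A c W''"
       "sec_eq E (gr_preimage f W'') v (\<lambda>k y. \<Sum>i<p. op_act c f (P i) (\<sigma> i) k y)"
      by simp_all
    have "sec_eq (zero_set f) (gr_preimage f W'') s (\<lambda>k y. \<Sum>i<p. op_act c f (P i) (\<sigma> i) k y)"
      unfolding sec_eq_def
    proof (intro allI ballI)
      fix k y assume y: "y \<in> gr_preimage f W'' - zero_set f"
      then have "y \<in> gr_preimage f W'' - E" "y \<in> U" using EZ W''(3) by (auto simp: gr_preimage_def)
      then show "s k y = (\<Sum>i<p. op_act c f (P i) (\<sigma> i) k y)"
        using W''(5) 1(4) y unfolding sec_eq_def by auto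
    qed
    then have "near_eq f x s (\<lambda>k y. \<Sum>i<p. op_act c f (P i) (\<sigma> i) k y)"
      unfolding near_eq_def using gr_preimage_open[OF W''(1)] W''(2) by (auto simp: gr_preimage_def)
    moreover have "W'' \<subseteq> W" using W''(3) by blast
    ultimately show ?thesis using W''(1,2,4) by (intro exI[of _ W''] exI[of _ P]) simp
  qed
  with W show ?thesis by (intro bexI[OF _ c(1)] exI[of _ W] exI[of _ p] exI[of _ \<sigma>]) simp
qed

end

section \<open>Denominators that are powers of \<open>t\<close>\<close>

lemma t_act_inj:
  assumes "f y \<noteq> 0" "\<forall>k\<ge>N. s k y = s' k y" "\<And>k. t_act f s k y = t_act f s' k y"
  shows "s k y = s' k y"
proof (induction "N - k" arbitrary: k)
  case 0
  then show ?case using assms(2) by simp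
next
  case (Suc n)
  then have "s (k + 1) y = s' (k + 1) y" by simp
  then show ?case using assms(3)[of k] assms(1) by (simp add: t_act_def)
qed

lemma t_pow_lin: "(t_act f ^^ n) (\<lambda>k y. a * s k y + b * s' k y) =
    (\<lambda>k y. a * (t_act f ^^ n) s k y + b * (t_act f ^^ n) s' k y)"
proof (induction n)
  case (Suc n)
  show ?case unfolding funpow.simps o_apply Suc.IH by (intro ext) (rule t_act_lin)
qed simp

lemma t_pow_swap: "(t_act f ^^ n) (t_act f s) = t_act f ((t_act f ^^ n) s)"
  by (simp add: funpow_swap1)

lemma t_pow_fin:
  assumes "\<exists>N. \<forall>k\<ge>N. s k y = 0"
  shows "\<exists>N. \<forall>k\<ge>N. (t_act f ^^ n) s k y = 0"
proof (induction n)
  case (Suc n)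
  then obtain N where "\<forall>k\<ge>N. (t_act f ^^ n) s k y = 0" by blast
  then have "\<forall>k\<ge>N. (t_act f ^^ Suc n) s k y = 0" by (simp add: t_act_def)
  then show ?case by blast
qed (use assms in simp)

context V_germ
begin

text \<open>
  Off the zero set of \<open>f\<close>, multiplication by \<open>t\<close> is injective on sections with finitely many
  components, so \<open>t V\<^sup>\<gamma> = V\<^sup>\<gamma>\<^sup>+\<^sup>1\<close> can be cancelled.
\<close>

lemma germ_t_cancel:
  assumes "open U" "x \<in> U" "\<And>y. y \<in> U - zero_set f \<Longrightarrow> \<exists>N. \<forall>k\<ge>N. s k y = 0"
    and "t_act f s \<in> G (\<gamma> + 1)" "\<gamma> > 0"
  shows "s \<in> G \<gamma>"
proof -
  obtain U' v where v: "open U'" "x \<in> U'" "v \<in> V \<gamma> U'" "near_eq f x (t_act f s) (t_act f v)"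
    using germ_t_surj[OF assms(4,5)] by blast
  obtain U2 where U2: "open U2" "x \<in> U2" "sec_eq (zero_set f) U2 (t_act f s) (t_act f v)"
    using v(4) unfolding near_eq_def by blast
  have "sec_eq (zero_set f) (U \<inter> U' \<inter> U2) s v"
    unfolding sec_eq_def
  proof (intro allI ballI)
    fix k y assume y: "y \<in> U \<inter> U' \<inter> U2 - zero_set f"
    obtain N where N: "\<forall>k\<ge>N. s k y = 0" using assms(3)[of y] y by blast
    have "y \<in> U' - E" using y EZ by blast
    then obtain N' where N': "\<forall>k\<ge>N'. v k y = 0" using V_fin[OF v(1,3)] by blast
    show "s k y = v k y"
    proof (rule t_act_inj[of f y "max N N'" s v])
      show "f y \<noteq> 0" using y by (simp add: zero_set_def)
      show "\<forall>k\<ge>max N N'. s k y = v k y" using N N' by simp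
      show "t_act f s k y = t_act f v k y" for k using U2(3) y unfolding sec_eq_def by blast
    qed
  qed
  then have "near_eq f x s v"
    unfolding near_eq_def using assms(1,2) v(1,2) U2(1,2) by (intro exI[of _ "U \<inter> U' \<inter> U2"]) auto
  then show ?thesis using germ_cong germI[OF v(1-3)] by blast
qed

text \<open>
  Since \<open>Q\<close> preserves the filtration and \<open>t\<close> raises it by one, so does each commutator with \<open>t\<close>.
\<close>

lemma germ_adT:
  assumes Q: "\<And>\<gamma> s. s \<in> G \<gamma> \<Longrightarrow> Q s \<in> G \<gamma>" and "s \<in> G \<gamma>"
  shows "adT f n Q s \<in> G (\<gamma> + of_nat n)"
  using assms(2)
proof (induction n arbitrary: s \<gamma>)
  case (Suc n)
  have "t_act f (adT f n Q s) \<in> G (\<gamma> + of_nat (Suc n))"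
    using germ_t[OF Suc.IH[OF Suc.prems]] by (simp add: algebra_simps)
  moreover have "adT f n Q (t_act f s) \<in> G (\<gamma> + of_nat (Suc n))"
    using Suc.IH[OF germ_t[OF Suc.prems]] by (simp add: algebra_simps)
  ultimately show ?case
    using lin_closed_diff[OF germ_lin] by simp
qed (simp add: Q)

text \<open>
  Conjugation by \<open>t\<^sup>m\<close> preserves the operators of \<open>V\<^sup>0\<close>: if \<open>s\<close> lies in \<open>t\<^sup>-\<^sup>m V\<^sup>1\<close>, so does \<open>P s\<close>.
  Put \<open>Q\<^sub>n = (ad t)\<^sup>n P\<close>.  More generally,
  \<open>t\<^sup>m Q\<^sub>n s \<in> V\<^sup>1\<^sup>+\<^sup>n\<close>.  This holds for large \<open>n\<close>, as \<open>Q\<^sub>n\<close> vanishes there, and for \<open>m = 0\<close>, as \<open>Q\<^sub>n\<close>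
  raises the filtration by \<open>n\<close>.  The relation \<open>t Q\<^sub>n = Q\<^sub>n\<^sub>+\<^sub>1 + Q\<^sub>n t\<close> gives the induction step, down in
  \<open>n\<close> and up in \<open>m\<close>, because \<open>t\<close> can be cancelled.
\<close>

lemma op_act_denominator:
  assumes "c \<in> A" "open W" "W \<subseteq> fst c \<times> UNIV" "(x, f x) \<in> W" "P \<in> V0_ops A c W"
    and U: "open U" "x \<in> U" "s \<in> hsec c (U \<inter> fst c - zero_set f)" and "(t_act f ^^ m) s \<in> G 1"
  shows "(t_act f ^^ m) (op_act c f P s) \<in> G 1"
proof -
  let ?Q = "op_act c f P" let ?H = "U \<inter> fst c - zero_set f"
  have xc: "x \<in> fst c" using assms(3,4) by auto
  have oU: "open (U \<inter> fst c)" "x \<in> U \<inter> fst c" using U chart_open[OF assms(1)] xc by auto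
  have H: "is_chart c" "open ?H" "?H \<subseteq> fst c" "f \<in> chol c ?H"
    using charts assms(1) oU closed_Z hol_sheaf_chol[OF hol assms(1), of ?H] by auto
  have Q: "?Q s \<in> G \<gamma>" if "s \<in> G \<gamma>" for \<gamma> s
    by (rule germ_op[OF assms(1-5) that])
  obtain d where d: "\<forall>(a, w)\<in>set P. length w < d"
  proof
    show "\<forall>(a, w)\<in>set P. length w < Suc (Max (insert 0 ((\<lambda>(a, w). length w) ` set P)))"
      by (auto simp: less_Suc_eq_le intro!: Max_ge)
  qed
  have claim: "(t_act f ^^ m) (adT f n ?Q s) \<in> G (1 + of_nat n)"
    if "n \<le> d" "s \<in> hsec c ?H" "(t_act f ^^ m) s \<in> G 1" for n m s
    using that
  proof (induction n arbitrary: m s rule: inc_induct)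
    case base
    have "near_eq f x (adT f d ?Q s) (\<lambda>_ _. 0)"
      unfolding near_eq_def sec_eq_def
      using oU adT_op_act_vanish[OF H base(1) _ d] by (intro exI[of _ "U \<inter> fst c"]) auto
    then have "near_eq f x ((t_act f ^^ m) (adT f d ?Q s)) ((t_act f ^^ m) (\<lambda>_ _. 0))"
      by (rule near_eq_t_pow)
    moreover have "(t_act f ^^ m) (\<lambda>_ _. 0) = (\<lambda>_ _. 0)"
      using t_pow_lin[of m f 0 "\<lambda>_ _. 0" 0 "\<lambda>_ _. 0"] by simp
    ultimately show ?case
      using germ_cong germ_lin unfolding lin_closed_def by metis
  next
    case (step n)
    note IHn = step.IH
    show ?case
      using step.prems
    proof (induction m arbitrary: s)
      case 0
      then show ?case using germ_adT[of ?Q s 1 n] Q by simp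
    next
      case (Suc m)
      let ?M = "t_act f ^^ Suc m"
      have ts: "t_act f s \<in> hsec c ?H" by (rule hsec_t_act[OF H(4) Suc.prems(1)])
      have 1: "?M (adT f (Suc n) ?Q s) \<in> G ((1 + of_nat n) + 1)"
        using IHn[OF Suc.prems] by (simp add: algebra_simps)
      have "(t_act f ^^ m) (adT f n ?Q (t_act f s)) \<in> G (1 + of_nat n)"
        by (rule Suc.IH[OF ts]) (use Suc.prems in \<open>simp add: t_pow_swap\<close>)
      from germ_t[OF this] have 2: "?M (adT f n ?Q (t_act f s)) \<in> G ((1 + of_nat n) + 1)"
        by simp
      \<comment> \<open>The relation \<open>t Q\<^sub>n = Q\<^sub>n\<^sub>+\<^sub>1 + Q\<^sub>n t\<close>.\<close>
      have "t_act f (adT f n ?Q s) = (\<lambda>k y. 1 * adT f (Suc n) ?Q s k y + 1 * adT f n ?Q (t_act f s) k y)"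
        by auto
      then have eq: "t_act f (?M (adT f n ?Q s)) =
          (\<lambda>k y. 1 * ?M (adT f (Suc n) ?Q s) k y + 1 * ?M (adT f n ?Q (t_act f s)) k y)"
        using t_pow_swap[of "Suc m" f "adT f n ?Q s"] t_pow_lin[of "Suc m" f 1 "adT f (Suc n) ?Q s" 1 "adT f n ?Q (t_act f s)"]
        by metis
      have "t_act f (?M (adT f n ?Q s)) \<in> G ((1 + of_nat n) + 1)"
        unfolding eq by (rule lin_closedD[OF germ_lin 1 2])
      then show ?case
      proof (rule germ_t_cancel[OF oU, rotated])
        fix y assume y: "y \<in> ?H"
        show "\<exists>N. \<forall>k\<ge>N. ?M (adT f n ?Q s) k y = 0"
          by (rule t_pow_fin, rule adT_op_act_fin[OF H Suc.prems(1) y])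
      qed simp
    qed
  qed
  show ?thesis using claim[of 0 s m] U(3) assms(9) by simp
qed

end

lemma hol_imp_mer: "open U \<Longrightarrow> g \<in> hol_sheaf A U \<Longrightarrow> g \<in> mer_sheaf A f U"
  unfolding mer_sheaf_def by (auto intro!: exI[of _ U] exI[of _ 0] exI[of _ g])

lemma dimg_hol_imp_mer:
  assumes "open U" "s \<in> dimg {} (hol_sheaf A) U"
  shows "s \<in> dimg (zero_set f) (mer_sheaf A f) U"
  unfolding dimg_def
proof (intro CollectI conjI allI ballI)
  show "s k \<in> mer_sheaf A f U" for k
    using assms hol_imp_mer[OF assms(1)] unfolding dimg_def by blast
  show "\<exists>U' K. open U' \<and> x \<in> U' \<and> U' \<subseteq> U \<and> (\<forall>k>K. \<forall>y\<in>U' - zero_set f. s k y = 0)" if "x \<in> U" for x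
  proof -
    obtain U' K where "open U'" "x \<in> U'" "U' \<subseteq> U" "\<forall>k>K. \<forall>y\<in>U' - {}. s k y = 0"
      using assms(2) \<open>x \<in> U\<close> unfolding dimg_def by blast
    then show ?thesis by (intro exI[of _ U'] exI[of _ K]) auto
  qed
qed

text \<open>
  If the component \<open>s\<^sub>k\<close> has a pole of order at most \<open>R - k\<close>, then the components of \<open>t s\<close> satisfy the
  same with \<open>R - 1\<close>, since \<open>(t s)\<^sub>k = f s\<^sub>k - (k+1) s\<^sub>k\<^sub>+\<^sub>1\<close>.
\<close>

lemma pole_reduction:
  assumes "f \<in> hol_sheaf A U" "\<And>k. h k \<in> hol_sheaf A U" "\<And>k. k > K \<Longrightarrow> h k = (\<lambda>_. 0)"
    and "\<And>k y. y \<in> U - zero_set f \<Longrightarrow> f y ^ (R - k) * s k y = h k y"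
  shows "\<exists>h'. (\<forall>k. h' k \<in> hol_sheaf A U) \<and> (\<forall>k>K. h' k = (\<lambda>_. 0)) \<and>
     (\<forall>k. \<forall>y\<in>U - zero_set f. (t_act f ^^ R) s k y = h' k y)"
  using assms(2-4)
proof (induction R arbitrary: s h)
  case 0
  then show ?case by (intro exI[of _ h]) auto
next
  case (Suc R)
  define h1 where "h1 k = (\<lambda>y. (if k \<le> R then h k y else f y * h k y) - of_nat (k + 1) * h (k + 1) y)" for k
  have "\<exists>h'. (\<forall>k. h' k \<in> hol_sheaf A U) \<and> (\<forall>k>K. h' k = (\<lambda>_. 0)) \<and>
     (\<forall>k. \<forall>y\<in>U - zero_set f. (t_act f ^^ R) (t_act f s) k y = h' k y)"
  proof (rule Suc.IH[of h1])
    show "h1 k \<in> hol_sheaf A U" for k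
      unfolding h1_def
      by (cases "k \<le> R") (auto intro!: hol_sheaf_diff hol_sheaf_mult hol_sheaf_const assms(1) Suc.prems(1))
    show "h1 k = (\<lambda>_. 0)" if "k > K" for k
      unfolding h1_def using Suc.prems(2)[of k] Suc.prems(2)[of "k + 1"] that by auto
    show "f y ^ (R - k) * t_act f s k y = h1 k y" if y: "y \<in> U - zero_set f" for k y
    proof (cases "k \<le> R")
      case True
      then have "Suc R - k = Suc (R - k)" by simp
      then show ?thesis
        using Suc.prems(3)[OF y, of k] Suc.prems(3)[OF y, of "k + 1"] True
        by (simp add: h1_def t_act_def algebra_simps)
    next
      case False
      then show ?thesis
        using Suc.prems(3)[OF y, of k] Suc.prems(3)[OF y, of "k + 1"]
        by (simp add: h1_def t_act_def algebra_simps)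
    qed
  qed
  then show ?case by (simp add: funpow_swap1)
qed

lemma mer_hsec:
  assumes "is_chart c" "c \<in> A" "f \<in> hol_sheaf A UNIV" "closed (zero_set f)" "open U"
    and "s \<in> dimg (zero_set f) (mer_sheaf A f) U"
  shows "s \<in> hsec c (U \<inter> fst c - zero_set f)"
proof -
  let ?H = "U \<inter> fst c - zero_set f"
  have oc: "open (fst c)" using assms(1) unfolding is_chart_def by (cases c) fastforce
  have "s k \<in> chol c ?H" for k
    unfolding chol_def
  proof safe
    fix y assume y: "y \<in> U" "y \<in> fst c" "y \<notin> zero_set f"
    have "s k \<in> mer_sheaf A f U" using assms(6) unfolding dimg_def by blast
    with y(1) obtain W' r h where W: "open W'" "y \<in> W'" "W' \<subseteq> U" "h \<in> hol_sheaf A W'"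
      "\<forall>y\<in>W' - zero_set f. s k y = h y / f y ^ r"
      unfolding mer_sheaf_def by blast
    have "cdiff_at (\<lambda>z. h (inv_into (fst c) (snd c) z) / f (inv_into (fst c) (snd c) z) ^ r) (snd c y)"
    proof (intro cdiff_at_divide cdiff_at_power)
      show "cdiff_at (\<lambda>z. h (inv_into (fst c) (snd c) z)) (snd c y)"
        using hol_sheaf_chol[OF W(4) assms(2), of "W' \<inter> fst c"] y W unfolding chol_def by auto
      show "cdiff_at (\<lambda>z. f (inv_into (fst c) (snd c) z)) (snd c y)"
        using hol_sheaf_chol[OF assms(3) assms(2), of "fst c"] y unfolding chol_def by auto
      show "f (inv_into (fst c) (snd c) (snd c y)) ^ r \<noteq> 0"
        using y is_chart_inv[OF assms(1)] by (simp add: zero_set_def)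
    qed
    then show "cdiff_at (\<lambda>z. s k (inv_into (fst c) (snd c) z)) (snd c y)"
      by (rule cdiff_chart_cong[OF assms(1), of "W' \<inter> fst c - zero_set f", rotated -1])
        (use W y oc assms(4) in \<open>auto intro!: open_Diff\<close>)
  qed
  moreover have "\<exists>G' K. open G' \<and> y \<in> G' \<and> G' \<subseteq> ?H \<and> (\<forall>k\<ge>K. \<forall>y\<in>G'. s k y = 0)" if y: "y \<in> ?H" for y
  proof -
    obtain U' K where "open U'" "y \<in> U'" "U' \<subseteq> U" "\<forall>k>K. \<forall>y\<in>U' - zero_set f. s k y = 0"
      using assms(6) y unfolding dimg_def by blast
    then show ?thesis
      using oc assms(4) y by (intro exI[of _ "U' \<inter> fst c - zero_set f"] exI[of _ "Suc K"]) auto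
  qed
  ultimately show ?thesis unfolding hsec_def by blast
qed

text \<open>
  Near \<open>x\<close> only the components with \<open>k \<le> K\<close> are nonzero, so adding \<open>K\<close> to the largest of their pole
  orders gives a bound \<open>R\<close> of the staircase form needed for the reduction of poles.
\<close>

lemma mer_t_pow_hol:
  assumes "f \<in> hol_sheaf A UNIV" "open U" "x \<in> U" "s \<in> dimg (zero_set f) (mer_sheaf A f) U"
  shows "\<exists>U' m h. open U' \<and> x \<in> U' \<and> h \<in> dimg {} (hol_sheaf A) U' \<and> sec_eq (zero_set f) U' ((t_act f ^^ m) s) h"
proof -
  obtain U0 K where U0: "open U0" "x \<in> U0" "U0 \<subseteq> U" "\<forall>k>K. \<forall>y\<in>U0 - zero_set f. s k y = 0"
    using assms(3,4) unfolding dimg_def by blast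
  have "\<forall>k. \<exists>W r h. open W \<and> x \<in> W \<and> h \<in> hol_sheaf A W \<and> (\<forall>y\<in>W - zero_set f. s k y = h y / f y ^ r)"
    using assms(3,4) unfolding dimg_def mer_sheaf_def by blast
  then obtain W r h where W: "\<And>k. open (W k)" "\<And>k. x \<in> W k" "\<And>k. h k \<in> hol_sheaf A (W k)"
    "\<And>k y. y \<in> W k - zero_set f \<Longrightarrow> s k y = h k y / f y ^ r k"
    by metis
  let ?U = "U0 \<inter> (\<Inter>k\<in>{..K}. W k)"
  define R where "R = K + Max (r ` {..K})"
  have R: "k + r k \<le> R" if "k \<le> K" for k
    unfolding R_def using that by (intro add_mono Max_ge) auto
  have oU: "open ?U" "x \<in> ?U" using U0 W by (auto intro!: open_Int open_INT)
  define h' where "h' k = (if k \<le> K then (\<lambda>y. f y ^ (R - k - r k) * h k y) else (\<lambda>_. 0))" for k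
  have fU: "f \<in> hol_sheaf A ?U" using hol_sheaf_mono[OF assms(1)] by blast
  obtain h2 where h2: "\<forall>k. h2 k \<in> hol_sheaf A ?U" "\<forall>k>K. h2 k = (\<lambda>_. 0)"
     "\<forall>k. \<forall>y\<in>?U - zero_set f. (t_act f ^^ R) s k y = h2 k y"
  proof (rule exE[OF pole_reduction[OF fU, of h' K R s]])
    show "h' k \<in> hol_sheaf A ?U" for k
      unfolding h'_def using hol_sheaf_mono[OF W(3)[of k], of ?U]
      by (auto intro!: hol_sheaf_mult hol_sheaf_power fU hol_sheaf_const)
    show "h' k = (\<lambda>_. 0)" if "k > K" for k using that by (simp add: h'_def)
    show "f y ^ (R - k) * s k y = h' k y" if y: "y \<in> ?U - zero_set f" for k y
    proof (cases "k \<le> K")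
      case True
      have "R - k = (R - k - r k) + r k" using R[OF True] by simp
      then have "f y ^ (R - k) = f y ^ (R - k - r k) * f y ^ r k" by (metis power_add)
      moreover have "f y \<noteq> 0" using y by (simp add: zero_set_def)
      moreover have "s k y = h k y / f y ^ r k" using W(4) y True by blast
      ultimately show ?thesis using True by (simp add: h'_def)
    next
      case False
      then show ?thesis using U0(4) y by (simp add: h'_def)
    qed
  qed blast
  have "h2 \<in> dimg {} (hol_sheaf A) ?U"
    unfolding dimg_def
  proof (intro CollectI conjI allI ballI)
    show "h2 k \<in> hol_sheaf A ?U" for k using h2(1) by blast
    show "\<exists>U' K. open U' \<and> z \<in> U' \<and> U' \<subseteq> ?U \<and> (\<forall>k>K. \<forall>y\<in>U' - {}. h2 k y = 0)" if "z \<in> ?U" for z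
      using oU(1) that h2(2) by (intro exI[of _ ?U] exI[of _ K]) simp
  qed
  moreover have "sec_eq (zero_set f) ?U ((t_act f ^^ R) s) h2"
    using h2(3) unfolding sec_eq_def by blast
  ultimately show ?thesis using oU by blast
qed

section \<open>Comparison of the \<open>V\<close>-filtrations of \<open>i\<^sub>+O\<close> and \<open>i\<^sub>+O(*f)\<close>\<close>

locale V_pair =
  O: V_germ A f "{}" "hol_sheaf A" VO x + M: V_germ A f "zero_set f" "mer_sheaf A f" VM x
  for A :: "('a::{t2_space,second_countable_topology}, 'n::finite) chart set" and f VO VM x
begin

text \<open>
  Finitely many generators of \<open>V\<^sup>1 i\<^sub>+O\<close> lie in a common \<open>V\<^sup>\<beta> i\<^sub>+O(*f)\<close>, which is stable under the
  operators of \<open>V\<^sup>0\<close>.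
\<close>

lemma germ_VO_sub_some_VM: "\<exists>\<beta>. \<forall>s\<in>O.G 1. s \<in> M.G \<beta>"
proof -
  obtain c W p and \<sigma> :: "nat \<Rightarrow> 'a dsec" where c: "c \<in> A" and W: "open W" "(x, f x) \<in> W" "W \<subseteq> fst c \<times> UNIV"
    and \<sigma>: "\<forall>i<p. \<sigma> i \<in> VO 1 (gr_preimage f W)"
    and gen: "\<forall>s\<in>O.G 1. \<exists>W' P. open W' \<and> (x, f x) \<in> W' \<and> W' \<subseteq> W \<and> (\<forall>i<p. P i \<in> V0_ops A c W') \<and>
        near_eq f x s (\<lambda>k y. \<Sum>i<p. op_act c f (P i) (\<sigma> i) k y)"
    using O.germ_generated[of 1] by (elim bexE exE conjE) (rule that)
  have oW: "open (gr_preimage f W)" "x \<in> gr_preimage f W"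
    using O.gr_preimage_open W by (auto simp: gr_preimage_def)
  have "\<forall>i. \<exists>\<gamma>. i < p \<longrightarrow> \<sigma> i \<in> M.G \<gamma>"
    using M.germ_exhaustive[OF oW dimg_hol_imp_mer[OF oW(1) O.V_dimg[OF oW(1)]]] \<sigma> by blast
  then obtain g where g: "\<And>i. i < p \<Longrightarrow> \<sigma> i \<in> M.G (g i)" by metis
  define \<beta> where "\<beta> = Min (insert 0 (g ` {..<p}))"
  have \<sigma>\<beta>: "\<sigma> i \<in> M.G \<beta>" if "i < p" for i
    using M.germ_decr[OF _ g[OF that], of \<beta>] that unfolding \<beta>_def by simp
  have "s \<in> M.G \<beta>" if s1: "s \<in> O.G 1" for s
  proof -
    obtain W' P where W': "open W'" "(x, f x) \<in> W'" "W' \<subseteq> W" "\<forall>i<p. P i \<in> V0_ops A c W'"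
        "near_eq f x s (\<lambda>k y. \<Sum>i<p. op_act c f (P i) (\<sigma> i) k y)"
      using bspec[OF gen s1] by (elim exE conjE) (rule that)
    have "W' \<subseteq> fst c \<times> UNIV" using W' W by blast
    then have "op_act c f (P i) (\<sigma> i) \<in> M.G \<beta>" if "i < p" for i
      using M.germ_op[OF c W'(1) _ W'(2) _ \<sigma>\<beta>[OF that]] W'(4) that by blast
    then have "(\<lambda>k y. \<Sum>i<p. op_act c f (P i) (\<sigma> i) k y) \<in> M.G \<beta>"
      by (rule lin_closed_sum[OF M.germ_lin])
    then show ?thesis by (rule M.germ_cong[OF W'(5)])
  qed
  then show ?thesis by blast
qed

text \<open>
  With \<open>V\<^sup>1 i\<^sub>+O \<subseteq> V\<^sup>\<beta> i\<^sub>+O(*f)\<close>, multiplication by \<open>t\<^sup>n\<close> gives \<open>V\<^sup>1\<^sup>+\<^sup>n i\<^sub>+O \<subseteq> V\<^sup>\<beta>\<^sup>+\<^sup>n i\<^sub>+O(*f)\<close>, which is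
  inside \<open>V\<^sup>1\<close> for large \<open>n\<close>.  A polynomial in \<open>\<partial>\<^sub>t t\<close> with roots \<open>\<ge> 1\<close> takes \<open>s\<close> into \<open>V\<^sup>1\<^sup>+\<^sup>n i\<^sub>+O\<close>, so
  \<open>s\<close> itself has index at least \<open>1\<close>.
\<close>

lemma germ_VO_imp_VM:
  assumes "s \<in> O.G 1"
  shows "s \<in> M.G 1"
proof -
  obtain \<beta> where \<beta>: "\<forall>s\<in>O.G 1. s \<in> M.G \<beta>" using germ_VO_sub_some_VM by blast
  define n where "n = nat \<lceil>1 - \<beta>\<rceil>"
  have n: "1 \<le> \<beta> + of_nat n" unfolding n_def by linarith
  obtain R where R: "set R \<subseteq> of_rat ` {1..}" "eulers f R s \<in> O.G (1 + of_nat n)"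
    using O.germ_b_function[OF assms] by blast
  obtain v where v: "v \<in> O.G 1" "near_eq f x (eulers f R s) ((t_act f ^^ n) v)"
    using O.germ_t_pow_surj[OF R(2)] by auto
  have "(t_act f ^^ n) v \<in> M.G 1"
    using M.germ_decr[OF n M.germ_t_pow] \<beta> v(1) by blast
  then have "eulers f R s \<in> M.G 1" using M.germ_cong v(2) by blast
  then show ?thesis using M.germ_climb[OF _ _ R(1)] \<beta> assms by blast
qed

text \<open>
  Here \<open>\<partial>\<^sub>t t u\<close> lies in \<open>V\<^sup>0\<close>, so the polynomial with the single root \<open>0\<close> takes \<open>u\<close> into \<open>V\<^sup>0\<close>.
\<close>

lemma germ_VM_t_inverse:
  assumes "open U" "x \<in> U" "u \<in> dimg (zero_set f) (mer_sheaf A f) U" "t_act f u \<in> M.G 1"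
  shows "u \<in> M.G 0"
proof -
  obtain \<gamma> where \<gamma>: "u \<in> M.G \<gamma>" using M.germ_exhaustive[OF assms(1-3)] by blast
  have "eulers f [0] u \<in> M.G 0"
    using M.germ_dt[OF assms(4)] by (simp add: euler_def)
  then show ?thesis
    by (rule M.germ_climb[OF \<gamma>]) (auto intro!: image_eqI[of _ _ 0])
qed

lemma mer_t_pow_germ_VO:
  assumes "open U" "x \<in> U" "s \<in> dimg (zero_set f) (mer_sheaf A f) U"
  shows "\<exists>m. \<forall>m'\<ge>m. (t_act f ^^ m') s \<in> O.G 1"
proof -
  obtain U' m h where h: "open U'" "x \<in> U'" "h \<in> dimg {} (hol_sheaf A) U'" "sec_eq (zero_set f) U' ((t_act f ^^ m) s) h"
    using mer_t_pow_hol[OF O.hol assms] by blast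
  obtain \<gamma> where \<gamma>: "h \<in> O.G \<gamma>" using O.germ_exhaustive[OF h(1-3)] by blast
  have "near_eq f x ((t_act f ^^ m) s) h" unfolding near_eq_def using h by blast
  then have s: "(t_act f ^^ m) s \<in> O.G \<gamma>" using O.germ_cong \<gamma> by blast
  define n where "n = nat \<lceil>1 - \<gamma>\<rceil>"
  have "(t_act f ^^ m') s \<in> O.G 1" if m': "m' \<ge> m + n" for m'
  proof -
    have "1 - \<gamma> \<le> of_nat n" unfolding n_def by linarith
    moreover have "(of_nat n :: rat) \<le> of_nat (m' - m)" using m' by simp
    ultimately have n: "1 \<le> \<gamma> + of_nat (m' - m)" by linarith
    have "(t_act f ^^ (m' - m)) ((t_act f ^^ m) s) \<in> O.G 1"
      by (rule O.germ_decr[OF n O.germ_t_pow[OF s]])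
    moreover have "(t_act f ^^ (m' - m)) ((t_act f ^^ m) s) = (t_act f ^^ m') s"
      using m' by (simp add: funpow_add[symmetric, THEN fun_cong, unfolded o_apply])
    ultimately show ?thesis by simp
  qed
  then show ?thesis by blast
qed

text \<open>
  One power of \<open>t\<close> suffices for finitely many generators of \<open>V\<^sup>1 i\<^sub>+O(*f)\<close>, and the sections with
  denominator \<open>t\<^sup>m\<close> are stable under the operators of \<open>V\<^sup>0\<close>.  The power has to be
  independent of \<open>s\<close>: the comparison below applies it to a section obtained by division by \<open>t\<^sup>m\<close>.
\<close>

lemma germ_VM_denominator: "\<exists>m. \<forall>s\<in>M.G 1. (t_act f ^^ m) s \<in> O.G 1"
proof -
  obtain c W p and \<sigma> :: "nat \<Rightarrow> 'a dsec" where c: "c \<in> A" and W: "open W" "(x, f x) \<in> W" "W \<subseteq> fst c \<times> UNIV"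
    and \<sigma>: "\<forall>i<p. \<sigma> i \<in> VM 1 (gr_preimage f W)"
    and gen: "\<forall>s\<in>M.G 1. \<exists>W' P. open W' \<and> (x, f x) \<in> W' \<and> W' \<subseteq> W \<and> (\<forall>i<p. P i \<in> V0_ops A c W') \<and>
        near_eq f x s (\<lambda>k y. \<Sum>i<p. op_act c f (P i) (\<sigma> i) k y)"
    using M.germ_generated[of 1] by (elim bexE exE conjE) (rule that)
  have oW: "open (gr_preimage f W)" "x \<in> gr_preimage f W"
    using O.gr_preimage_open W by (auto simp: gr_preimage_def)
  have dim: "\<sigma> i \<in> dimg (zero_set f) (mer_sheaf A f) (gr_preimage f W)" if "i < p" for i
    using M.V_dimg[OF oW(1)] \<sigma> that by blast
  have "\<forall>i. \<exists>m. i < p \<longrightarrow> (\<forall>m'\<ge>m. (t_act f ^^ m') (\<sigma> i) \<in> O.G 1)"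
    using mer_t_pow_germ_VO[OF oW dim] by blast
  then obtain mi where mi: "\<And>i m'. i < p \<Longrightarrow> m' \<ge> mi i \<Longrightarrow> (t_act f ^^ m') (\<sigma> i) \<in> O.G 1" by metis
  define m where "m = Max (insert 0 (mi ` {..<p}))"
  have \<sigma>m: "(t_act f ^^ m) (\<sigma> i) \<in> O.G 1" if "i < p" for i
    by (rule mi[OF that]) (use that in \<open>simp add: m_def\<close>)
  let ?L = "{s. (t_act f ^^ m) s \<in> O.G 1}"
  have L: "lin_closed ?L"
    unfolding lin_closed_def
  proof (intro conjI allI ballI)
    have "(t_act f ^^ m) (\<lambda>_ _. 0) = (\<lambda>_ _. 0)"
      using t_pow_lin[of m f 0 "\<lambda>_ _. 0" 0 "\<lambda>_ _. 0"] by simp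
    then show "(\<lambda>_ _. 0) \<in> ?L" using O.germ_lin[of 1] unfolding lin_closed_def by simp
  next
    fix a b s s' assume "s \<in> ?L" "s' \<in> ?L"
    then show "(\<lambda>k y. a * s k y + b * s' k y) \<in> ?L"
      using lin_closedD[OF O.germ_lin] unfolding mem_Collect_eq t_pow_lin by blast
  qed
  have "(t_act f ^^ m) s \<in> O.G 1" if s1: "s \<in> M.G 1" for s
  proof -
    obtain W' P where W': "open W'" "(x, f x) \<in> W'" "W' \<subseteq> W" "\<forall>i<p. P i \<in> V0_ops A c W'"
        "near_eq f x s (\<lambda>k y. \<Sum>i<p. op_act c f (P i) (\<sigma> i) k y)"
      using bspec[OF gen s1] by (elim exE conjE) (rule that)
    have W'c: "W' \<subseteq> fst c \<times> UNIV" using W' W by blast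
    have "op_act c f (P i) (\<sigma> i) \<in> ?L" if i: "i < p" for i
    proof -
      have "is_chart c" using O.charts c by blast
      from mer_hsec[OF this c O.hol O.closed_Z oW(1) dim[OF i]]
      have "\<sigma> i \<in> hsec c (gr_preimage f W \<inter> fst c - zero_set f)" .
      moreover have "P i \<in> V0_ops A c W'" using W'(4) i by blast
      ultimately show ?thesis
        using O.op_act_denominator[OF c W'(1) W'c W'(2) _ oW _ \<sigma>m[OF i]] by blast
    qed
    then have "(\<lambda>k y. \<Sum>i<p. op_act c f (P i) (\<sigma> i) k y) \<in> ?L" by (rule lin_closed_sum[OF L])
    then show ?thesis using O.germ_cong[OF near_eq_t_pow[OF W'(5), of m]] by simp
  qed
  then show ?thesis by blast
qed

text \<open>
  Two polynomials in \<open>\<partial>\<^sub>t t\<close> take \<open>s\<close> into \<open>V\<^sup>1\<^sup>-\<^sup>m i\<^sub>+O\<close>.  One has roots \<open>\<ge> 1\<close> and comes from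
  \<open>V\<^sup>1\<^sup>+\<^sup>m i\<^sub>+O(*f) = t\<^sup>m V\<^sup>1 i\<^sub>+O(*f) \<subseteq> V\<^sup>1 i\<^sub>+O\<close>.  The other is \<open>\<partial>\<^sub>t\<^sup>m t\<^sup>m\<close>, with roots \<open>\<le> 0\<close>.  Hence \<open>s\<close> is a
  section of \<open>i\<^sub>+O\<close>, and the first polynomial shows that its index is at least \<open>1\<close>.
\<close>

lemma germ_VM_imp_VO:
  assumes "s \<in> M.G 1"
  shows "s \<in> O.G 1"
proof -
  obtain m where m: "\<forall>s\<in>M.G 1. (t_act f ^^ m) s \<in> O.G 1" using germ_VM_denominator by blast
  obtain R where R: "set R \<subseteq> of_rat ` {1..}" "eulers f R s \<in> M.G (1 + of_nat m)"
    using M.germ_b_function[OF assms] by blast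
  obtain v where v: "v \<in> M.G 1" "near_eq f x (eulers f R s) ((t_act f ^^ m) v)"
    using M.germ_t_pow_surj[OF R(2)] by auto
  have 1: "eulers f R s \<in> O.G 1" using O.germ_cong[OF v(2)] m v(1) by blast
  let ?R' = "rev (map (\<lambda>j. - of_nat j) [0..<m]) :: complex list"
  have 2: "eulers f ?R' s \<in> O.G (1 - of_nat m)"
    using O.germ_dt_pow[of "(t_act f ^^ m) s" 1 m] m assms by (simp add: dt_pow_t_pow)
  have "set R \<inter> set ?R' = {}"
  proof (rule ccontr)
    assume "set R \<inter> set ?R' \<noteq> {}"
    then obtain z where z: "z \<in> set R" "z \<in> set ?R'" by blast
    obtain q :: rat where q: "q \<ge> 1" "z = of_rat q" using R(1) z(1) by auto
    obtain j :: nat where "z = - of_nat j" using z(2) by auto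
    with q have "of_rat q = (- of_nat j :: complex)" "q \<ge> 1" by simp_all
    then have "of_rat q = (of_rat (- of_nat j) :: complex)" by (simp add: of_rat_minus)
    then have "q = - of_nat j" by (simp only: of_rat_eq_iff)
    with \<open>q \<ge> 1\<close> show False by simp
  qed
  then have "s \<in> O.G (1 - of_nat m)"
    using O.germ_coprime[OF _ 2] O.germ_decr[OF _ 1, of "1 - of_nat m"] by simp
  from O.germ_climb[OF this 1 R(1)] show ?thesis .
qed

end

section \<open>The Hodge filtration\<close>

text \<open>
  Needed because \<open>X\<close> may be disconnected, so that \<open>f\<close> may vanish on whole components.  Where it
  does not, a holomorphic function is determined by its values off the zero set.
\<close>

lemma zero_set_dichotomy:
  assumes "complex_manifold A" "f \<in> hol_sheaf A UNIV"
  shows "\<exists>N. open N \<and> x \<in> N \<and> (N \<subseteq> zero_set f \<or> (\<forall>G. open G \<longrightarrow> G \<subseteq> N \<inter> zero_set f \<longrightarrow> G = {}))"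
proof -
  obtain c where c: "c \<in> A" "x \<in> fst c" using assms(1) unfolding complex_manifold_def by blast
  have ch: "is_chart c" using assms(1) c unfolding complex_manifold_def by blast
  obtain U \<phi> where U: "c = (U, \<phi>)" by (cases c)
  have oU: "open U" "continuous_on U \<phi>" "open (\<phi> ` U)"
    using ch unfolding U is_chart_def homeomorphism_def by auto
  have "\<phi> x \<in> \<phi> ` U" using c U by auto
  then obtain e where e: "e > 0" "ball (\<phi> x) e \<subseteq> \<phi> ` U" using oU(3) open_contains_ball by blast
  let ?B = "ball (\<phi> x) e"
  let ?F = "\<lambda>z. f (inv_into U \<phi> z)"
  define N where "N = U \<inter> \<phi> -` ?B"
  have N: "open N" "x \<in> N"
    unfolding N_def using continuous_open_preimage[OF oU(2,1) open_ball] e(1) c U by auto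
  have F: "cdiff_at ?F z" if "z \<in> ?B" for z
  proof -
    obtain y where "y \<in> U" "z = \<phi> y" using e(2) \<open>z \<in> ?B\<close> by blast
    then show ?thesis using assms(2) c(1) unfolding U hol_sheaf_def by auto
  qed
  have "N \<subseteq> zero_set f" if G: "open G" "G \<subseteq> N \<inter> zero_set f" "p \<in> G" for G p
  proof
    fix y assume y: "y \<in> N"
    have GU: "G \<subseteq> fst c" using G(2) unfolding N_def U by auto
    have "?F (\<phi> y) = 0"
    proof (rule cdiff_zero_on_convex[of ?B ?F "\<phi> ` G" "\<phi> p"])
      show "open (\<phi> ` G)" using is_chart_open_image[OF ch G(1) GU] by (simp add: U)
      show "\<phi> ` G \<subseteq> ?B" using G(2) unfolding N_def by auto
      show "?F z = 0" if z: "z \<in> \<phi> ` G" for z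
      proof -
        obtain q where q: "q \<in> G" "z = \<phi> q" using z by blast
        then have "inv_into U \<phi> z = q" using is_chart_inv[OF ch, of q] GU U by auto
        then show ?thesis using q G(2) by (auto simp: zero_set_def)
      qed
      show "\<phi> y \<in> ?B" using y unfolding N_def by blast
    qed (use G(3) F in auto)
    moreover have "inv_into U \<phi> (\<phi> y) = y" using is_chart_inv[OF ch, of y] y U unfolding N_def by auto
    ultimately show "y \<in> zero_set f" by (simp add: zero_set_def)
  qed
  then show ?thesis using N by blast
qed

text \<open>
  The \<open>\<delta>\<close>-coefficient of \<open>b\<close> is recovered from \<open>v = t b\<close>, as
  \<open>j! v\<^sub>j / f\<^sup>j\<^sup>+\<^sup>1 = j! b\<^sub>j / f\<^sup>j - (j+1)! b\<^sub>j\<^sub>+\<^sub>1 / f\<^sup>j\<^sup>+\<^sup>1\<close>.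
\<close>

lemma hodge_sum_telescope:
  assumes "(f y :: complex) \<noteq> 0"
  shows "(\<Sum>j\<le>n. fact j * t_act f b j y / f y ^ (j + 1)) = b 0 y - fact (n + 1) * b (n + 1) y / f y ^ (n + 1)"
proof (induction n)
  case 0
  then show ?case using assms by (simp add: t_act_def field_simps)
next
  case (Suc n)
  have "fact (Suc n) * t_act f b (Suc n) y / f y ^ (Suc n + 1) =
     fact (n + 1) * b (n + 1) y / f y ^ (n + 1) - fact (Suc n + 1) * b (Suc n + 1) y / f y ^ (Suc n + 1)"
    using assms by (simp add: t_act_def field_simps)
  then show ?case using Suc.IH by simp
qed

text \<open>
  The inverse of \<open>t\<close> on sections of order at most \<open>k\<close>.  Its component \<open>i = 0\<close> is the sum
  \<open>\<Sum>\<^sub>j j! v\<^sub>j / f\<^sup>j\<^sup>+\<^sup>1\<close> that defines the Hodge filtration.  For \<open>i > k\<close> the truncated difference leaves the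
  term \<open>v\<^sub>i / f\<close>, which is zero.
\<close>

definition t_inverse :: "('a \<Rightarrow> complex) \<Rightarrow> nat \<Rightarrow> 'a dsec \<Rightarrow> 'a dsec" where
  "t_inverse f k v i y = (\<Sum>l\<le>k - i. fact l * (of_nat ((l + i) choose i) * v (l + i) y) / f y ^ (l + 1))"

lemma choose_absorb: "of_nat (l + 1) * of_nat ((l + 1 + i) choose i) = (of_nat (i + 1) * of_nat ((l + Suc i) choose Suc i) :: complex)"
proof -
  have "(l + 1) * ((l + 1 + i) choose i) = (i + 1) * ((l + Suc i) choose Suc i)"
  proof -
    have "(i + 1) * ((l + Suc i) choose Suc i) = (l + Suc i) * ((l + i) choose i)"
      using Suc_times_binomial[of i "l + i"] by simp
    moreover have "(l + 1) * ((l + 1 + i) choose (l + 1)) = (l + 1 + i) * ((l + i) choose l)"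
      using Suc_times_binomial[of l "l + i"] by simp
    moreover have "(l + i) choose l = (l + i) choose i" using binomial_symmetric[of l "l + i"] by simp
    moreover have "(l + 1 + i) choose (l + 1) = (l + 1 + i) choose i"
      using binomial_symmetric[of "l + 1" "l + 1 + i"] by simp
    ultimately show ?thesis by simp
  qed
  then show ?thesis by (metis of_nat_mult)
qed

text \<open>
  The factor \<open>l! (l+i choose i) = (l+i)! / i!\<close> solves the recursion \<open>f u\<^sub>i - (i+1) u\<^sub>i\<^sub>+\<^sub>1 = v\<^sub>i\<close> downwards
  from \<open>u\<^sub>k\<^sub>+\<^sub>1 = 0\<close>.
\<close>

lemma t_act_t_inverse:
  assumes "(f y :: complex) \<noteq> 0" "\<And>j. j > k \<Longrightarrow> v j y = 0"
  shows "t_act f (t_inverse f k v) i y = v i y"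
proof (cases "i < k")
  case False
  then have "t_inverse f k v (i + 1) y = 0" unfolding t_inverse_def using assms(2)[of "i + 1"] by simp
  moreover have "t_inverse f k v i y = v i y / f y" unfolding t_inverse_def using False by simp
  ultimately show ?thesis using assms(1) by (simp add: t_act_def)
next
  case True
  define n where "n = k - (i + 1)"
  have n: "k - i = Suc n" "k - (i + 1) = n" using True by (auto simp: n_def)
  have "f y * t_inverse f k v i y = (\<Sum>l\<le>Suc n. fact l * (of_nat ((l + i) choose i) * v (l + i) y) / f y ^ l)"
    unfolding t_inverse_def n(1) sum_distrib_left using assms(1) by (intro sum.cong) (auto simp: field_simps)
  also have "\<dots> = v i y + (\<Sum>l\<le>n. fact (Suc l) * (of_nat ((Suc l + i) choose i) * v (Suc l + i) y) / f y ^ Suc l)"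
    by (subst sum.atMost_Suc_shift) simp
  also have "(\<Sum>l\<le>n. fact (Suc l) * (of_nat ((Suc l + i) choose i) * v (Suc l + i) y) / f y ^ Suc l)
     = of_nat (i + 1) * t_inverse f k v (i + 1) y"
    unfolding t_inverse_def n(2) sum_distrib_left
  proof (rule sum.cong[OF refl])
    fix l
    have "of_nat (Suc l) * of_nat ((Suc l + i) choose i) = (of_nat (i + 1) * of_nat ((l + (i + 1)) choose (i + 1)) :: complex)"
      using choose_absorb[of l i] by simp
    then have "fact (Suc l) * (of_nat ((Suc l + i) choose i) * v (Suc l + i) y) =
       of_nat (i + 1) * (fact l * (of_nat ((l + (i + 1)) choose (i + 1)) * v (l + (i + 1)) y))"
      by (simp add: fact_Suc mult.assoc mult.left_commute del: of_nat_Suc)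
    then show "fact (Suc l) * (of_nat ((Suc l + i) choose i) * v (Suc l + i) y) / f y ^ Suc l =
       of_nat (i + 1) * (fact l * (of_nat ((l + (i + 1)) choose (i + 1)) * v (l + (i + 1)) y) / f y ^ (l + 1))"
      by simp
  qed
  finally show ?thesis by (simp add: t_act_def)
qed

lemma t_inverse_dimg:
  assumes "open U" "f \<in> hol_sheaf A UNIV" "\<And>j. v j \<in> hol_sheaf A U" "\<And>j. j > k \<Longrightarrow> v j = (\<lambda>_. 0)"
  shows "(\<lambda>i y. a * t_inverse f k v (i + e) y) \<in> dimg (zero_set f) (mer_sheaf A f) U"
  unfolding dimg_def
proof (intro CollectI conjI allI ballI)
  have fU: "f \<in> hol_sheaf A U" using hol_sheaf_mono[OF assms(2)] by blast
  fix i
  let ?h = "\<lambda>y. a * (\<Sum>l\<le>k - (i + e). fact l * (of_nat ((l + (i + e)) choose (i + e)) * v (l + (i + e)) y) * f y ^ (k - l))"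
  have h: "?h \<in> hol_sheaf A U"
    by (intro hol_sheaf_mult hol_sheaf_sum hol_sheaf_const hol_sheaf_power fU assms(3))
  have "a * t_inverse f k v (i + e) y = ?h y / f y ^ (k + 1)" if y: "y \<in> U - zero_set f" for y
  proof -
    have "f y \<noteq> 0" using y by (simp add: zero_set_def)
    have "z / f y ^ (l + 1) = z * f y ^ (k - l) / f y ^ (k + 1)" if "l \<le> k - (i + e)" for l z
    proof -
      have "f y ^ (k + 1) = f y ^ (k - l) * f y ^ (l + 1)" using that by (simp flip: power_add)
      then show ?thesis using \<open>f y \<noteq> 0\<close> by (simp add: field_simps)
    qed
    then show ?thesis
      unfolding t_inverse_def sum_divide_distrib times_divide_eq_right[symmetric]
      by (intro arg_cong[where f = "\<lambda>z. a * z"] sum.cong) auto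
  qed
  then show "(\<lambda>y. a * t_inverse f k v (i + e) y) \<in> mer_sheaf A f U"
    unfolding mer_sheaf_def using h assms(1)
    by (intro CollectI ballI exI[of _ U] exI[of _ "k + 1"] exI[of _ ?h]) auto
next
  fix x assume x: "x \<in> U"
  have "a * t_inverse f k v (i + e) y = 0" if "i > k" for i y
    unfolding t_inverse_def using assms(4) that by simp
  then show "\<exists>U' K. open U' \<and> x \<in> U' \<and> U' \<subseteq> U \<and> (\<forall>i>K. \<forall>y\<in>U' - zero_set f. a * t_inverse f k v (i + e) y = 0)"
    using assms(1) x by (intro exI[of _ U] exI[of _ k]) auto
qed

context V_pair
begin

text \<open>
  The function \<open>f(x) - t\<close> acts by \<open>\<partial>\<^sub>t\<^sup>k \<delta> \<mapsto> k \<partial>\<^sub>t\<^sup>k\<^sup>-\<^sup>1 \<delta>\<close> and preserves \<open>V\<^sup>1\<close>.  Its \<open>i\<close>-th power divided by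
  \<open>i!\<close> is the shift by \<open>i\<close> with binomial weights.
\<close>

lemma VO_binomial_shift:
  assumes "c \<in> A" "open U" "U \<subseteq> fst c" "v \<in> VO 1 U"
  shows "(\<lambda>l y. a * (of_nat ((l + i) choose i) * v (l + i) y)) \<in> VO 1 U"
proof (induction i arbitrary: a)
  have v: "v \<in> dimg {} (hol_sheaf A) U" using O.V_dimg assms by blast
  have dim: "(\<lambda>l y. a * (of_nat ((l + i) choose i) * v (l + i) y)) \<in> dimg {} (hol_sheaf A) U" for i a
    unfolding dimg_def
  proof (intro CollectI conjI allI ballI)
    show "(\<lambda>y. a * (of_nat ((l + i) choose i) * v (l + i) y)) \<in> hol_sheaf A U" for l
      by (intro hol_sheaf_mult hol_sheaf_const) (use v in \<open>auto simp: dimg_def\<close>)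
    show "\<exists>U' K. open U' \<and> z \<in> U' \<and> U' \<subseteq> U \<and> (\<forall>l>K. \<forall>y\<in>U' - {}. a * (of_nat ((l + i) choose i) * v (l + i) y) = 0)"
      if z: "z \<in> U" for z
    proof -
      obtain U' K where "open U'" "z \<in> U'" "U' \<subseteq> U" "\<forall>k>K. \<forall>y\<in>U' - {}. v k y = 0"
        using v z unfolding dimg_def by blast
      then show ?thesis by (intro exI[of _ U'] exI[of _ K]) auto
    qed
  qed
  {
    case 0
    obtain w where w: "w \<in> VO 1 U" "\<forall>k. \<forall>y\<in>U - {}. w k y = a * v k y"
      using O.V_mult[OF assms(1-3) hol_sheaf_const assms(4)] by blast
    show ?case
      by (rule O.V_cong[OF assms(2) w(1) dim]) (use w(2) in \<open>simp add: sec_eq_def\<close>)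
  next
    case (Suc i)
    \<comment> \<open>By the absorption identity, applying \<open>f - t\<close> to this multiple of the \<open>i\<close>-th shift gives the next shift.\<close>
    define w where "w = (\<lambda>l y. (a / of_nat (i + 1)) * (of_nat ((l + i) choose i) * v (l + i) y))"
    have w: "w \<in> VO 1 U" unfolding w_def by (rule Suc)
    have fU: "f \<in> hol_sheaf A U" using hol_sheaf_mono[OF O.hol] by blast
    obtain w1 where w1: "w1 \<in> VO 1 U" "\<forall>k. \<forall>y\<in>U - {}. w1 k y = f y * w k y"
      using O.V_mult[OF assms(1-3) fU w] by blast
    have "t_act f w \<in> VO (1 + 1) U" using O.vf_t assms(2) w by blast
    then have "t_act f w \<in> VO 1 U" by (rule O.V_decr[OF assms(2), rotated]) simp
    from O.V_mult[OF assms(1-3) hol_sheaf_const this, of "-1"]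
    obtain w2 where w2: "w2 \<in> VO 1 U" "\<forall>k. \<forall>y\<in>U - {}. w2 k y = - 1 * t_act f w k y" by blast
    have eq: "of_nat (l + 1) * w (l + 1) y = a * (of_nat ((l + Suc i) choose Suc i) * v (l + Suc i) y)" for l y
    proof -
      have "of_nat (l + 1) * w (l + 1) y = a / of_nat (i + 1) * ((of_nat (l + 1) * of_nat ((l + 1 + i) choose i)) * v (l + Suc i) y)"
        unfolding w_def by simp
      also have "\<dots> = a * (of_nat ((l + Suc i) choose Suc i) * v (l + Suc i) y)"
        unfolding choose_absorb by (simp add: field_simps del: of_nat_Suc of_nat_add)
      finally show ?thesis .
    qed
    show ?case
    proof (rule O.V_cong[OF assms(2) O.V_add[OF assms(2) w1(1) w2(1)] dim])
      show "sec_eq {} U (\<lambda>k y. w1 k y + w2 k y) (\<lambda>l y. a * (of_nat ((l + Suc i) choose Suc i) * v (l + Suc i) y))"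
        unfolding sec_eq_def eq[symmetric] using w1(2) w2(2) by (simp add: t_act_def)
    qed
  }
qed

text \<open>
  With \<open>u = t\<^sup>-\<^sup>1 v \<in> V\<^sup>0\<close>, the section \<open>u\<^sub>0 \<delta>\<close> differs from \<open>u\<close> by \<open>\<partial>\<^sub>t w\<close> for \<open>w\<^sub>i = -u\<^sub>i\<^sub>+\<^sub>1\<close>.  The
  coefficient \<open>u\<^sub>i\<close> is to the shift of \<open>v\<close> by \<open>i\<close> what \<open>u\<^sub>0\<close> is to \<open>v\<close>, and this shift lies in \<open>V\<^sup>1\<close> with
  order at most \<open>k - i\<close>.  So \<open>w\<close> belongs to the Hodge filtration, and not merely to the filtration by
  the order in \<open>\<partial>\<^sub>t\<close>.
\<close>

lemma hodge_decomposition: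
  assumes "open U" "x \<in> U" "(\<lambda>j. if j \<le> k then v j else (\<lambda>_. 0)) \<in> VO 1 U"
  shows "\<exists>U' w b. open U' \<and> x \<in> U' \<and> U' \<subseteq> U \<and> w \<in> hodge_filt_dimg A f VO (int k) U' \<and> b \<in> VM 0 U' \<and>
    (\<forall>i. \<forall>y\<in>U' - zero_set f. dt_act w i y + b i y =
       (if i = 0 then \<Sum>j\<le>k. fact j * v j y / f y ^ (j + 1) else 0))"
proof -
  define v' where "v' = (\<lambda>j. if j \<le> k then v j else (\<lambda>_. 0))"
  define u where "u = t_inverse f k v'"
  obtain c where c: "c \<in> A" "x \<in> fst c" using O.chart_at by blast
  have v'0: "v' j = (\<lambda>_. 0)" if "j > k" for j using that by (simp add: v'_def)
  have v'U: "v' \<in> VO 1 U" using assms(3) by (simp add: v'_def)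
  have hol: "v' j \<in> hol_sheaf A W" if "W \<subseteq> U" for W j
    using O.V_dimg[OF assms(1) v'U] hol_sheaf_mono that unfolding dimg_def by blast
  have "sec_eq (zero_set f) U (t_act f u) v'"
    unfolding sec_eq_def u_def using t_act_t_inverse[of f _ k v'] v'0 by (auto simp: zero_set_def)
  then have "near_eq f x (t_act f u) v'" unfolding near_eq_def using assms(1,2) by blast
  then have "t_act f u \<in> O.G 1" using O.germ_cong O.germI[OF assms(1,2) v'U] by blast
  then have tu: "t_act f u \<in> M.G 1" by (rule germ_VO_imp_VM)
  have "u \<in> dimg (zero_set f) (mer_sheaf A f) U"
    using t_inverse_dimg[OF assms(1) O.hol hol[OF order_refl], where k = k and a = 1 and e = 0] v'0 by (simp add: u_def)
  from germ_VM_t_inverse[OF assms(1,2) this tu] obtain U1 b where b: "open U1" "x \<in> U1" "b \<in> VM 0 U1"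
    "sec_eq (zero_set f) U1 u b" unfolding germ_def by blast
  let ?U = "U \<inter> U1 \<inter> fst c"
  have oU: "open ?U" "x \<in> ?U" using assms b c O.chart_open[OF c(1)] by auto
  define w where "w = (\<lambda>i y. - 1 * u (i + 1) y)"
  have "w \<in> dimg (zero_set f) (mer_sheaf A f) ?U"
    unfolding w_def u_def by (rule t_inverse_dimg[OF oU(1) O.hol hol]) (use v'0 in auto)
  moreover have "w j \<in> hodge_filt A f VO (int k - 1 - int j) ?U" for j
  proof (cases "j < k")
    case False
    then have "w j y = 0" for y
      unfolding w_def u_def t_inverse_def using v'0 by simp
    then show ?thesis using False by (simp add: hodge_filt_def)
  next
    case True
    define n where "n = k - (j + 1)"
    have n: "int k - 1 - int j = int n" using True by (simp add: n_def)
    \<comment> \<open>The shift of \<open>v\<close> by \<open>j + 1\<close>; the sign is that of \<open>w\<close>.\<close>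
    define d where "d = (\<lambda>l y. - 1 * (of_nat ((l + (j + 1)) choose (j + 1)) * v' (l + (j + 1)) y))"
    have v1: "v' \<in> VO 1 ?U" using O.V_restrict[OF assms(1) oU(1) _ v'U] by blast
    have d: "d \<in> VO 1 ?U" unfolding d_def by (rule VO_binomial_shift[OF c(1) oU(1) _ v1]) blast
    have d0: "d l = (\<lambda>_. 0)" if "l > n" for l
      unfolding d_def using v'0[of "l + (j + 1)"] that by (simp add: n_def)
    have d': "(\<lambda>l. if l \<le> n then d l else (\<lambda>_. 0)) = d" using d0 by (auto simp: fun_eq_iff)
    have dh: "d l \<in> hol_sheaf A ?U" for l
      using O.V_dimg[OF oU(1) d] unfolding dimg_def by blast
    have "w j y = (\<Sum>l\<le>n. fact l * d l y / f y ^ (l + 1))" for y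
      unfolding w_def u_def t_inverse_def n_def[symmetric] d_def sum_distrib_left by (intro sum.cong) auto
    then show ?thesis
      unfolding hodge_filt_def n using oU d dh d'
      by (auto intro!: exI[of _ ?U] exI[of _ d])
  qed
  ultimately have w: "w \<in> hodge_filt_dimg A f VO (int k) ?U"
    unfolding hodge_filt_dimg_def by blast
  have bU: "b \<in> VM 0 ?U" using M.V_restrict[OF b(1) oU(1) _ b(3)] by blast
  have "dt_act w i y + b i y = (if i = 0 then \<Sum>j\<le>k. fact j * v j y / f y ^ (j + 1) else 0)"
    if y: "y \<in> ?U - zero_set f" for i y
  proof -
    have bu: "b i y = u i y" for i using b(4) y unfolding sec_eq_def by auto
    have "u 0 y = (\<Sum>j\<le>k. fact j * v j y / f y ^ (j + 1))"
      unfolding u_def t_inverse_def v'_def by (intro sum.cong) auto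
    then show ?thesis by (cases i) (simp_all add: bu dt_act_def w_def)
  qed
  then show ?thesis using oU w bU by (intro exI[of _ ?U] exI[of _ w] exI[of _ b]) auto
qed

text \<open>
  The converse: \<open>v = t b\<close> lies in \<open>V\<^sup>1\<close> and has order at most \<open>k\<close>, first off the zero set, and then
  everywhere because the components of \<open>v\<close> are holomorphic.
\<close>

lemma hodge_recovery:
  assumes "open U" "x \<in> U" "b \<in> VM 0 U" "\<And>j y. j > k \<Longrightarrow> y \<in> U - zero_set f \<Longrightarrow> b j y = 0"
  shows "\<exists>U' v. open U' \<and> x \<in> U' \<and> U' \<subseteq> U \<and> (\<forall>j\<le>k. v j \<in> hol_sheaf A U') \<and>
    (\<lambda>j. if j \<le> k then v j else (\<lambda>_. 0)) \<in> VO 1 U' \<and>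
    (\<forall>y\<in>U' - zero_set f. b 0 y = (\<Sum>j\<le>k. fact j * v j y / f y ^ (j + 1)))"
proof -
  obtain N where N: "open N" "x \<in> N" and dich: "N \<subseteq> zero_set f \<or> (\<forall>G. open G \<longrightarrow> G \<subseteq> N \<inter> zero_set f \<longrightarrow> G = {})"
    using zero_set_dichotomy[OF O.manifold O.hol] by blast
  show ?thesis
  proof (cases "N \<subseteq> zero_set f")
    case True
    have oU: "open (U \<inter> N)" using assms(1) N(1) by auto
    \<comment> \<open>There are no points off the zero set, so the zero section does.\<close>
    have "(\<lambda>j. if j \<le> k then (\<lambda>_. 0) else (\<lambda>_. 0)) = (\<lambda>k y. 0::complex)" by auto
    then have "(\<lambda>j. if j \<le> k then (\<lambda>_. 0) else (\<lambda>_. 0)) \<in> VO 1 (U \<inter> N)"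
      using O.V_zero[OF oU, of 1] by simp
    then show ?thesis
      using True assms(1,2) N oU
      by (intro exI[of _ "U \<inter> N"] exI[of _ "\<lambda>_ _. 0"]) (auto intro: hol_sheaf_const)
  next
    case False
    with dich have dense: "G = {}" if "open G" "G \<subseteq> N \<inter> zero_set f" for G using that by blast
    have "t_act f b \<in> M.G 1" using M.germ_t[OF M.germI[OF assms(1-3)]] by simp
    then have "t_act f b \<in> O.G 1" by (rule germ_VM_imp_VO)
    then obtain U2 v where v: "open U2" "x \<in> U2" "v \<in> VO 1 U2" "sec_eq (zero_set f) U2 (t_act f b) v"
      unfolding germ_def by blast
    let ?U = "U \<inter> U2 \<inter> N"
    have oU: "open ?U" "x \<in> ?U" using assms v N by auto
    have vU: "v \<in> VO 1 ?U" using O.V_restrict[OF v(1) oU(1) _ v(3)] by blast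
    have vh: "v j \<in> hol_sheaf A ?U" for j using O.V_dimg[OF oU(1) vU] unfolding dimg_def by blast
    have v0: "v j y = 0" if j: "j > k" and y: "y \<in> ?U" for j y
    proof -
      \<comment> \<open>A nonzero value of \<open>v\<^sub>j\<close> would persist on a nonempty open subset of the zero set.\<close>
      have "continuous_on ?U (v j)" by (rule hol_sheaf_continuous[OF O.manifold vh oU(1)])
      then have "open (?U \<inter> v j -` (- {0}))"
        by (rule continuous_open_preimage[OF _ oU(1)]) auto
      moreover have "?U \<inter> v j -` (- {0}) \<subseteq> N \<inter> zero_set f"
      proof
        fix z assume z: "z \<in> ?U \<inter> v j -` (- {0})"
        have "z \<in> zero_set f"
        proof (rule ccontr)
          assume nz: "z \<notin> zero_set f"
          then have "v j z = t_act f b j z" using v(4) z unfolding sec_eq_def by auto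
          also have "\<dots> = 0" using assms(4)[of j z] assms(4)[of "j + 1" z] j z nz by (simp add: t_act_def)
          finally show False using z by simp
        qed
        then show "z \<in> N \<inter> zero_set f" using z by blast
      qed
      ultimately have "?U \<inter> v j -` (- {0}) = {}" by (rule dense)
      then show ?thesis using y by blast
    qed
    let ?v = "\<lambda>j. if j \<le> k then v j else (\<lambda>_. 0)"
    have "?v \<in> VO 1 ?U"
    proof (rule O.V_cong[OF oU(1) vU])
      show "?v \<in> dimg {} (hol_sheaf A) ?U"
        unfolding dimg_def
      proof (intro CollectI conjI allI ballI)
        show "?v j \<in> hol_sheaf A ?U" for j using vh by (auto intro: hol_sheaf_const)
        show "\<exists>U' K. open U' \<and> z \<in> U' \<and> U' \<subseteq> ?U \<and> (\<forall>j>K. \<forall>y\<in>U' - {}. ?v j y = 0)" if "z \<in> ?U" for z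
          using oU(1) that by (intro exI[of _ ?U] exI[of _ k]) auto
      qed
      show "sec_eq {} ?U v ?v" unfolding sec_eq_def using v0 by auto
    qed
    moreover have "b 0 y = (\<Sum>j\<le>k. fact j * v j y / f y ^ (j + 1))" if y: "y \<in> ?U - zero_set f" for y
    proof -
      have fy: "f y \<noteq> 0" using y by (simp add: zero_set_def)
      have "v j y = t_act f b j y" for j using v(4) y unfolding sec_eq_def by auto
      then show ?thesis
        using hodge_sum_telescope[where f = f and y = y and n = k and b = b, OF fy] assms(4)[of "k + 1" y] y by simp
    qed
    ultimately show ?thesis
      using oU vh by (intro exI[of _ ?U] exI[of _ v]) auto
  qed
qed

end

lemma sheaf_sum_mono:
  assumes "\<And>U'. S U' \<subseteq> S' U'"
  shows "sheaf_sum A f S T U \<subseteq> sheaf_sum A f S' T U"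
proof
  fix s assume s: "s \<in> sheaf_sum A f S T U"
  have "\<exists>U'. open U' \<and> x \<in> U' \<and> U' \<subseteq> U \<and>
      (\<exists>a\<in>S' U'. \<exists>b\<in>T U'. sec_eq (zero_set f) U' s (\<lambda>k y. a k y + b k y))" if x: "x \<in> U" for x
  proof -
    obtain U' a b where "open U'" "x \<in> U'" "U' \<subseteq> U" "a \<in> S U'" "b \<in> T U'"
      "sec_eq (zero_set f) U' s (\<lambda>k y. a k y + b k y)"
      using s x unfolding sheaf_sum_def by blast
    with assms[of U'] show ?thesis by blast
  qed
  with s show "s \<in> sheaf_sum A f S' T U" unfolding sheaf_sum_def by blast
qed

theorem theorem1p1:
  fixes A :: "('a::{t2_space,second_countable_topology}, 'n::finite) chart set"
    and f :: "'a \<Rightarrow> complex"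
    and VO VM :: "rat \<Rightarrow> 'a set \<Rightarrow> 'a dsec set"
    and k :: nat
    and U :: "'a set"
  assumes "complex_manifold A"
    and "f \<in> hol_sheaf A UNIV"
    and "reduced_fun A f"
    and "\<exists>x. f x \<noteq> 0"
    and "\<not> invertible_fun A f"
    and "V_filtration A f {} (hol_sheaf A) VO"
    and "V_filtration A f (zero_set f) (mer_sheaf A f) VM"
    and "open U"
  shows "delta_part A f (hodge_filt A f VO (int k)) U =
           sheaf_sum A f (\<lambda>U. dt_act ` hodge_filt_dimg A f VO (int k) U) (VM 0) U
             \<inter> delta_part A f (mer_sheaf A f) U \<and>
         sheaf_sum A f (\<lambda>U. dt_act ` hodge_filt_dimg A f VO (int k) U) (VM 0) U
             \<inter> delta_part A f (mer_sheaf A f) U =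
           sheaf_sum A f (\<lambda>U. dt_act ` tord_filt A f (int k - 1) U) (VM 0) U
             \<inter> delta_part A f (mer_sheaf A f) U"
proof -
  let ?Z = "zero_set f"
  let ?D = "delta_part A f (hodge_filt A f VO (int k)) U"
  let ?H = "sheaf_sum A f (\<lambda>U. dt_act ` hodge_filt_dimg A f VO (int k) U) (VM 0) U \<inter> delta_part A f (mer_sheaf A f) U"
  let ?T = "sheaf_sum A f (\<lambda>U. dt_act ` tord_filt A f (int k - 1) U) (VM 0) U \<inter> delta_part A f (mer_sheaf A f) U"
  have pair: "V_pair A f VO VM"
    by unfold_locales (use assms in auto)
  have 1: "?D \<subseteq> ?H"
  proof
    fix s assume s: "s \<in> ?D"
    have dim: "s \<in> dimg ?Z (mer_sheaf A f) U" and h: "s 0 \<in> hodge_filt A f VO (int k) U"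
      and s0: "\<And>i y. i > 0 \<Longrightarrow> y \<in> U - ?Z \<Longrightarrow> s i y = 0"
      using s unfolding delta_part_def by auto
    have "\<exists>U'. open U' \<and> x \<in> U' \<and> U' \<subseteq> U \<and>
       (\<exists>a\<in>dt_act ` hodge_filt_dimg A f VO (int k) U'. \<exists>b\<in>VM 0 U'. sec_eq ?Z U' s (\<lambda>k y. a k y + b k y))"
      if x: "x \<in> U" for x
    proof -
      obtain U1 v where 1: "open U1" "x \<in> U1" "U1 \<subseteq> U" "(\<lambda>j. if j \<le> k then v j else (\<lambda>_. 0)) \<in> VO 1 U1"
        "\<And>y. y \<in> U1 - ?Z \<Longrightarrow> s 0 y = (\<Sum>j\<le>k. fact j * v j y / f y ^ (j + 1))"
        using h x unfolding hodge_filt_def by auto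
      obtain U' w b where 2: "open U'" "x \<in> U'" "U' \<subseteq> U1" "w \<in> hodge_filt_dimg A f VO (int k) U'" "b \<in> VM 0 U'"
        "\<And>i y. y \<in> U' - ?Z \<Longrightarrow> dt_act w i y + b i y = (if i = 0 then \<Sum>j\<le>k. fact j * v j y / f y ^ (j + 1) else 0)"
        using V_pair.hodge_decomposition[OF pair 1(1,2,4)] by blast
      have "sec_eq ?Z U' s (\<lambda>k y. dt_act w k y + b k y)"
        unfolding sec_eq_def
      proof (intro allI ballI)
        fix i y assume y: "y \<in> U' - ?Z"
        then have "y \<in> U1 - ?Z" "y \<in> U - ?Z" using 1(3) 2(3) by auto
        then show "s i y = dt_act w i y + b i y"
          unfolding 2(6)[OF y] using 1(5) s0[of i y] by auto
      qed
      moreover have "U' \<subseteq> U" using 1(3) 2(3) by blast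
      ultimately show ?thesis using 2(1,2,4,5) by blast
    qed
    then have "s \<in> sheaf_sum A f (\<lambda>U. dt_act ` hodge_filt_dimg A f VO (int k) U) (VM 0) U"
      unfolding sheaf_sum_def using dim by blast
    moreover have "s \<in> delta_part A f (mer_sheaf A f) U"
      using dim s0 unfolding delta_part_def dimg_def by blast
    ultimately show "s \<in> ?H" by blast
  qed
  have 2: "?H \<subseteq> ?T"
  proof -
    have "hodge_filt_dimg A f VO (int k) U' \<subseteq> tord_filt A f (int k - 1) U'" for U'
    proof
      fix s assume s: "s \<in> hodge_filt_dimg A f VO (int k) U'"
      have "s j y = 0" if j: "int j > int k - 1" and y: "y \<in> U' - ?Z" for j y
      proof -
        have "s j \<in> hodge_filt A f VO (int k - 1 - int j) U'" using s unfolding hodge_filt_dimg_def by blast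
        then show ?thesis using j y unfolding hodge_filt_def by simp
      qed
      then show "s \<in> tord_filt A f (int k - 1) U'"
        using s unfolding tord_filt_def hodge_filt_dimg_def by blast
    qed
    then have "dt_act ` hodge_filt_dimg A f VO (int k) U' \<subseteq> dt_act ` tord_filt A f (int k - 1) U'" for U'
      by (rule image_mono)
    then show ?thesis using sheaf_sum_mono[where T = "VM 0" and S = "\<lambda>U. dt_act ` hodge_filt_dimg A f VO (int k) U"
        and S' = "\<lambda>U. dt_act ` tord_filt A f (int k - 1) U" and A = A and f = f and U = U] by blast
  qed
  have 3: "?T \<subseteq> ?D"
  proof
    fix s assume s: "s \<in> ?T"
    have dim: "s \<in> dimg ?Z (mer_sheaf A f) U" and s0: "\<And>i y. i > 0 \<Longrightarrow> y \<in> U - ?Z \<Longrightarrow> s i y = 0"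
      using s unfolding delta_part_def by auto
    have "\<exists>U' v. open U' \<and> x \<in> U' \<and> U' \<subseteq> U \<and> (\<forall>j\<le>k. v j \<in> hol_sheaf A U') \<and>
              (\<lambda>j. if j \<le> k then v j else (\<lambda>_. 0)) \<in> VO 1 U' \<and>
              (\<forall>y\<in>U' - ?Z. s 0 y = (\<Sum>j\<le>k. fact j * v j y / f y ^ (j + 1)))" if x: "x \<in> U" for x
    proof -
      have "s \<in> sheaf_sum A f (\<lambda>U. dt_act ` tord_filt A f (int k - 1) U) (VM 0) U" using s by blast
      then obtain U1 w b where 1: "open U1" "x \<in> U1" "U1 \<subseteq> U" "w \<in> tord_filt A f (int k - 1) U1" "b \<in> VM 0 U1"
        "sec_eq ?Z U1 s (\<lambda>k y. dt_act w k y + b k y)"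
        unfolding sheaf_sum_def using x by blast
      have eq: "s j y = dt_act w j y + b j y" if "y \<in> U1 - ?Z" for j y
        using 1(6) that unfolding sec_eq_def by blast
      have b0: "b j y = 0" if j: "j > k" and y: "y \<in> U1 - ?Z" for j y
      proof -
        obtain i where i: "j = Suc i" "i \<ge> k" using j by (cases j) auto
        have "w i y = 0" using 1(4) i(2) y unfolding tord_filt_def by simp
        moreover have "s j y = 0" using s0[of j y] j y 1(3) by auto
        ultimately show ?thesis using eq[OF y, of j] i(1) by (simp add: dt_act_def)
      qed
      have "\<exists>U' v. open U' \<and> x \<in> U' \<and> U' \<subseteq> U1 \<and> (\<forall>j\<le>k. v j \<in> hol_sheaf A U') \<and>
          (\<lambda>j. if j \<le> k then v j else (\<lambda>_. 0)) \<in> VO 1 U' \<and>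
          (\<forall>y\<in>U' - ?Z. b 0 y = (\<Sum>j\<le>k. fact j * v j y / f y ^ (j + 1)))"
        by (rule V_pair.hodge_recovery[OF pair 1(1,2,5)]) (rule b0)
      then obtain U' v where 2: "open U'" "x \<in> U'" "U' \<subseteq> U1" "\<forall>j\<le>k. v j \<in> hol_sheaf A U'"
        "(\<lambda>j. if j \<le> k then v j else (\<lambda>_. 0)) \<in> VO 1 U'"
        "\<forall>y\<in>U' - ?Z. b 0 y = (\<Sum>j\<le>k. fact j * v j y / f y ^ (j + 1))"
        by (elim exE conjE) (rule that)
      have "s 0 y = b 0 y" if "y \<in> U' - ?Z" for y
        using eq[of y 0] that 2(3) by (auto simp: dt_act_def)
      then show ?thesis using 1(3) 2 by (intro exI[of _ U'] exI[of _ v]) auto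
    qed
    then have "s 0 \<in> hodge_filt A f VO (int k) U" unfolding hodge_filt_def by auto
    then show "s \<in> ?D" unfolding delta_part_def using dim s0 by blast
  qed
  show ?thesis
    by (intro conjI subset_antisym[OF 1 subset_trans[OF 2 3]] subset_antisym[OF 2 subset_trans[OF 3 1]])
qed

end
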